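(* There is an absolute constant $C>0$ such that for all $n\ge 1$, writing $N=5^n$, $$r_4(\mathbb{F}_5^n)\le C\,N(\log\log N)^{-2^{-21}}.$$
   Context: For a finite abelian group $G$ of order $N$ with $\gcd(6,N)=1$, $r_4(G)$ denotes the cardinality of the largest set $A\subseteq G$ which does not contain four distinct elements in arithmetic progression, i.e. four distinct elements of the form $x,x+r,x+2r,x+3r$. *)

theory Defs
  imports Complex_Main "HOL-Algebra.Product_Groups"
begin

text \<open>
  Groups are written multiplicatively as in HOL-Algebra, so the progression
  \<open>x, x + r, x + 2r, x + 3r\<close> reads \<open>x, x \<otimes> r, x \<otimes> r\<^sup>2, x \<otimes> r\<^sup>3\<close>. Degenerate
  progressions (with repeated terms) are not counted.
\<close>

definition contains_4AP :: "('a, 'b) monoid_scheme \<Rightarrow> 'a set \<Rightarrow> bool" where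
  "contains_4AP G A \<longleftrightarrow>
     (\<exists>x \<in> carrier G. \<exists>r \<in> carrier G.
        let P = [x, x \<otimes>\<^bsub>G\<^esub> r, x \<otimes>\<^bsub>G\<^esub> (r [^]\<^bsub>G\<^esub> (2::nat)), x \<otimes>\<^bsub>G\<^esub> (r [^]\<^bsub>G\<^esub> (3::nat))]
        in distinct P \<and> set P \<subseteq> A)"

text \<open>Meaningful only when \<open>carrier G\<close> is finite, so that the maximum exists.\<close>

definition r4 :: "('a, 'b) monoid_scheme \<Rightarrow> nat" where
  "r4 G = Max {card A | A. A \<subseteq> carrier G \<and> \<not> contains_4AP G A}"

text \<open>
  The additive group of the vector space of dimension \<open>n\<close> over the field with five elements;
  the scalar multiplication plays no role in \<open>r4\<close>. Coordinates are indexed by \<open>{..<n}\<close>.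
\<close>

definition F5_space :: "nat \<Rightarrow> (nat \<Rightarrow> int) monoid" where
  "F5_space n = product_group {..<n} (\<lambda>_. integer_mod_group 5)"

lemma comm_group_F5_space: "comm_group (F5_space n)"
  by (rule group.group_comm_groupI)
     (auto simp: F5_space_def add.commute intro!: ext)

lemma finite_carrier_F5_space: "finite (carrier (F5_space n))"
  by (simp add: F5_space_def carrier_integer_mod_group finite_PiE)

lemma order_F5_space: "order (F5_space n) = 5 ^ n"
  by (simp add: order_def F5_space_def carrier_integer_mod_group card_PiE)

end

theory Submission
  imports Defs "HOL-Analysis.Analysis" "HOL-Library.Function_Algebras" "HOL-Library.Product_Plus"
    "HOL-Library.Numeral_Type"
begin

text \<open>
  If a progression-free set \<open>A\<close> has density \<open>\<delta>\<close>, three applications of the Cauchy--Schwarz inequality show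
  that for many \<open>h\<close> the function \<open>x \<mapsto> f x * f (x + h)\<close>, with \<open>f = 1\<^sub>A - \<delta>\<close>, has a large Fourier coefficient
  at some frequency \<open>\<phi> h\<close>, and (Gowers) that the graph of \<open>\<phi>\<close> has many additive quadruples. Passing to
  a subset of small doubling, to a Freiman homomorphism and to the subgroup provided by Bogolyubov's argument,
  \<open>\<phi>\<close> is affine, \<open>\<phi> (h\<^sub>0 + w) = \<phi> h\<^sub>0 + \<psi> w\<close>, on a large part of a coset \<open>h\<^sub>0 + H\<close>.

  Instead of proving that \<open>\<psi>\<close> is symmetric and working with quadratic phases, we restrict to a subgroup
  \<open>W\<close> of \<open>H\<close> on which the bilinear form \<open>u \<cdot> \<psi> w\<close> vanishes identically. On cosets of \<open>W\<close> the phases are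
  linear, so that \<open>f\<close> correlates with characters there and \<open>A\<close> has increased density on a coset of a subgroup.
  As \<open>W\<close> can be found by a greedy choice with dimension a constant proportion of that of \<open>H\<close>, each step of the
  iteration divides the dimension by a bounded factor, and the increment is polynomial in \<open>\<delta>\<close>. This yields
  a bound of the shape \<open>N (log log N)\<^sup>-\<^sup>c\<close>, with room to spare in \<open>c\<close>.
\<close>

text \<open>The price of passing to \<open>W\<close> is paid in dimension: a step goes from n to
  some m with n \<le> 36 m, while the density \<delta> gains at least (\<delta>/2)^117053. So ln n
  drops by a bounded amount per step, and a bounded power of 1/\<delta> steps would exhaust the
  density. Hence ln n, which differs from ln ln N by the constant ln ln 5, is at most a constant
  times a power of 1/\<delta>. Linearisation has to control sums of six differences of points of the
  graph of \<phi>: the height \<psi> v is read off from a sum of two differences, and additivity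
  compares three such heights. Every loss must be polynomial in \<delta>, also where values of many
  characters are fixed at once. There the number of characters is the logarithm of the size of a set
  to be separated, so that fixing all their values costs only a power of that size. The exponents
  that arise are 117053 for the increment and 234050 for the required dimension; 2^21 lies well
  above both.\<close>

section \<open>The Balog--Szemeredi--Gowers theorem\<close>

lemma card_sum_of_bool:
  "finite A \<Longrightarrow> real (card {x\<in>A. P x}) = (\<Sum>x\<in>A. of_bool (P x))"
  by (subst sum_of_bool_eq) (auto intro: arg_cong[of _ _ card])

text \<open>\<open>B\<close> is the neighbourhood of a random vertex x. On average it is large, by
  Cauchy-Schwarz, and contains few bad pairs, because a bad pair has few common neighbours and so
  rarely lies in the neighbourhood of x. The set \<open>B'\<close> consists of the points with few
  bad partners in \<open>B\<close>.\<close>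

lemma dependent_random_choice:
  fixes A :: "'v set" and \<gamma> :: real
  assumes fin: "finite A" and sym: "\<And>x y. R x y \<Longrightarrow> R y x" and \<gamma>: "\<gamma> > 0"
    and dense: "real (card {p\<in>A\<times>A. R (fst p) (snd p)}) \<ge> \<gamma> * (card A)^2"
    and ne: "A \<noteq> {}"
  defines "good \<equiv> \<lambda>a b. real (card {x\<in>A. R a x \<and> R x b}) \<ge> \<gamma>^2 / 16 * card A"
  shows "\<exists>B B'. B \<subseteq> A \<and> B' \<subseteq> B \<and> real (card B)^2 \<ge> \<gamma>^2/2 * (card A)^2 \<and> 2 * card B' \<ge> card B
     \<and> (\<forall>a\<in>B'. \<forall>b\<in>B'. 2 * card {y\<in>B. good a y \<and> good y b} \<ge> card B)"
proof -
  define N where "N x = {a\<in>A. R x a}" for x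
  define m where "m = real (card A)"
  have m0: "m > 0" using fin ne by (simp add: m_def card_gt_0_iff)
  have finN: "finite (N x)" for x using fin by (simp add: N_def)
  have good_sym: "good a b \<Longrightarrow> good b a" for a b
  proof -
    assume "good a b"
    moreover have "{x\<in>A. R a x \<and> R x b} = {x\<in>A. R b x \<and> R x a}" using sym by blast
    ultimately show "good b a" by (simp add: good_def)
  qed
  define bad where "bad x = card {p\<in>N x \<times> N x. \<not> good (fst p) (snd p)}" for x
  have s1: "(\<Sum>x\<in>A. real (card (N x))) \<ge> \<gamma> * m^2"
  proof -
    have "real (card {p\<in>A\<times>A. R (fst p) (snd p)}) = (\<Sum>p\<in>A\<times>A. of_bool (R (fst p) (snd p)))"
      using fin by (intro card_sum_of_bool) auto
    also have "\<dots> = (\<Sum>x\<in>A. \<Sum>y\<in>A. of_bool (R x y))"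
      unfolding sum.cartesian_product by (simp only: case_prod_unfold)
    also have "\<dots> = (\<Sum>x\<in>A. real (card (N x)))"
      unfolding N_def using fin by (simp add: card_sum_of_bool del: sum_of_bool_eq)
    finally show ?thesis using dense by (simp add: m_def)
  qed
  have s2: "(\<Sum>x\<in>A. real (card (N x))^2) \<ge> \<gamma>^2 * m^3"
  proof -
    have "(\<gamma> * m^2)^2 \<le> (\<Sum>x\<in>A. real (card (N x)))^2"
      using s1 \<gamma> m0 by (intro power_mono) auto
    also have "\<dots> \<le> (\<Sum>x\<in>A. real (card (N x))^2) * m"
      unfolding m_def by (rule sum_squared_le_sum_of_squares)
    finally have "\<gamma>^2 * m^3 * m \<le> (\<Sum>x\<in>A. real (card (N x))^2) * m"
      by (simp add: power_mult_distrib algebra_simps eval_nat_numeral)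
    thus ?thesis using m0 by simp
  qed
  have s3: "(\<Sum>x\<in>A. real (bad x)) \<le> \<gamma>^2/16 * m^3"
  proof -
    have "real (bad x) = (\<Sum>p\<in>A\<times>A. of_bool (R x (fst p) \<and> R x (snd p) \<and> \<not> good (fst p) (snd p)))" if "x\<in>A" for x
    proof -
      have "{p\<in>N x \<times> N x. \<not> good (fst p) (snd p)} = {p\<in>A\<times>A. R x (fst p) \<and> R x (snd p) \<and> \<not> good (fst p) (snd p)}"
        by (auto simp: N_def)
      thus ?thesis unfolding bad_def using fin by (simp add: card_sum_of_bool del: sum_of_bool_eq)
    qed
    hence "(\<Sum>x\<in>A. real (bad x)) = (\<Sum>x\<in>A. \<Sum>p\<in>A\<times>A. of_bool (R x (fst p) \<and> R x (snd p) \<and> \<not> good (fst p) (snd p)))"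
      by simp
    also have "\<dots> = (\<Sum>p\<in>A\<times>A. \<Sum>x\<in>A. of_bool (R x (fst p) \<and> R x (snd p) \<and> \<not> good (fst p) (snd p)))"
      by (rule sum.swap)
    also have "\<dots> \<le> (\<Sum>p\<in>A\<times>A. \<gamma>^2/16 * m)"
    proof (rule sum_mono)
      fix p assume "p \<in> A\<times>A"
      show "(\<Sum>x\<in>A. of_bool (R x (fst p) \<and> R x (snd p) \<and> \<not> good (fst p) (snd p))) \<le> \<gamma>^2/16 * m"
      proof (cases "good (fst p) (snd p)")
        case True thus ?thesis using m0 by simp
      next
        case False
        have "(\<Sum>x\<in>A. of_bool (R x (fst p) \<and> R x (snd p) \<and> \<not> good (fst p) (snd p))) = 
          real (card {x\<in>A. R (fst p) x \<and> R x (snd p)})"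
          using fin False sym by (simp add: card_sum_of_bool del: sum_of_bool_eq) (intro sum.cong, auto)
        also have "\<dots> \<le> \<gamma>^2/16 * m" using False by (simp add: good_def m_def)
        finally show ?thesis .
      qed
    qed
    also have "\<dots> = \<gamma>^2/16 * m^3" by (simp add: card_cartesian_product m_def power3_eq_cube)
    finally show ?thesis .
  qed
  \<comment> \<open>Averaging this one difference secures size and few bad pairs simultaneously:
    \<gamma>^2 - 8 * \<gamma>^2/16 = \<gamma>^2/2. The weight 8 is what makes at most half of
    \<open>B\<close> have more than a quarter of \<open>B\<close> as bad partners.\<close>
  have "(\<Sum>x\<in>A. \<gamma>^2/2 * m^2) \<le> (\<Sum>x\<in>A. real (card (N x))^2 - 8 * real (bad x))"
  proof -
    have "(\<Sum>x\<in>A. \<gamma>^2/2 * m^2) = \<gamma>^2/2 * m^3" by (simp add: m_def power3_eq_cube power2_eq_square)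
    moreover have "(\<Sum>x\<in>A. real (card (N x))^2 - 8 * real (bad x)) = 
       (\<Sum>x\<in>A. real (card (N x))^2) - 8 * (\<Sum>x\<in>A. real (bad x))"
      by (simp add: sum_subtractf sum_distrib_left)
    ultimately show ?thesis using s2 s3 by linarith
  qed
  then obtain x where x: "x\<in>A" and xb: "\<gamma>^2/2 * m^2 \<le> real (card (N x))^2 - 8 * real (bad x)"
    using sum_strict_mono[OF fin ne, of "\<lambda>x. real (card (N x))^2 - 8 * real (bad x)" "\<lambda>x. \<gamma>^2/2 * m^2"]
    by (meson linorder_not_le)
  define B where "B = N x"
  have finB: "finite B" using finN B_def by simp
  define b where "b a = card {y\<in>B. \<not> good a y}" for a
  define B' where "B' = {a\<in>B. 4 * b a \<le> card B}"
  have badB: "real (bad x) = (\<Sum>a\<in>B. real (b a))"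
  proof -
    have "real (bad x) = (\<Sum>p\<in>B\<times>B. of_bool (\<not> good (fst p) (snd p)))"
      unfolding bad_def B_def[symmetric] using finB by (intro card_sum_of_bool) auto
    also have "\<dots> = (\<Sum>a\<in>B. real (b a))"
      unfolding b_def card_sum_of_bool[OF finB] sum.cartesian_product by (simp only: case_prod_unfold)
    finally show ?thesis .
  qed
  have B8: "8 * real (bad x) \<le> real (card B)^2" 
  proof -
    have "0 \<le> \<gamma>^2/2 * m^2" by simp
    with xb show ?thesis unfolding B_def by linarith
  qed
  have Bpos: "real (card B) > 0"
  proof -
    have "0 < \<gamma>^2/2 * m^2" using \<gamma> m0 by simp
    also have "\<dots> \<le> real (card B)^2" using xb by (simp add: B_def)
    finally show ?thesis by simp
  qed
  have "2 * card B' \<ge> card B"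
  proof -
    have "real (card (B - B')) * (card B / 4) = (\<Sum>a\<in>B-B'. card B / 4)" by simp
    also have "\<dots> \<le> (\<Sum>a\<in>B-B'. real (b a))"
      by (intro sum_mono) (auto simp: B'_def)
    also have "\<dots> \<le> (\<Sum>a\<in>B. real (b a))" using finB by (intro sum_mono2) auto
    also have "\<dots> \<le> real (card B)^2/8" using badB B8 by simp
    finally have "real (card (B - B')) * 2 \<le> real (card B)" using Bpos
      by (simp add: power2_eq_square field_simps)
    moreover have "real (card (B-B')) = real (card B) - real (card B')"
      using finB by (subst card_Diff_subset) (auto simp: B'_def card_mono of_nat_diff)
    ultimately have "real (card B) \<le> 2 * real (card B')" by simp
    thus ?thesis by linarith
  qed
  moreover have "2 * card {y\<in>B. good a y \<and> good y c} \<ge> card B" if "a\<in>B'" "c\<in>B'" for a c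
  proof -
    have "B \<subseteq> {y\<in>B. good a y \<and> good y c} \<union> {y\<in>B. \<not> good a y} \<union> {y\<in>B. \<not> good c y}"
      using good_sym by blast
    hence "card B \<le> card ({y\<in>B. good a y \<and> good y c} \<union> {y\<in>B. \<not> good a y} \<union> {y\<in>B. \<not> good c y})"
      using finB by (intro card_mono) auto
    also have "\<dots> \<le> card {y\<in>B. good a y \<and> good y c} + b a + b c"
      unfolding b_def by (meson add_le_mono card_Un_le le_trans order_refl)
    finally show ?thesis using that by (simp add: B'_def)
  qed
  moreover have "B \<subseteq> A" "B' \<subseteq> B" by (auto simp: B_def N_def B'_def)
  moreover have "real (card B)^2 \<ge> \<gamma>^2/2 * (card A)^2" using xb by (simp add: B_def m_def)
  ultimately show ?thesis by (intro exI[of _ B] exI[of _ B'] conjI ballI)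
qed

section \<open>Additive energy and popular differences\<close>

text \<open>This is the autocorrelation of the indicator function of \<open>A\<close>; its sum over
  the differences of all pairs of \<open>A\<close> is the additive energy.\<close>

definition rep :: "'a::ab_group_add set \<Rightarrow> 'a \<Rightarrow> real" where
  "rep A d = card {p\<in>A\<times>A. fst p - snd p = d}"

lemma rep_le: "finite A \<Longrightarrow> rep A d \<le> card A"
proof -
  assume f: "finite A"
  have "card {p\<in>A\<times>A. fst p - snd p = d} \<le> card A"
    by (rule card_inj_on_le[of fst _ A]) (use f in \<open>auto simp: inj_on_def\<close>)
  thus ?thesis by (simp add: rep_def)
qed

lemma rep_minus: "rep A (- d) = rep A d"
  unfolding rep_def of_nat_eq_iff
  by (rule bij_betw_same_card[of prod.swap], rule bij_betwI[of _ _ _ prod.swap]) (auto simp: algebra_simps)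

text \<open>Each intermediate point y splits a - b into (a - y) + (y - b), and different y give
  disjoint families of representations. Applied twice, it turns paths of length four into
  representations by four differences.\<close>

lemma card_rep_convolution:
  fixes f :: "'t \<Rightarrow> 'a::ab_group_add" and g :: "'u \<Rightarrow> 'a" and p q :: real
  assumes fin: "finite T" "finite U" "finite Y" and nn: "p \<ge> 0" "q \<ge> 0"
    and p: "\<And>y. y\<in>Y \<Longrightarrow> card {t\<in>T. f t = a - y} \<ge> p"
    and q: "\<And>y. y\<in>Y \<Longrightarrow> card {u\<in>U. g u = y - b} \<ge> q"
  shows "card {s\<in>T\<times>U. f (fst s) + g (snd s) = a - b} \<ge> card Y * (p * q)"
proof -
  have "card Y * (p * q) = (\<Sum>y\<in>Y. p * q)" by simp
  also have "\<dots> \<le> (\<Sum>y\<in>Y. real (card {t\<in>T. f t = a - y}) * real (card {u\<in>U. g u = y - b}))"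
    using p q nn by (intro sum_mono mult_mono) auto
  also have "\<dots> = real (card (\<Union>y\<in>Y. {t\<in>T. f t = a - y} \<times> {u\<in>U. g u = y - b}))"
    using fin by (subst card_UN_disjoint) (auto simp: card_cartesian_product)
  also have "\<dots> \<le> card {s\<in>T\<times>U. f (fst s) + g (snd s) = a - b}"
    unfolding of_nat_le_iff using fin by (intro card_mono) auto
  finally show ?thesis .
qed

lemma card_le_of_rep:
  fixes M :: real
  assumes "finite T" "finite X" "\<And>d. d\<in>X \<Longrightarrow> real (card {t\<in>T. f t = d}) \<ge> M"
  shows "card X * M \<le> card T"
proof -
  have "card X * M = (\<Sum>d\<in>X. M)" by simp
  also have "\<dots> \<le> (\<Sum>d\<in>X. real (card {t\<in>T. f t = d}))" using assms by (intro sum_mono) auto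
  also have "\<dots> = real (card (\<Union>d\<in>X. {t\<in>T. f t = d}))"
    using assms by (subst card_UN_disjoint) auto
  also have "\<dots> \<le> card T" unfolding of_nat_le_iff using assms by (intro card_mono) auto
  finally show ?thesis .
qed

text \<open>In the graph of pairs with popular difference, any two points of \<open>B'\<close> are
  joined by many paths of length four. So each difference of \<open>B'\<close> has at least M
  representations as a sum of four differences of \<open>A\<close>. There are only m^8 tuples to
  share, hence at most m^8 / M differences.\<close>

lemma balog_szemeredi_gowers:
  fixes A :: "'a::ab_group_add set" and c :: real
  assumes fin: "finite A" and ne: "A \<noteq> {}" and c: "c > 0"
    and energy: "(\<Sum>p\<in>A\<times>A. rep A (fst p - snd p)) \<ge> c * (card A)^3"
  shows "\<exists>A'\<subseteq>A. card A' \<ge> c/6 * card A \<and>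
      real (card {a - b |a b. a\<in>A' \<and> b\<in>A'}) \<le> 2^19 / c^9 * card A"
proof -
  define m where "m = real (card A)"
  have m0: "m > 0" using fin ne by (simp add: m_def card_gt_0_iff)
  \<comment> \<open>With half of the mean as threshold, the unpopular pairs carry at most half of
    the energy, so the graph has density at least c/2.\<close>
  define R where "R x y \<longleftrightarrow> rep A (x - y) \<ge> c/2 * m" for x y
  have sym: "R x y \<Longrightarrow> R y x" for x y
    unfolding R_def using rep_minus[of A "x-y"] by simp
  have dense: "real (card {p\<in>A\<times>A. R (fst p) (snd p)}) \<ge> c/2 * (card A)^2"
  proof -
    have "c * m^3 \<le> (\<Sum>p\<in>A\<times>A. rep A (fst p - snd p))" using energy by (simp add: m_def)
    also have "\<dots> \<le> (\<Sum>p\<in>A\<times>A. m * of_bool (R (fst p) (snd p)) + c/2 * m)"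
      using rep_le[OF fin] c m0 by (intro sum_mono) (auto simp: R_def m_def intro: add_increasing2)
    also have "\<dots> = m * real (card {p\<in>A\<times>A. R (fst p) (snd p)}) + c/2 * m^3"
      using fin by (simp add: card_sum_of_bool sum.distrib sum_distrib_left[symmetric] card_cartesian_product
          m_def power3_eq_cube del: sum_of_bool_eq)
    finally have "m * (c/2 * m^2) \<le> m * real (card {p\<in>A\<times>A. R (fst p) (snd p)})"
      by (simp add: power3_eq_cube power2_eq_square mult.assoc mult.left_commute[of m c])
    hence "c/2 * m^2 \<le> real (card {p\<in>A\<times>A. R (fst p) (snd p)})"
      using m0 by (simp only: mult_le_cancel_left_pos)
    thus ?thesis by (simp add: m_def)
  qed
  obtain B B' where B: "B \<subseteq> A" "B' \<subseteq> B" "real (card B)^2 \<ge> (c/2)^2/2 * (card A)^2" "2 * card B' \<ge> card B"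
    and path: "\<And>a b. a\<in>B' \<Longrightarrow> b\<in>B' \<Longrightarrow> 
      2 * card {y\<in>B. (c/2)^2/16 * card A \<le> real (card {x\<in>A. R a x \<and> R x y}) \<and> 
                     (c/2)^2/16 * card A \<le> real (card {x\<in>A. R y x \<and> R x b})} \<ge> card B"
    using dependent_random_choice[OF fin sym _ dense ne] c by auto
  have cB: "real (card B) \<ge> c/3 * m"
  proof (rule power2_le_imp_le)
    have "(c/3*m)^2 \<le> (c/2)^2/2 * m^2" using c m0 by (simp add: power2_eq_square)
    also have "\<dots> \<le> real (card B)^2" using B(3) by (simp add: m_def)
    finally show "(c/3*m)^2 \<le> real (card B)^2" .
  qed simp
  have finB: "finite B" using B fin finite_subset by auto
  define T2 where "T2 = A \<times> A"
  define f2 :: "'a \<times> 'a \<Rightarrow> 'a" where "f2 t = fst t - snd t" for t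
  define f4 where "f4 s = f2 (fst s) + f2 (snd s)" for s
  define f8 where "f8 s = f4 (fst s) + f4 (snd s)" for s
  define T4 where "T4 = T2 \<times> T2"
  define T8 where "T8 = T4 \<times> T4"
  have finT: "finite T2" "finite T4" "finite T8" using fin by (auto simp: T2_def T4_def T8_def)
  have c2: "card {t\<in>T2. f2 t = x - y} \<ge> c/2*m" if "R x y" for x y
    using that by (simp add: R_def rep_def T2_def f2_def)
  define \<kappa> where "\<kappa> = (c/2)^2/16 * m"
  have c4: "card {t\<in>T4. f4 t = a - y} \<ge> \<kappa> * (c/2*m)^2" if "real (card {x\<in>A. R a x \<and> R x y}) \<ge> \<kappa>" for a y
  proof -
    have "\<kappa> * (c/2*m)^2 \<le> card {x\<in>A. R a x \<and> R x y} * ((c/2*m) * (c/2*m))"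
      using that c m0 by (auto simp: power2_eq_square intro!: mult_right_mono)
    also have "\<dots> \<le> card {s\<in>T2\<times>T2. f2 (fst s) + f2 (snd s) = a - y}"
      using finT fin c m0 c2 by (intro card_rep_convolution) auto
    finally show ?thesis by (simp add: T4_def f4_def)
  qed
  define M where "M = card B / 2 * (\<kappa> * (c/2*m)^2 * (\<kappa> * (c/2*m)^2))"
  have \<kappa>0: "\<kappa> > 0" using c m0 by (simp add: \<kappa>_def)
  have c8: "card {t\<in>T8. f8 t = a - b} \<ge> M" if "a\<in>B'" "b\<in>B'" for a b
  proof -
    let ?Y = "{y\<in>B. \<kappa> \<le> real (card {x\<in>A. R a x \<and> R x y}) \<and> \<kappa> \<le> real (card {x\<in>A. R y x \<and> R x b})}"
    have "card B \<le> 2 * card ?Y" using path[OF that] by (simp add: \<kappa>_def m_def)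
    hence "M \<le> card ?Y * (\<kappa> * (c/2*m)^2 * (\<kappa> * (c/2*m)^2))"
      using \<kappa>0 c m0 unfolding M_def by (intro mult_right_mono) auto
    also have "\<dots> \<le> card {s\<in>T4\<times>T4. f4 (fst s) + f4 (snd s) = a - b}"
      using finT finB \<kappa>0 c m0 c4 by (intro card_rep_convolution) auto
    finally show ?thesis by (simp add: T8_def f8_def)
  qed
  let ?D = "{a - b |a b. a\<in>B' \<and> b\<in>B'}"
  have finB': "finite B'" using B finB finite_subset by auto
  have finD: "finite ?D"
    using finite_image_set2[of "\<lambda>x. x\<in>B'" "\<lambda>x. x\<in>B'" "(-)"] finB' by simp
  have "card ?D * M \<le> card T8"
    by (rule card_le_of_rep[where f=f8]) (use finT finD c8 in auto)
  also have "real (card T8) = m^8" by (simp add: T8_def T4_def T2_def card_cartesian_product m_def eval_nat_numeral)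
  finally have 1: "card ?D * M \<le> m^8" .
  \<comment> \<open>The factors are c/6 from \<open>B\<close>, (c^2/64)^2 from the two counts of
    midpoints and (c/2)^4 from the four edges; 6 * 2^16 is at most 2^19.\<close>
  have "c^9 / 2^19 * m^7 \<le> M"
  proof -
    have "c^9 / 2^19 * m^7 \<le> c/3*m/2 * (\<kappa> * (c/2*m)^2 * (\<kappa> * (c/2*m)^2))"
      unfolding \<kappa>_def using c m0 by (simp add: field_simps power_mult_distrib) (simp add: eval_nat_numeral)
    also have "\<dots> \<le> M" unfolding M_def using cB \<kappa>0 c m0 by (intro mult_right_mono) auto
    finally show ?thesis .
  qed
  hence "card ?D * (c^9 / 2^19 * m^7) \<le> m^8" using 1 by (meson mult_left_mono of_nat_0_le_iff order_trans)
  hence "(card ?D * (c^9 / 2^19)) * m^7 \<le> m * m^7" by (simp add: eval_nat_numeral algebra_simps)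
  hence "card ?D * (c^9 / 2^19) \<le> m" using m0 by simp
  hence "card ?D \<le> 2^19/c^9 * m" using c by (simp add: field_simps)
  moreover have "card B' \<ge> c/6 * card A" using cB B(4) by (simp add: m_def)
  moreover have "B' \<subseteq> A" using B by auto
  ultimately show ?thesis unfolding m_def by blast
qed

section \<open>Iterated sums of popular differences\<close>

primrec ksum :: "nat \<Rightarrow> 'a::ab_group_add set \<Rightarrow> 'a set" where
  "ksum 0 X = {0}"
| "ksum (Suc k) X = {x + y |x y. x \<in> X \<and> y \<in> ksum k X}"

lemma finite_ksum: "finite X \<Longrightarrow> finite (ksum k X)"
  by (induction k) (auto intro: finite_image_set2[of "\<lambda>x. x \<in> X" _ "(+)"])

lemma ksum_add: "x \<in> ksum i X \<Longrightarrow> y \<in> ksum j X \<Longrightarrow> x + y \<in> ksum (i + j) X"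
proof (induction i arbitrary: x)
  case (Suc i)
  then obtain u v where "x = u + v" "u \<in> X" "v \<in> ksum i X" by auto
  moreover have "v + y \<in> ksum (i + j) X" using Suc calculation by auto
  ultimately show ?case by (auto simp: add.assoc)
qed auto

lemma ksum_zero: "0 \<in> X \<Longrightarrow> 0 \<in> ksum k X"
proof (induction k)
  case (Suc k)
  hence "0 + 0 \<in> ksum (Suc k) X" unfolding ksum.simps by blast
  thus ?case by simp
qed simp

lemma ksum_mono: "X \<subseteq> Y \<Longrightarrow> ksum k X \<subseteq> ksum k Y"
proof (induction k)
  case (Suc k)
  show ?case
  proof
    fix z assume "z \<in> ksum (Suc k) X"
    then obtain x y where "z = x + y" "x \<in> X" "y \<in> ksum k X" by auto
    moreover have "x \<in> Y" "y \<in> ksum k Y" using calculation Suc by auto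
    ultimately show "z \<in> ksum (Suc k) Y" by auto
  qed
qed auto

lemma ksum_1: "x \<in> X \<Longrightarrow> x \<in> ksum 1 X"
proof -
  assume "x \<in> X"
  hence "x + 0 \<in> ksum (Suc 0) X" unfolding ksum.simps by blast
  thus ?thesis by simp
qed

lemma ksum_uminus:
  assumes "\<And>x. x \<in> X \<Longrightarrow> - x \<in> X" shows "z \<in> ksum k X \<Longrightarrow> - z \<in> ksum k X"
proof (induction k arbitrary: z)
  case (Suc k)
  then obtain x y where z: "z = x + y" "x \<in> X" "y \<in> ksum k X" by auto
  have "- x + - y \<in> ksum (Suc k) X" unfolding ksum.simps using Suc.IH[OF z(3)] assms[OF z(2)] by blast
  thus ?case using z by simp
qed auto

lemma ksum_double: "X \<subseteq> {s + t |s t. s \<in> S \<and> t \<in> S} \<Longrightarrow> ksum k X \<subseteq> ksum (2 * k) S"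
proof (induction k)
  case (Suc k)
  show ?case
  proof
    fix z assume "z \<in> ksum (Suc k) X"
    then obtain x y where z: "z = x + y" "x \<in> X" "y \<in> ksum k X" by auto
    then obtain s t where st: "x = s + t" "s \<in> S" "t \<in> S" using Suc by blast
    have "y \<in> ksum (2 * k) S" using z Suc by auto
    hence "s + (t + y) \<in> ksum (Suc (Suc (2 * k))) S" using st by auto
    thus "z \<in> ksum (2 * Suc k) S" using z st by (simp add: add.assoc)
  qed
qed auto

text \<open>
  This replaces the Pluennecke inequality: writing each popular \<open>x\<^sub>i\<close> as \<open>b\<^sub>i - c\<^sub>i\<close> in many ways turns \<open>a + x\<^sub>1 + \<dots> + x\<^sub>k\<close>
  into the telescoping sum \<open>(a - c\<^sub>1) + (b\<^sub>1 - c\<^sub>2) + \<dots> + b\<^sub>k\<close> of \<open>k\<close> differences and one element of \<open>A\<close>.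
\<close>

lemma card_popular_ksum:
  fixes A :: "'a::ab_group_add set" and \<rho> :: real
  assumes fin: "finite A" and \<rho>: "\<rho> \<ge> 0"
  shows "real (card {a + z |a z. a \<in> A \<and> z \<in> ksum k {d. rep A d \<ge> \<rho>}}) * \<rho>^k 
     \<le> real (card {a - b |a b. a \<in> A \<and> b \<in> A})^k * card A"
proof -
  let ?D = "{a - b |a b. a \<in> A \<and> b \<in> A}"
  let ?S = "{d. rep A d \<ge> \<rho>}"
  have finD: "finite ?D" using finite_image_set2[of "\<lambda>x. x\<in>A" "\<lambda>x. x\<in>A" "(-)"] fin by simp
  define T where "T k = {ds. set ds \<subseteq> ?D \<and> length ds = k} \<times> A" for k
  have finT: "finite (T k)" for k
    unfolding T_def using finite_lists_length_eq[OF finD] fin by auto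
  have cardT: "card (T k) = card ?D ^ k * card A" for k
    unfolding T_def by (simp add: card_cartesian_product card_lists_length_eq[OF finD])
  define \<sigma> :: "'a list \<times> 'a \<Rightarrow> 'a" where "\<sigma> t = sum_list (fst t) + snd t" for t
  have count: "\<rho>^k \<le> card {t \<in> T k. \<sigma> t = a + y}" if "a \<in> A" "y \<in> ksum k ?S" for a y k
    using that
  proof (induction k arbitrary: y)
    case 0
    hence "([], a) \<in> {t \<in> T 0. \<sigma> t = a + y}" by (simp add: T_def \<sigma>_def)
    hence "card {t \<in> T 0. \<sigma> t = a + y} > 0" using finT[of 0] card_gt_0_iff by fastforce
    thus ?case by simp
  next
    case (Suc k)
    then obtain x y' where y: "y = x + y'" "x \<in> ?S" "y' \<in> ksum k ?S" by auto
    let ?P = "{t \<in> T k. \<sigma> t = a + y'}" and ?Q = "{p\<in>A\<times>A. fst p - snd p = x}"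
    define g :: "('a list \<times> 'a) \<times> ('a \<times> 'a) \<Rightarrow> 'a list \<times> 'a" where
      "g u = ((snd (fst u) - snd (snd u)) # fst (fst u), fst (snd u))" for u
    have "\<rho>^k * \<rho> \<le> real (card ?P) * real (card ?Q)"
      using Suc.IH[OF Suc.prems(1) y(3)] y(2) \<rho> by (intro mult_mono) (auto simp: rep_def)
    also have "\<dots> = card (?P \<times> ?Q)" by (simp add: card_cartesian_product)
    also have "\<dots> \<le> card {t \<in> T (Suc k). \<sigma> t = a + y}"
    proof (unfold of_nat_le_iff, rule card_inj_on_le[of g])
      \<comment> \<open>The last entry of the new tuple is the first member of the pair; as the
        difference x is fixed, this gives the second member, and then the old last entry.\<close>
      show "inj_on g (?P \<times> ?Q)"
        by (auto simp: inj_on_def g_def algebra_simps)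
      show "g ` (?P \<times> ?Q) \<subseteq> {t \<in> T (Suc k). \<sigma> t = a + y}"
        by (auto simp: g_def T_def \<sigma>_def y(1) algebra_simps; (blast | metis add.commute))
      show "finite {t \<in> T (Suc k). \<sigma> t = a + y}" using finT by simp
    qed
    finally show ?case by (simp add: mult.commute)
  qed
  have finX: "finite {a + z |a z. a \<in> A \<and> z \<in> ksum k ?S}" if "\<rho> > 0"
  proof -
    have "?S \<subseteq> ?D"
    proof (rule subsetI, rule ccontr)
      fix d assume d: "d \<in> ?S" "d \<notin> ?D"
      hence e: "{p\<in>A\<times>A. fst p - snd p = d} = {}" by auto
      have "rep A d = 0" unfolding rep_def e by simp
      thus False using d(1) that by simp
    qed
    hence "finite ?S" using finD by (rule finite_subset)
    thus ?thesis using finite_image_set2[of "\<lambda>x. x\<in>A" "\<lambda>x. x\<in>ksum k ?S" "(+)"] fin finite_ksum by auto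
  qed
  show ?thesis
  \<comment> \<open>For \<rho> = 0 every element is popular and the set may be infinite; then the
    factor \<rho>^k vanishes, except for k = 0, where the set is \<open>A\<close> itself.\<close>
  proof (cases "\<rho> = 0 \<and> k \<noteq> 0")
    case True thus ?thesis by (auto simp: zero_power)
  next
    case False
    hence "finite {a + z |a z. a \<in> A \<and> z \<in> ksum k ?S}"
    proof (cases "k = 0")
      case True
      hence "{a + z |a z. a \<in> A \<and> z \<in> ksum k ?S} = A" by auto
      thus ?thesis using fin by simp
    qed (use finX \<rho> False in auto)
    hence "real (card {a + z |a z. a \<in> A \<and> z \<in> ksum k ?S}) * \<rho>^k \<le> card (T k)"
      using count finT by (intro card_le_of_rep[where f = \<sigma>]) auto
    thus ?thesis by (simp add: cardT)
  qed
qed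

text \<open>Popular differences account for half of all pairs, so for some b in \<open>A\<close>
  half of the a in \<open>A\<close> have a - b popular; these form \<open>B\<close>. Then x - y = (x
  - b) + (b - y) writes each difference of \<open>B\<close> as a sum of two popular ones, and
  popular differences can be added at controlled cost. The base 2 K^2 is the quotient of the bound K
  m for the difference set by the popularity m/(2K).\<close>

lemma small_doubling_ksum:
  fixes A :: "'a::ab_group_add set" and K :: real
  assumes fin: "finite A" and ne: "A \<noteq> {}" and K: "K > 0"
    and dbl: "card {a - b |a b. a \<in> A \<and> b \<in> A} \<le> K * card A"
  shows "\<exists>B\<subseteq>A. card A \<le> 2 * card B \<and>
    card {a + z |a z. a \<in> A \<and> z \<in> ksum k {x - y |x y. x \<in> B \<and> y \<in> B}} \<le> (2 * K^2)^(2*k) * card A"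
proof -
  define m where "m = real (card A)"
  have m0: "m > 0" using fin ne by (simp add: m_def card_gt_0_iff)
  \<comment> \<open>At most K m differences occur, so those with fewer than m/(2K) representations
    use up at most m^2/2 pairs.\<close>
  define S where "S = {d. rep A d \<ge> m / (2*K)}"
  let ?D = "{a - b |a b. a \<in> A \<and> b \<in> A}"
  have finD: "finite ?D" using finite_image_set2[of "\<lambda>x. x\<in>A" "\<lambda>x. x\<in>A" "(-)"] fin by simp
  have Dsum: "m^2 = (\<Sum>d\<in>?D. rep A d)"
  proof -
    have "(\<Sum>d\<in>?D. rep A d) = real (card (\<Union>d\<in>?D. {p\<in>A\<times>A. fst p - snd p = d}))"
      unfolding rep_def using finD fin by (subst card_UN_disjoint) auto
    also have "(\<Union>d\<in>?D. {p\<in>A\<times>A. fst p - snd p = d}) = A \<times> A"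
      by (auto, intro exI conjI, rule refl)
    finally show ?thesis by (simp add: m_def power2_eq_square card_cartesian_product)
  qed
  have "(\<Sum>d\<in>?D. rep A d) = (\<Sum>d\<in>?D\<inter>S. rep A d) + (\<Sum>d\<in>?D-S. rep A d)"
    using sum.Int_Diff[OF finD] by blast
  moreover have "(\<Sum>d\<in>?D-S. rep A d) \<le> (\<Sum>d\<in>?D-S. m/(2*K))"
    by (intro sum_mono) (auto simp: S_def)
  moreover have "(\<Sum>d\<in>?D-S. m/(2*K)) \<le> m^2/2"
  proof -
    have "(\<Sum>d\<in>?D-S. m/(2*K)) \<le> card ?D * (m/(2*K))"
      using finD m0 K by (auto intro!: mult_right_mono divide_right_mono card_mono)
    also have "\<dots> \<le> K * m * (m/(2*K))" using dbl m0 K by (intro mult_right_mono) (auto simp: m_def)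
    also have "\<dots> = m^2/2" using K by (simp add: power2_eq_square)
    finally show ?thesis .
  qed
  ultimately have "m^2/2 \<le> (\<Sum>d\<in>?D\<inter>S. rep A d)" using Dsum by linarith
  also have "\<dots> = real (card (\<Union>d\<in>?D\<inter>S. {p\<in>A\<times>A. fst p - snd p = d}))"
    unfolding rep_def using finD fin by (subst card_UN_disjoint) auto
  also have "(\<Union>d\<in>?D\<inter>S. {p\<in>A\<times>A. fst p - snd p = d}) = (\<Union>b\<in>A. {a\<in>A. a - b \<in> S} \<times> {b})"
    by (auto, intro exI conjI, rule refl)
  also have "real (card (\<Union>b\<in>A. {a\<in>A. a - b \<in> S} \<times> {b})) = (\<Sum>b\<in>A. real (card {a\<in>A. a - b \<in> S}))"
    using fin by (subst card_UN_disjoint) (auto simp: card_cartesian_product)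
  finally have "(\<Sum>b\<in>A. m/2) \<le> (\<Sum>b\<in>A. real (card {a\<in>A. a - b \<in> S}))"
    by (simp add: m_def power2_eq_square)
  then obtain b where b: "b \<in> A" "m/2 \<le> card {a\<in>A. a - b \<in> S}"
    using sum_strict_mono[OF fin ne, of "\<lambda>b. real (card {a\<in>A. a - b \<in> S})" "\<lambda>_. m/2"]
    by (meson linorder_not_le)
  define B where "B = {a\<in>A. a - b \<in> S}"
  let ?X = "{x - y |x y. x \<in> B \<and> y \<in> B}"
  have "?X \<subseteq> {s + t |s t. s \<in> S \<and> t \<in> S}"
  proof clarify
    fix x y assume "x \<in> B" "y \<in> B"
    hence "x - b \<in> S" "b - y \<in> S" using rep_minus[of A "y - b"] by (auto simp: B_def S_def)
    moreover have "x - y = (x - b) + (b - y)" by simp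
    ultimately show "\<exists>s t. x - y = s + t \<and> s \<in> S \<and> t \<in> S" by blast
  qed
  hence sub: "ksum k ?X \<subseteq> ksum (2 * k) S" by (rule ksum_double)
  let ?L = "{a + z |a z. a \<in> A \<and> z \<in> ksum (2*k) S}"
  have pos: "m / (2*K) > 0" using m0 K by simp
  have "real (card ?L) * (m/(2*K))^(2*k) \<le> real (card ?D)^(2*k) * m"
    unfolding S_def m_def[symmetric] using card_popular_ksum[OF fin, of "m/(2*K)" "2*k"] pos by (simp add: m_def)
  also have "\<dots> \<le> (K*m)^(2*k) * m" using dbl m0 by (intro mult_right_mono power_mono) (auto simp: m_def)
  also have "\<dots> = ((2*K^2)^(2*k) * m) * (m/(2*K))^(2*k)" 
  proof -
    have "K * m = (2*K^2) * (m/(2*K))" using K by (simp add: power2_eq_square)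
    hence "(K * m)^(2*k) = (2*K^2)^(2*k) * (m/(2*K))^(2*k)"
      by (simp only: power_mult_distrib[of "2*K^2" "m/(2*K)"])
    thus ?thesis by (simp only: mult_ac)
  qed
  finally have L: "real (card ?L) \<le> (2*K^2)^(2*k) * m" using pos by simp
  have finB: "finite B" using fin by (simp add: B_def)
  have "finite S"
  proof (rule finite_subset[OF _ finD], rule subsetI, rule ccontr)
    fix d assume d: "d \<in> S" "d \<notin> ?D"
    hence e: "{p\<in>A\<times>A. fst p - snd p = d} = {}" by auto
    have "rep A d = 0" unfolding rep_def e by simp
    thus False using d pos by (simp add: S_def)
  qed
  hence "finite ?L"
    using finite_image_set2[of "\<lambda>x. x\<in>A" "\<lambda>x. x\<in>ksum (2*k) S" "(+)"] fin finite_ksum by auto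
  hence "card {a + z |a z. a \<in> A \<and> z \<in> ksum k ?X} \<le> card ?L"
    by (rule card_mono) (use sub in blast)
  with L have "card {a + z |a z. a \<in> A \<and> z \<in> ksum k ?X} \<le> (2*K^2)^(2*k) * m" by linarith
  moreover have "card A \<le> 2 * card B" using b by (simp add: B_def m_def)
  moreover have "B \<subseteq> A" by (auto simp: B_def)
  ultimately show ?thesis unfolding m_def by (intro exI[of _ B] conjI)
qed

text \<open>Since \<open>A\<close> is a graph, its vertical translates by distinct y are disjoint.
  For y in the fibre over 0 they all lie in the sum of \<open>A\<close> and the iterated sumset,
  which is only a constant times larger than \<open>A\<close>.\<close>

lemma graph_vertical_fibre:
  fixes A :: "('a::ab_group_add \<times> 'b::ab_group_add) set" and K :: real
  assumes fin: "finite A" and ne: "A \<noteq> {}" and K: "K > 0" and inj: "inj_on fst A"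
    and dbl: "card {a - b |a b. a \<in> A \<and> b \<in> A} \<le> K * card A"
  shows "\<exists>B\<subseteq>A. card A \<le> 2 * card B \<and> finite {y. (0, y) \<in> ksum k {x - y |x y. x \<in> B \<and> y \<in> B}} \<and>
    card {y. (0, y) \<in> ksum k {x - y |x y. x \<in> B \<and> y \<in> B}} \<le> (2 * K^2)^(2*k)"
proof -
  obtain B where B: "B \<subseteq> A" "card A \<le> 2 * card B" and
    c: "card {a + z |a z. a \<in> A \<and> z \<in> ksum k {x - y |x y. x \<in> B \<and> y \<in> B}} \<le> (2 * K^2)^(2*k) * card A"
    using small_doubling_ksum[OF fin ne K dbl, of k] by blast
  let ?X = "{x - y |x y. x \<in> B \<and> y \<in> B}"
  let ?L = "{a + z |a z. a \<in> A \<and> z \<in> ksum k ?X}"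
  let ?D = "{y. (0, y) \<in> ksum k ?X}"
  have finB: "finite B" using B fin finite_subset by auto
  have finX: "finite ?X" using finite_image_set2[of "\<lambda>x. x\<in>B" "\<lambda>x. x\<in>B" "(-)"] finB by simp
  have finL: "finite ?L"
    using finite_image_set2[of "\<lambda>x. x\<in>A" "\<lambda>x. x\<in>ksum k ?X" "(+)"] fin finite_ksum[OF finX] by auto
  have finD: "finite ?D"
    by (rule finite_subset[OF _ finite_imageI[OF finite_ksum[OF finX, of k], of snd]]) force
  have "card (A \<times> ?D) \<le> card ?L"
  proof (rule card_inj_on_le[of "\<lambda>u. fst u + (0, snd u)"])
    show "inj_on (\<lambda>u. fst u + (0, snd u)) (A \<times> ?D)"
    proof (rule inj_onI, clarsimp)
      fix a b y a' b' y' assume "(a, b) \<in> A" "(a, b') \<in> A" "b + y = b' + y'"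
      moreover have "b = b'" using inj_onD[OF inj, of "(a,b)" "(a,b')"] calculation by simp
      ultimately show "b = b' \<and> y = y'" by simp
    qed
    show "(\<lambda>u. fst u + (0, snd u)) ` (A \<times> ?D) \<subseteq> ?L"
    proof (rule image_subsetI)
      fix u assume "u \<in> A \<times> ?D"
      hence "fst u \<in> A" "(0, snd u) \<in> ksum k ?X" by auto
      thus "fst u + (0, snd u) \<in> ?L" by blast
    qed
  qed (rule finL)
  hence "real (card A) * card ?D \<le> card ?L" by (simp add: card_cartesian_product flip: of_nat_mult)
  hence "real (card A) * real (card ?D) \<le> (2 * K^2)^(2*k) * card A" using c by linarith
  hence "card ?D \<le> (2 * K^2)^(2*k)" using fin ne by (simp add: card_gt_0_iff mult.commute)
  thus ?thesis using B finD by (intro exI[of _ B] conjI)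
qed

section \<open>Fourier analysis on a finite group of exponent five\<close>

text \<open>Groups are sets inside one type, so that spaces of all dimensions and their subgroups
  can be handled without changing types.\<close>

definition fin_subgroup :: "'a::ab_group_add set \<Rightarrow> bool" where
  "fin_subgroup H \<longleftrightarrow> finite H \<and> 0 \<in> H \<and> (\<forall>x\<in>H. \<forall>y\<in>H. x + y \<in> H) \<and> (\<forall>x\<in>H. - x \<in> H)"

lemma fin_subgroupD: assumes "fin_subgroup H" 
  shows fin_subgroup_finite: "finite H" and fin_subgroup_0: "0 \<in> H" 
    and fin_subgroup_add: "x \<in> H \<Longrightarrow> y \<in> H \<Longrightarrow> x + y \<in> H" and fin_subgroup_minus: "x \<in> H \<Longrightarrow> - x \<in> H"
    and fin_subgroup_diff: "x \<in> H \<Longrightarrow> y \<in> H \<Longrightarrow> x - y \<in> H" and fin_subgroup_card: "card H > 0"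
proof -
  show d: "x \<in> H \<Longrightarrow> y \<in> H \<Longrightarrow> x - y \<in> H" 
    using assms unfolding fin_subgroup_def by (metis add_uminus_conv_diff)
qed (use assms in \<open>auto simp: fin_subgroup_def card_gt_0_iff\<close>)

lemma sum_shift:
  assumes "fin_subgroup H" "h \<in> H" shows "(\<Sum>x\<in>H. f (x + h)) = (\<Sum>x\<in>H. f x)"
  by (rule sum.reindex_bij_witness[of _ "\<lambda>x. x - h" "\<lambda>x. x + h"]) (use assms fin_subgroup_add fin_subgroup_diff in auto)

lemma sum_shift':
  assumes "fin_subgroup H" "h \<in> H" shows "(\<Sum>x\<in>H. f (h + x)) = (\<Sum>x\<in>H. f x)"
  using sum_shift[OF assms, of f] by (simp add: add.commute)

lemma sum_reflect:
  assumes "fin_subgroup H" shows "(\<Sum>x\<in>H. f (- x)) = (\<Sum>x\<in>H. f x)"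
  by (rule sum.reindex_bij_witness[of _ uminus uminus]) (use assms fin_subgroup_minus in auto)

lemma pigeonhole_roots:
  fixes g :: "'b \<Rightarrow> complex"
  assumes fin: "finite B" and g: "\<And>b. b \<in> B \<Longrightarrow> g b ^ 5 = 1"
  shows "\<exists>z. card B \<le> 5 * card {b\<in>B. g b = z}"
proof (rule ccontr)
  assume "\<not> ?thesis"
  hence n: "5 * card {b\<in>B. g b = z} < card B" for z by (simp add: not_le)
  let ?R = "{z::complex. z ^ 5 = 1}"
  have finR: "finite ?R" by (rule finite_roots_unity) simp
  have cR: "card ?R = 5" by (rule card_roots_unity_eq) simp
  have "B = (\<Union>z\<in>?R. {b\<in>B. g b = z})" using g by auto
  hence "card B \<le> (\<Sum>z\<in>?R. card {b\<in>B. g b = z})"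
    using card_UN_le[OF finR, of "\<lambda>z. {b\<in>B. g b = z}"] by simp
  hence "5 * card B \<le> (\<Sum>z\<in>?R. 5 * card {b\<in>B. g b = z})" by (simp flip: sum_distrib_left)
  also have "\<dots> < (\<Sum>z\<in>?R. card B)" using n finR cR by (intro sum_strict_mono) (auto intro: exI[of _ 1])
  finally show False using cR by simp
qed

text \<open>The map takes at most five values on \<open>H\<close>, and each nonempty fibre can be
  translated into the kernel.\<close>

lemma hom_ker:
  fixes g :: "'a::ab_group_add \<Rightarrow> complex"
  assumes H: "fin_subgroup H" and hom: "\<And>x y. x \<in> H \<Longrightarrow> y \<in> H \<Longrightarrow> g (x + y) = g x * g y"
    and five: "\<And>x. x \<in> H \<Longrightarrow> g x ^ 5 = 1"
  shows "fin_subgroup {v\<in>H. g v = 1}" "card H \<le> 5 * card {v\<in>H. g v = 1}"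
proof -
  have g0: "g 0 = 1"
  proof -
    have "g 0 * g 0 = g 0" using hom[of 0 0] fin_subgroup_0[OF H] by simp
    moreover have "g 0 \<noteq> 0" using five[OF fin_subgroup_0[OF H]] by auto
    ultimately show ?thesis by simp
  qed
  have inv: "g x * g (- x) = 1" if "x \<in> H" for x
    using hom[OF that fin_subgroup_minus[OF H that]] g0 by simp
  show "fin_subgroup {v\<in>H. g v = 1}"
    unfolding fin_subgroup_def using fin_subgroupD[OF H] hom inv g0 by (auto, metis mult_1)
  have finH: "finite H" using fin_subgroup_finite[OF H] .
  obtain z where z: "card H \<le> 5 * card {b\<in>H. g b = z}"
    using pigeonhole_roots[of H g] finH five by blast
  hence "{b\<in>H. g b = z} \<noteq> {}" using fin_subgroup_card[OF H] by (metis card.empty mult_0_right not_le)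
  then obtain w where w: "w \<in> H" "g w = z" by blast
  have "(\<lambda>v. v - w) ` {v\<in>H. g v = z} \<subseteq> {v\<in>H. g v = 1}"
  proof clarify
    fix v assume v: "v \<in> H" "z = g v"
    have "g (v + - w) = g v * g (- w)" using v w fin_subgroup_minus[OF H] by (intro hom) auto
    thus "v - w \<in> H \<and> g (v - w) = 1" using v w fin_subgroup_diff[OF H] inv[OF w(1)] by simp
  qed
  hence "card {v\<in>H. g v = z} \<le> card {v\<in>H. g v = 1}"
    by (intro card_inj_on_le[of "\<lambda>v. v - w"]) (use finH in auto)
  thus "card H \<le> 5 * card {v\<in>H. g v = 1}" using z by linarith
qed

text \<open>The symmetric pairing identifies \<open>V\<close> with its dual, so frequencies are
  again elements of \<open>V\<close>. The ring structure on the type serves to write multiples such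
  as \<open>2 * r\<close>; the equation 5 = 0 makes the exponent five. Orthogonality is what
  expresses nondegeneracy on \<open>V\<close>.\<close>

locale dual_group =
  fixes V :: "'a::comm_ring_1 set" and e :: "'a \<Rightarrow> 'a \<Rightarrow> complex"
  assumes subgroup_V: "fin_subgroup V" and five: "(5::'a) = 0"
    and e_add: "e (x + y) z = e x z * e y z"
    and e_sym: "e x y = e y x"
    and e_norm [simp]: "norm (e x y) = 1"
    and e_orth: "y \<in> V \<Longrightarrow> y \<noteq> 0 \<Longrightarrow> (\<Sum>x\<in>V. e x y) = 0"
begin

abbreviation N :: real where "N \<equiv> real (card V)"

lemmas V_simps [simp] = fin_subgroup_finite[OF subgroup_V] fin_subgroup_0[OF subgroup_V] 
lemmas V_closed = fin_subgroup_add[OF subgroup_V] fin_subgroup_minus[OF subgroup_V] fin_subgroup_diff[OF subgroup_V]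

lemma N_pos [simp]: "N > 0" using fin_subgroup_card[OF subgroup_V] by simp
lemma N_neq [simp]: "N \<noteq> 0" using N_pos by linarith
lemma N_neq' [simp]: "card V \<noteq> 0" "V \<noteq> {}" using N_pos by auto

lemma e_neq_0 [simp]: "e x y \<noteq> 0"
  using e_norm[of x y] by (metis norm_zero zero_neq_one)

lemma e_0 [simp]: "e 0 z = 1" "e z 0 = 1"
proof -
  have "e 0 z * e 0 z = e 0 z" using e_add[of 0 0 z] by simp
  thus "e 0 z = 1" by simp
  thus "e z 0 = 1" by (simp add: e_sym[of z])
qed

lemma e_add': "e z (x + y) = e z x * e z y"
  using e_add e_sym by metis

lemma e_minus: "e (- x) z = cnj (e x z)"
proof -
  have "e x z * e (- x) z = 1" using e_add[of x "- x" z] by simp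
  moreover have "e x z * cnj (e x z) = 1" using complex_norm_square[of "e x z"] by simp
  ultimately show ?thesis by (metis e_neq_0 mult_left_cancel)
qed

lemma e_minus': "e z (- x) = cnj (e z x)"
  using e_minus e_sym by metis

lemma e_diff: "e (x - y) z = e x z * cnj (e y z)"
  using e_add[of x "-y" z] by (simp add: e_minus)

lemma e_diff': "e z (x - y) = e z x * cnj (e z y)"
  using e_diff e_sym by metis

lemma e_pow5: "e x z ^ 5 = 1"
proof -
  have "x + x + x + x + x = 5 * x" by simp
  hence "e (x + x + x + x + x) z = 1" by (simp only: five mult_zero_left e_0)
  thus ?thesis by (simp only: e_add) (simp add: eval_nat_numeral mult_ac)
qed

lemma e_orth': "y \<in> V \<Longrightarrow> (\<Sum>x\<in>V. e x y) = (if y = 0 then of_nat (card V) else 0)"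
  using e_orth by auto

definition fourier :: "('a \<Rightarrow> complex) \<Rightarrow> 'a \<Rightarrow> complex" where
  "fourier f \<xi> = (\<Sum>x\<in>V. f x * e x \<xi>)"

lemma parseval: "(\<Sum>\<xi>\<in>V. norm (fourier f \<xi>)^2) = N * (\<Sum>x\<in>V. norm (f x)^2)"
proof -
  have "complex_of_real (\<Sum>\<xi>\<in>V. norm (fourier f \<xi>)^2) = (\<Sum>\<xi>\<in>V. fourier f \<xi> * cnj (fourier f \<xi>))"
    by (simp flip: complex_norm_square)
  also have "\<dots> = (\<Sum>\<xi>\<in>V. \<Sum>x\<in>V. \<Sum>y\<in>V. f x * cnj (f y) * e (x - y) \<xi>)"
    by (simp add: fourier_def sum_product e_diff mult_ac)
  also have "\<dots> = (\<Sum>x\<in>V. \<Sum>y\<in>V. \<Sum>\<xi>\<in>V. f x * cnj (f y) * e \<xi> (x - y))"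
    by (subst sum.swap, rule sum.cong[OF refl], subst sum.swap) (simp add: e_sym)
  also have "\<dots> = (\<Sum>x\<in>V. \<Sum>y\<in>V. if x = y then f x * cnj (f x) * N else 0)"
    by (intro sum.cong refl) (simp add: sum_distrib_left[symmetric] e_orth' V_closed)
  also have "\<dots> = (\<Sum>x\<in>V. complex_of_real (N * norm (f x)^2))"
    by (intro sum.cong refl) (simp add: complex_mult_cnj cmod_def mult.commute)
  also have "\<dots> = complex_of_real (N * (\<Sum>x\<in>V. norm (f x)^2))"
    by (simp add: sum_distrib_left)
  finally show ?thesis using of_real_eq_iff by blast
qed

text \<open>There is no conjugate here, whence the frequency \<open>- \<xi>\<close> in the
  transform; for autocorrelations the conjugate is put into the first argument.\<close>

definition corr :: "('a \<Rightarrow> complex) \<Rightarrow> ('a \<Rightarrow> complex) \<Rightarrow> 'a \<Rightarrow> complex" where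
  "corr f g k = (\<Sum>x\<in>V. f x * g (x + k))"

lemma fourier_corr: assumes "\<xi> \<in> V" shows "fourier (corr f g) \<xi> = fourier f (- \<xi>) * fourier g \<xi>"
proof -
  have "fourier (corr f g) \<xi> = (\<Sum>k\<in>V. \<Sum>x\<in>V. f x * g (x + k) * e k \<xi>)"
    by (simp add: fourier_def corr_def sum_distrib_right)
  also have "\<dots> = (\<Sum>x\<in>V. \<Sum>k\<in>V. f x * e x (- \<xi>) * (g (x + k) * e (x + k) \<xi>))"
  proof (subst sum.swap, intro sum.cong refl)
    fix x k
    have "e x (- \<xi>) * e x \<xi> = 1"
      using complex_norm_square[of "e x \<xi>"] by (simp add: e_minus' mult.commute)
    hence "f x * e x (- \<xi>) * (g (x + k) * e (x + k) \<xi>) = f x * g (x + k) * e k \<xi> * 1"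
      unfolding e_add by (metis mult.assoc mult.commute)
    thus "f x * g (x + k) * e k \<xi> = f x * e x (- \<xi>) * (g (x + k) * e (x + k) \<xi>)" by (simp only: mult_1_right)
  qed
  also have "\<dots> = (\<Sum>x\<in>V. f x * e x (- \<xi>) * fourier g \<xi>)"
    unfolding fourier_def sum_distrib_left[symmetric]
    by (intro sum.cong refl arg_cong2[of _ _ _ _ "(*)"] sum_shift'[OF subgroup_V])
  finally show ?thesis by (simp add: fourier_def sum_distrib_right)
qed

text \<open>By Parseval the left side is a sum of products of squared transforms; the supremum of
  one is taken out and Parseval is applied to the other.\<close>

lemma corr_bound:
  assumes M: "\<And>\<xi>. \<xi> \<in> V \<Longrightarrow> norm (fourier f \<xi>) \<le> M"
  shows "(\<Sum>k\<in>V. norm (\<Sum>x\<in>V. f x * g (x + k))^2) \<le> M^2 * (\<Sum>x\<in>V. norm (g x)^2)"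
proof -
  have "N * (\<Sum>k\<in>V. norm (corr f g k)^2) = (\<Sum>\<xi>\<in>V. norm (fourier (corr f g) \<xi>)^2)"
    by (simp add: parseval)
  also have "\<dots> = (\<Sum>\<xi>\<in>V. norm (fourier f (- \<xi>))^2 * norm (fourier g \<xi>)^2)"
    by (intro sum.cong) (auto simp: fourier_corr norm_mult power_mult_distrib)
  also have "\<dots> \<le> (\<Sum>\<xi>\<in>V. M^2 * norm (fourier g \<xi>)^2)"
    using M V_closed by (intro sum_mono mult_right_mono power_mono) auto
  also have "\<dots> = N * (M^2 * (\<Sum>x\<in>V. norm (g x)^2))"
    by (simp add: sum_distrib_left[symmetric] parseval)
  finally have "(\<Sum>k\<in>V. norm (corr f g k)^2) \<le> M^2 * (\<Sum>x\<in>V. norm (g x)^2)"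
    by (simp only: mult_le_cancel_left_pos[OF N_pos])
  thus ?thesis by (simp add: corr_def)
qed

section \<open>Kernels and annihilators of characters\<close>

lemma card_ker_ge:
  assumes "fin_subgroup H"
  shows "fin_subgroup {v\<in>H. e v \<xi> = 1}" "card H \<le> 5 * card {v\<in>H. e v \<xi> = 1}"
  by (rule hom_ker[OF assms]; simp add: e_add e_pow5)+

lemma card_annihilator_ge:
  assumes "finite X" "fin_subgroup H"
  shows "fin_subgroup {v\<in>H. \<forall>\<xi>\<in>X. e v \<xi> = 1} \<and> card H \<le> 5 ^ card X * card {v\<in>H. \<forall>\<xi>\<in>X. e v \<xi> = 1}"
  using assms(1)
proof induction
  case empty thus ?case using assms by simp
next
  case (insert \<xi> X)
  let ?K = "{v\<in>H. \<forall>\<xi>\<in>X. e v \<xi> = 1}"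
  have K: "fin_subgroup ?K" using insert by simp
  have eq: "{v\<in>H. \<forall>\<xi>\<in>insert \<xi> X. e v \<xi> = 1} = {v\<in>?K. e v \<xi> = 1}" by auto
  have "card H \<le> 5 ^ card X * card ?K" using insert by simp
  also have "\<dots> \<le> 5 ^ card X * (5 * card {v\<in>?K. e v \<xi> = 1})"
    using card_ker_ge(2)[OF K] by simp
  finally show ?case unfolding eq using card_ker_ge(1)[OF K] insert by (simp add: mult_ac)
qed

lemma ex_separating:
  assumes "y \<in> V" "y \<noteq> 0" obtains \<xi> where "\<xi> \<in> V" "e y \<xi> \<noteq> 1"
proof -
  have "\<exists>\<xi>\<in>V. e y \<xi> \<noteq> 1"
  proof (rule ccontr)
    assume "\<not> ?thesis"
    hence "(\<Sum>x\<in>V. e x y) = (\<Sum>x\<in>V. 1)" by (intro sum.cong refl) (metis e_sym)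
    thus False using e_orth[OF assms] by simp
  qed
  thus ?thesis using that by blast
qed

end

section \<open>Counting four-term progressions\<close>

context dual_group
begin

text \<open>Multiplication by u permutes \<open>V\<close>, with an inverse that is also a
  multiplication. It is needed for the differences of the coefficients 0, 1, 2, 3 of a progression;
  modulo 5, the inverse of 2 is 3.\<close>

definition unitV :: "'a \<Rightarrow> bool" where
  "unitV u \<longleftrightarrow> (\<forall>x\<in>V. u * x \<in> V) \<and> (\<exists>w. u * w = 1 \<and> (\<forall>x\<in>V. w * x \<in> V))"

lemma mult_numeral_V: "x \<in> V \<Longrightarrow> 2 * x \<in> V" "x \<in> V \<Longrightarrow> 3 * x \<in> V"
proof -
  assume x: "x \<in> V"
  have "2 * x = x + x" "3 * x = x + x + x" by simp_all
  thus "2 * x \<in> V" "3 * x \<in> V" using x V_closed by metis+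
qed

lemma six: "(6::'a) = 1" and four: "(4::'a) = -1"
proof -
  have "(6::'a) = 5 + 1" by simp
  thus "(6::'a) = 1" by (simp only: five add_0)
  have "(4::'a) = 5 - 1" by simp
  thus "(4::'a) = -1" by (simp only: five diff_0)
qed

lemma unitV_simps: "unitV 1" "unitV 2" "unitV 3" "unitV u \<Longrightarrow> unitV (- u)"
proof -
  show "unitV 1" by (auto simp: unitV_def intro: exI[of _ 1])
  show "unitV 2" unfolding unitV_def using mult_numeral_V six by (auto intro!: exI[of _ 3])
  show "unitV 3" unfolding unitV_def using mult_numeral_V six by (auto intro!: exI[of _ 2])
  assume "unitV u"
  then obtain w where "\<forall>x\<in>V. u * x \<in> V" "u * w = 1" "\<forall>x\<in>V. w * x \<in> V" by (auto simp: unitV_def)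
  thus "unitV (- u)" unfolding unitV_def by (auto simp: V_closed intro!: exI[of _ "- w"])
qed

lemma sum_scale: assumes "unitV u" shows "(\<Sum>x\<in>V. f (u * x)) = (\<Sum>x\<in>V. f x)"
proof -
  obtain w where w: "\<forall>x\<in>V. u * x \<in> V" "u * w = 1" "\<forall>x\<in>V. w * x \<in> V" 
    using assms by (auto simp: unitV_def)
  have "u * (w * x) = x" "w * (u * x) = x" for x
    using w(2) by (metis mult.assoc mult.commute mult_1_left)+
  thus ?thesis
    by (intro sum.reindex_bij_witness[of _ "\<lambda>x. w * x" "\<lambda>x. u * x"]) (use w in auto)
qed

lemma unitV_mult: "unitV u \<Longrightarrow> x \<in> V \<Longrightarrow> u * x \<in> V" by (auto simp: unitV_def)

definition \<Delta> :: "('a \<Rightarrow> real) \<Rightarrow> 'a \<Rightarrow> 'a \<Rightarrow> real" where "\<Delta> f h x = f x * f (x + h)"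

lemma \<Delta>_bound: "(\<And>x. \<bar>f x\<bar> \<le> 1) \<Longrightarrow> \<bar>\<Delta> f h x\<bar> \<le> 1"
  unfolding \<Delta>_def abs_mult by (intro mult_le_one) auto

lemma sum_square_le: 
  fixes f :: "'a \<Rightarrow> real"
  shows "(\<Sum>x\<in>V. f x)^2 \<le> N * (\<Sum>x\<in>V. f x^2)"
  using sum_squared_le_sum_of_squares[of f V] by (simp add: mult.commute)

text \<open>Cauchy-Schwarz in x discards the bounded factor g; the second copy of r is written r +
  h.\<close>

lemma cauchy_schwarz_step:
  fixes g :: "'a \<Rightarrow> real"
  assumes "\<And>x. \<bar>g x\<bar> \<le> 1"
  shows "(\<Sum>x\<in>V. \<Sum>r\<in>V. g x * G x r)^2 \<le> N * (\<Sum>h\<in>V. \<Sum>x\<in>V. \<Sum>r\<in>V. G x r * G x (r + h))"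
proof -
  have "(\<Sum>x\<in>V. \<Sum>r\<in>V. g x * G x r)^2 = (\<Sum>x\<in>V. g x * (\<Sum>r\<in>V. G x r))^2"
    by (simp add: sum_distrib_left)
  also have "\<dots> \<le> N * (\<Sum>x\<in>V. (g x * (\<Sum>r\<in>V. G x r))^2)" by (rule sum_square_le)
  also have "\<dots> \<le> N * (\<Sum>x\<in>V. (\<Sum>r\<in>V. G x r)^2)"
    using assms by (intro mult_left_mono sum_mono) 
      (auto simp: power_mult_distrib abs_square_le_1 intro!: mult_left_le_one_le)
  also have "(\<Sum>x\<in>V. (\<Sum>r\<in>V. G x r)^2) = (\<Sum>x\<in>V. \<Sum>r\<in>V. \<Sum>h\<in>V. G x r * G x (r + h))"
  proof -
    have "(\<Sum>h\<in>V. G x r * G x (r + h)) = (\<Sum>j\<in>V. G x r * G x j)" if "r \<in> V" for x r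
      using sum_shift'[OF subgroup_V that, of "\<lambda>j. G x r * G x j"] .
    thus ?thesis by (simp add: power2_eq_square sum_product)
  qed
  also have "\<dots> = (\<Sum>h\<in>V. \<Sum>x\<in>V. \<Sum>r\<in>V. G x r * G x (r + h))"
    by (subst (2) sum.swap) (subst sum.swap, rule refl)
  finally show ?thesis .
qed

text \<open>The two arguments are independent variables after a linear change of coordinates, so the
  double sum is a product of two means.\<close>

lemma two_term_bound:
  fixes u v :: "'a \<Rightarrow> real"
  assumes u: "\<And>x. \<bar>u x\<bar> \<le> 1" and pq: "unitV (q - p)" "unitV p"
  shows "\<bar>\<Sum>x\<in>V. \<Sum>r\<in>V. u (x + p * r) * v (x + q * r)\<bar> \<le> N * \<bar>\<Sum>x\<in>V. v x\<bar>"
proof -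
  have "(\<Sum>x\<in>V. \<Sum>r\<in>V. u (x + p * r) * v (x + q * r)) = (\<Sum>r\<in>V. \<Sum>x\<in>V. u (x + p * r) * v ((x + p * r) + (q - p) * r))"
    by (subst sum.swap) (simp add: algebra_simps)
  also have "\<dots> = (\<Sum>r\<in>V. \<Sum>x\<in>V. u x * v (x + (q - p) * r))"
    using unitV_mult[OF pq(2)] sum_shift[OF subgroup_V, where f="\<lambda>x. u x * v (x + (q - p) * _)"] by simp
  also have "\<dots> = (\<Sum>x\<in>V. u x * (\<Sum>r\<in>V. v (x + (q - p) * r)))"
    by (subst sum.swap) (simp add: sum_distrib_left)
  also have "\<dots> = (\<Sum>x\<in>V. u x * (\<Sum>r\<in>V. v r))"
    using sum_scale[OF pq(1), where f="\<lambda>r. v (_ + r)"] by (simp add: sum_shift'[OF subgroup_V])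
  finally have eq: "(\<Sum>x\<in>V. \<Sum>r\<in>V. u (x + p * r) * v (x + q * r)) = (\<Sum>x\<in>V. u x) * (\<Sum>r\<in>V. v r)"
    by (simp add: sum_distrib_right)
  have "(\<Sum>x\<in>V. \<bar>u x\<bar>) \<le> (\<Sum>x\<in>V. 1)" using u by (intro sum_mono)
  hence "\<bar>\<Sum>x\<in>V. u x\<bar> \<le> N" by (simp add: order_trans[OF sum_abs])
  thus ?thesis unfolding eq abs_mult by (intro mult_right_mono) auto
qed

lemma three_term_bound:
  fixes g2 g3 g4 :: "'a \<Rightarrow> real"
  assumes b: "\<And>x. \<bar>g2 x\<bar> \<le> 1" "\<And>x. \<bar>g3 x\<bar> \<le> 1"
    and units: "unitV p" "unitV q" "unitV (q - p)"
  shows "(\<Sum>x\<in>V. \<Sum>r\<in>V. g2 x * (g3 (x + p * r) * g4 (x + q * r)))^2 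
    \<le> N^2 * (\<Sum>k\<in>V. \<bar>\<Sum>x\<in>V. \<Delta> g4 k x\<bar>)"
proof -
  have "(\<Sum>x\<in>V. \<Sum>r\<in>V. g2 x * (g3 (x + p * r) * g4 (x + q * r)))^2 \<le>
     N * (\<Sum>k\<in>V. \<Sum>x\<in>V. \<Sum>r\<in>V. (g3 (x + p * r) * g4 (x + q * r)) * (g3 (x + p * (r + k)) * g4 (x + q * (r + k))))"
    by (rule cauchy_schwarz_step[OF b(1)])
  also have "\<dots> = N * (\<Sum>k\<in>V. \<Sum>x\<in>V. \<Sum>r\<in>V. \<Delta> g3 (p * k) (x + p * r) * \<Delta> g4 (q * k) (x + q * r))"
    by (simp add: \<Delta>_def algebra_simps)
  also have "\<dots> \<le> N * (\<Sum>k\<in>V. N * \<bar>\<Sum>x\<in>V. \<Delta> g4 (q * k) x\<bar>)"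
    by (intro mult_left_mono sum_mono order_trans[OF abs_ge_self two_term_bound] \<Delta>_bound b units) simp
  also have "\<dots> = N^2 * (\<Sum>k\<in>V. \<bar>\<Sum>x\<in>V. \<Delta> g4 k x\<bar>)"
    using sum_scale[OF units(2), of "\<lambda>k. \<bar>\<Sum>x\<in>V. \<Delta> g4 k x\<bar>"]
    by (simp add: sum_distrib_left[symmetric] power2_eq_square mult.assoc)
  finally show ?thesis .
qed

text \<open>Two Cauchy-Schwarz steps remove g1 and g2, a change of variables removes g3, and a
  second derivative of g4 is left. Its sums are correlations of \<Delta> g4 h with itself, so a
  third Cauchy-Schwarz step and \<open>corr_bound\<close> bring in the Fourier coefficients. The
  coefficients a, b, c are left general so that g4 can stand at any of the last three
  places.\<close>

lemma four_term_bound: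
  fixes g1 g2 g3 g4 :: "'a \<Rightarrow> real"
  assumes bd: "\<And>x. \<bar>g1 x\<bar> \<le> 1" "\<And>x. \<bar>g2 x\<bar> \<le> 1" "\<And>x. \<bar>g3 x\<bar> \<le> 1" "\<And>x. \<bar>g4 x\<bar> \<le> 1"
    and units: "unitV a" "unitV (b - a)" "unitV (c - a)" "unitV (c - b)" "unitV c"
    and M: "\<And>h \<xi>. h \<in> V \<Longrightarrow> \<xi> \<in> V \<Longrightarrow> norm (fourier (\<lambda>x. complex_of_real (\<Delta> g4 h x)) \<xi>) \<le> M h"
  shows "(\<Sum>x\<in>V. \<Sum>r\<in>V. g1 x * (g2 (x + a * r) * g3 (x + b * r) * g4 (x + c * r)))^8 
    \<le> N^13 * (\<Sum>h\<in>V. (M h)^2)"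
proof -
  let ?T = "\<Sum>x\<in>V. \<Sum>r\<in>V. g1 x * (g2 (x + a * r) * g3 (x + b * r) * g4 (x + c * r))"
  define T3 where "T3 h = (\<Sum>x\<in>V. \<Sum>r\<in>V. \<Delta> g2 (a * h) x * (\<Delta> g3 (b * h) (x + (b - a) * r) * \<Delta> g4 (c * h) (x + (c - a) * r)))" for h
  have "?T^2 \<le> N * (\<Sum>h\<in>V. \<Sum>x\<in>V. \<Sum>r\<in>V. (g2 (x + a * r) * g3 (x + b * r) * g4 (x + c * r)) * 
      (g2 (x + a * (r + h)) * g3 (x + b * (r + h)) * g4 (x + c * (r + h))))"
    by (rule cauchy_schwarz_step[OF bd(1)])
  also have "(\<Sum>h\<in>V. \<Sum>x\<in>V. \<Sum>r\<in>V. (g2 (x + a * r) * g3 (x + b * r) * g4 (x + c * r)) * 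
      (g2 (x + a * (r + h)) * g3 (x + b * (r + h)) * g4 (x + c * (r + h)))) = (\<Sum>h\<in>V. T3 h)"
  proof (rule sum.cong[OF refl])
    fix h assume "h \<in> V"
    let ?H = "\<lambda>x r. \<Delta> g2 (a * h) x * (\<Delta> g3 (b * h) (x + (b - a) * r) * \<Delta> g4 (c * h) (x + (c - a) * r))"
    have "(\<Sum>x\<in>V. \<Sum>r\<in>V. (g2 (x + a * r) * g3 (x + b * r) * g4 (x + c * r)) * 
      (g2 (x + a * (r + h)) * g3 (x + b * (r + h)) * g4 (x + c * (r + h)))) = (\<Sum>x\<in>V. \<Sum>r\<in>V. ?H (x + a * r) r)"
      by (simp add: \<Delta>_def algebra_simps)
    also have "\<dots> = (\<Sum>r\<in>V. \<Sum>x\<in>V. ?H (x + a * r) r)" by (rule sum.swap)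
    \<comment> \<open>For each fixed r the translation of x by a r is undone, which brings the next
      function to the argument x.\<close>
    also have "\<dots> = (\<Sum>r\<in>V. \<Sum>x\<in>V. ?H x r)"
      using unitV_mult[OF units(1)] sum_shift[OF subgroup_V, where f="\<lambda>x. ?H x _"] by simp
    also have "\<dots> = T3 h" unfolding T3_def by (rule sum.swap)
    finally show "(\<Sum>x\<in>V. \<Sum>r\<in>V. (g2 (x + a * r) * g3 (x + b * r) * g4 (x + c * r)) * 
      (g2 (x + a * (r + h)) * g3 (x + b * (r + h)) * g4 (x + c * (r + h)))) = T3 h" .
  qed
  finally have t2: "?T^2 \<le> N * (\<Sum>h\<in>V. T3 h)" .
  have "?T^4 = (?T^2)^2" by simp
  also have "\<dots> \<le> (N * (\<Sum>h\<in>V. T3 h))^2" using t2 by (intro power_mono) auto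
  also have "\<dots> \<le> N^2 * (N * (\<Sum>h\<in>V. (T3 h)^2))"
    unfolding power_mult_distrib by (intro mult_left_mono sum_square_le) auto
  also have "\<dots> \<le> N^2 * (N * (\<Sum>h\<in>V. N^2 * (\<Sum>k\<in>V. \<bar>\<Sum>x\<in>V. \<Delta> (\<Delta> g4 (c * h)) k x\<bar>)))"
    unfolding T3_def using bd units 
    by (intro mult_left_mono sum_mono three_term_bound \<Delta>_bound) (auto simp: algebra_simps)
  also have "\<dots> = N^5 * (\<Sum>h\<in>V. \<Sum>k\<in>V. \<bar>\<Sum>x\<in>V. \<Delta> (\<Delta> g4 h) k x\<bar>)"
    using sum_scale[OF units(5), of "\<lambda>h. \<Sum>k\<in>V. \<bar>\<Sum>x\<in>V. \<Delta> (\<Delta> g4 h) k x\<bar>"]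
    by (simp add: sum_distrib_left[symmetric] eval_nat_numeral mult.assoc)
  finally have t4: "?T^4 \<le> N^5 * (\<Sum>h\<in>V. \<Sum>k\<in>V. \<bar>\<Sum>x\<in>V. \<Delta> (\<Delta> g4 h) k x\<bar>)" .
  have t8: "(\<Sum>h\<in>V. \<Sum>k\<in>V. \<bar>\<Sum>x\<in>V. \<Delta> (\<Delta> g4 h) k x\<bar>)^2 \<le> N^3 * (\<Sum>h\<in>V. (M h)^2)"
  proof -
    have "(\<Sum>h\<in>V. \<Sum>k\<in>V. \<bar>\<Sum>x\<in>V. \<Delta> (\<Delta> g4 h) k x\<bar>)^2 \<le> N * (\<Sum>h\<in>V. (\<Sum>k\<in>V. \<bar>\<Sum>x\<in>V. \<Delta> (\<Delta> g4 h) k x\<bar>)^2)"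
      by (rule sum_square_le)
    also have "\<dots> \<le> N * (\<Sum>h\<in>V. N * (\<Sum>k\<in>V. \<bar>\<Sum>x\<in>V. \<Delta> (\<Delta> g4 h) k x\<bar>^2))"
      by (intro mult_left_mono sum_mono sum_square_le) auto
    also have "\<dots> \<le> N * (\<Sum>h\<in>V. N * ((M h)^2 * N))"
    proof (intro mult_left_mono sum_mono)
      fix h assume h: "h \<in> V"
      let ?f = "\<lambda>x. complex_of_real (\<Delta> g4 h x)"
      have "(\<Sum>k\<in>V. \<bar>\<Sum>x\<in>V. \<Delta> (\<Delta> g4 h) k x\<bar>^2) = (\<Sum>k\<in>V. norm (\<Sum>x\<in>V. ?f x * ?f (x + k))^2)"
        by (intro sum.cong refl) (simp add: \<Delta>_def[of "\<Delta> g4 h"] flip: of_real_mult of_real_sum)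
      also have "\<dots> \<le> (M h)^2 * (\<Sum>x\<in>V. norm (?f x)^2)"
        using M[OF h] by (rule corr_bound)
      also have "\<dots> \<le> (M h)^2 * (\<Sum>x\<in>V. 1)"
        using \<Delta>_bound[OF bd(4)] by (intro mult_left_mono sum_mono) (auto simp: abs_square_le_1)
      finally show "(\<Sum>k\<in>V. \<bar>\<Sum>x\<in>V. \<Delta> (\<Delta> g4 h) k x\<bar>^2) \<le> (M h)^2 * N" by simp
    qed auto
    also have "\<dots> = N^3 * (\<Sum>h\<in>V. (M h)^2)"
      by (simp add: sum_distrib_left power3_eq_cube mult_ac)
    finally show ?thesis .
  qed
  have "?T^8 = (?T^4)^2" by simp
  also have "\<dots> \<le> (N^5 * (\<Sum>h\<in>V. \<Sum>k\<in>V. \<bar>\<Sum>x\<in>V. \<Delta> (\<Delta> g4 h) k x\<bar>))^2"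
    using t4 by (intro power_mono) auto
  also have "\<dots> \<le> N^10 * (N^3 * (\<Sum>h\<in>V. (M h)^2))"
    unfolding power_mult_distrib using mult_left_mono[OF t8, of "N^10"] by simp
  also have "\<dots> = N^13 * (\<Sum>h\<in>V. (M h)^2)" by (simp add: eval_nat_numeral mult.assoc)
  finally show ?thesis .
qed

definition ap4_form :: "('a \<Rightarrow> real) \<Rightarrow> ('a \<Rightarrow> real) \<Rightarrow> ('a \<Rightarrow> real) \<Rightarrow> ('a \<Rightarrow> real) \<Rightarrow> real" where
  "ap4_form f0 f1 f2 f3 = (\<Sum>x\<in>V. \<Sum>r\<in>V. f0 x * f1 (x + r) * f2 (x + 2 * r) * f3 (x + 3 * r))"

lemma ap4_form_bound:
  fixes f0 f1 f2 f3 g :: "'a \<Rightarrow> real"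
  assumes bd: "\<And>x. \<bar>f0 x\<bar> \<le> 1" "\<And>x. \<bar>f1 x\<bar> \<le> 1" "\<And>x. \<bar>f2 x\<bar> \<le> 1" "\<And>x. \<bar>g x\<bar> \<le> 1"
    and M: "\<And>h \<xi>. h \<in> V \<Longrightarrow> \<xi> \<in> V \<Longrightarrow> norm (fourier (\<lambda>x. complex_of_real (\<Delta> g h x)) \<xi>) \<le> M h"
  shows "(ap4_form f0 f1 f2 g)^8 \<le> N^13 * (\<Sum>h\<in>V. (M h)^2)"
    "(ap4_form f0 f1 g f2)^8 \<le> N^13 * (\<Sum>h\<in>V. (M h)^2)"
    "(ap4_form f0 g f1 f2)^8 \<le> N^13 * (\<Sum>h\<in>V. (M h)^2)"
    "(ap4_form g f0 f1 f2)^8 \<le> N^13 * (\<Sum>h\<in>V. (M h)^2)"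
proof -
  have u: "unitV 1" "unitV 2" "unitV 3" "unitV (-1)" "unitV (-2)"
    using unitV_simps by auto
  have A: "(ap4_form g1 g2 g3 g)^8 \<le> N^13 * (\<Sum>h\<in>V. (M h)^2)" 
    if "\<And>x. \<bar>g1 x\<bar> \<le> 1" "\<And>x. \<bar>g2 x\<bar> \<le> 1" "\<And>x. \<bar>g3 x\<bar> \<le> 1" for g1 g2 g3
    using four_term_bound[of g1 g2 g3 g 1 2 3 M, OF that bd(4)] u M by (simp add: ap4_form_def mult_ac)
  show "(ap4_form f0 f1 f2 g)^8 \<le> N^13 * (\<Sum>h\<in>V. (M h)^2)" using A bd by blast
  show "(ap4_form f0 f1 g f2)^8 \<le> N^13 * (\<Sum>h\<in>V. (M h)^2)"
    using four_term_bound[of f0 f1 f2 g 1 3 2 M, OF bd(1,2,3,4)] u M by (simp add: ap4_form_def mult_ac)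
  show "(ap4_form f0 g f1 f2)^8 \<le> N^13 * (\<Sum>h\<in>V. (M h)^2)"
    using four_term_bound[of f0 f1 f2 g 2 3 1 M, OF bd(1,2,3,4)] u M by (simp add: ap4_form_def mult_ac)
  \<comment> \<open>The first place is treated by reading the progression backwards, from x + 3r
    with step -r.\<close>
  have "ap4_form g f0 f1 f2 = ap4_form f2 f1 f0 g"
  proof -
    have "ap4_form g f0 f1 f2 = (\<Sum>r\<in>V. \<Sum>x\<in>V. g x * f0 (x + r) * f1 (x + 2 * r) * f2 (x + 3 * r))"
      unfolding ap4_form_def by (rule sum.swap)
    also have "\<dots> = (\<Sum>r\<in>V. \<Sum>x\<in>V. g x * f0 (x - r) * f1 (x - 2 * r) * f2 (x - 3 * r))"
      by (subst sum_reflect[OF subgroup_V, symmetric]) simp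
    also have "\<dots> = (\<Sum>r\<in>V. \<Sum>x\<in>V. g (x + 3 * r) * f0 (x + 3 * r - r) * f1 (x + 3 * r - 2 * r) * f2 (x + 3 * r - 3 * r))"
    proof (rule sum.cong[OF refl])
      fix r assume r: "r \<in> V"
      show "(\<Sum>x\<in>V. g x * f0 (x - r) * f1 (x - 2 * r) * f2 (x - 3 * r)) =
        (\<Sum>x\<in>V. g (x + 3 * r) * f0 (x + 3 * r - r) * f1 (x + 3 * r - 2 * r) * f2 (x + 3 * r - 3 * r))"
        by (rule sum_shift[OF subgroup_V mult_numeral_V(2)[OF r], symmetric,
              where f="\<lambda>x. g x * f0 (x - r) * f1 (x - 2 * r) * f2 (x - 3 * r)"])
    qed
    also have "\<dots> = (\<Sum>r\<in>V. \<Sum>x\<in>V. f2 x * f1 (x + r) * f0 (x + 2 * r) * g (x + 3 * r))"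
      by (simp add: algebra_simps)
    also have "\<dots> = ap4_form f2 f1 f0 g" unfolding ap4_form_def by (rule sum.swap)
    finally show ?thesis .
  qed
  thus "(ap4_form g f0 f1 f2)^8 \<le> N^13 * (\<Sum>h\<in>V. (M h)^2)" using A bd by simp
qed

end

section \<open>Additive quadruples of large Fourier coefficients\<close>

context dual_group
begin

text \<open>For nonzero r the four terms are distinct, since 1, 2 and 3 are invertible modulo 5; so
  this excludes exactly the nondegenerate progressions.\<close>

definition ap4_free :: "'a set \<Rightarrow> bool" where
  "ap4_free A \<longleftrightarrow> (\<forall>x\<in>V. \<forall>r\<in>V. x \<in> A \<and> x + r \<in> A \<and> x + 2 * r \<in> A \<and> x + 3 * r \<in> A \<longrightarrow> r = 0)"

text \<open>A progression-free set has only \<delta> N progressions, all trivial, against the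
  expected \<delta>^4 N^2. The deficit forces a large progression form with f in one place, and the
  bound for that form makes the mean square of the largest Fourier coefficient of the derivatives of
  f large.\<close>

lemma ap4_free_large_derivatives:
  fixes A :: "'a set"
  assumes A: "A \<subseteq> V" "ap4_free A" and \<delta>: "card A = \<delta> * N" and big: "2 \<le> \<delta>^3 * N"
  defines "f \<equiv> \<lambda>x. of_bool (x \<in> A) - \<delta>"
  defines "\<sigma> \<equiv> (\<delta>^4/8)^8 / 2"
  shows "\<exists>S\<subseteq>V. card S \<ge> \<sigma> * N \<and> 
    (\<forall>h\<in>S. \<exists>\<xi>\<in>V. norm (fourier (\<lambda>x. complex_of_real (\<Delta> f h x)) \<xi>)^2 \<ge> \<sigma> * N^2)"
proof -
  define a :: "'a \<Rightarrow> real" where "a x = of_bool (x \<in> A)" for x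
  define d :: "'a \<Rightarrow> real" where "d x = \<delta>" for x
  have \<delta>0: "\<delta> \<ge> 0"
  proof -
    have "0 \<le> \<delta> * N" using \<delta> by (metis of_nat_0_le_iff)
    thus ?thesis using N_pos by (metis mult_le_cancel_right_pos mult_zero_left)
  qed
  have "card A \<le> card V" using A by (intro card_mono) auto
  hence \<delta>1: "\<delta> \<le> 1" using \<delta> N_pos
    by (metis mult_le_cancel_right_pos mult_1 of_nat_le_iff)
  define \<tau> where "\<tau> = \<delta>^4/8"
  have bd: "\<bar>f x\<bar> \<le> 1" "\<bar>a x\<bar> \<le> 1" "\<bar>d x\<bar> \<le> 1" for x
    using \<delta>0 \<delta>1 by (auto simp: f_def a_def d_def)
  define M where "M h = Max ((\<lambda>\<xi>. norm (fourier (\<lambda>x. complex_of_real (\<Delta> f h x)) \<xi>)) ` V)" for h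
  have M: "norm (fourier (\<lambda>x. complex_of_real (\<Delta> f h x)) \<xi>) \<le> M h" if "\<xi> \<in> V" for h \<xi>
    unfolding M_def using that by (intro Max_ge) auto
  have Mex: "\<exists>\<xi>\<in>V. norm (fourier (\<lambda>x. complex_of_real (\<Delta> f h x)) \<xi>) = M h" for h
  proof -
    have "M h \<in> (\<lambda>\<xi>. norm (fourier (\<lambda>x. complex_of_real (\<Delta> f h x)) \<xi>)) ` V"
      unfolding M_def by (intro Max_in) auto
    thus ?thesis by auto
  qed
  have taa: "ap4_form a a a a = \<delta> * N"
  proof -
    have "ap4_form a a a a = (\<Sum>x\<in>V. \<Sum>r\<in>V. if r = 0 then a x else 0)"
      unfolding ap4_form_def using A(2) by (intro sum.cong refl) (auto simp: a_def ap4_free_def)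
    also have "\<dots> = (\<Sum>x\<in>V. a x)" by simp
    also have "\<dots> = card (V \<inter> A)" unfolding a_def by (simp add: Int_def)
    also have "V \<inter> A = A" using A by auto
    finally show ?thesis using \<delta> by simp
  qed
  have tdd: "ap4_form d d d d = \<delta>^4 * N^2" 
    by (simp add: ap4_form_def d_def power2_eq_square eval_nat_numeral)
  \<comment> \<open>A telescoping sum: the places are changed one after the other from a to d, each
    time leaving f = a - d in the changed place. One of four terms then has size at least a quarter
    of \<delta>^4 N^2 / 2, which is \<tau> N^2.\<close>
  have "ap4_form a a a a - ap4_form d d d d = ap4_form f a a a + ap4_form d f a a + ap4_form d d f a + ap4_form d d d f"
    unfolding ap4_form_def sum_subtractf[symmetric] sum.distrib[symmetric] f_def a_def[symmetric] d_def[symmetric]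
    by (intro sum.cong refl) (simp add: algebra_simps d_def)
  moreover have "\<delta>^4 * N^2 - \<delta> * N \<ge> \<delta>^4 * N^2 / 2"
  proof -
    have "2 * (\<delta> * N) \<le> (\<delta>^3 * N) * (\<delta> * N)" using big \<delta>0 by (intro mult_right_mono) auto
    thus ?thesis by (simp add: eval_nat_numeral algebra_simps)
  qed
  ultimately have "\<bar>ap4_form f a a a\<bar> + \<bar>ap4_form d f a a\<bar> + \<bar>ap4_form d d f a\<bar> + \<bar>ap4_form d d d f\<bar> \<ge> 4 * (\<tau> * N^2)"
    unfolding taa tdd \<tau>_def by linarith
  hence "\<exists>t\<in>{ap4_form f a a a, ap4_form d f a a, ap4_form d d f a, ap4_form d d d f}. \<tau> * N^2 \<le> \<bar>t\<bar>" by auto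
  then obtain t where t: "t \<in> {ap4_form f a a a, ap4_form d f a a, ap4_form d d f a, ap4_form d d d f}" "\<tau> * N^2 \<le> \<bar>t\<bar>" by blast
  have "(\<tau> * N^2)^8 \<le> t^8"
    using power_mono[OF t(2), of 8] by (simp add: \<tau>_def)
  also have "\<dots> \<le> N^13 * (\<Sum>h\<in>V. (M h)^2)"
    using t(1) ap4_form_bound[of d d d f M] ap4_form_bound[of d d a f M] ap4_form_bound[of d a a f M] ap4_form_bound[of a a a f M] bd M
    by auto
  finally have "(\<tau> * N^2)^8 \<le> N^13 * (\<Sum>h\<in>V. (M h)^2)" .
  hence "\<tau>^8 * N^3 * N^13 \<le> (\<Sum>h\<in>V. (M h)^2) * N^13" 
    by (simp add: power_mult_distrib power_mult[symmetric] mult_ac flip: power_add)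
  hence sM: "\<tau>^8 * N^3 \<le> (\<Sum>h\<in>V. (M h)^2)"
    by (rule mult_right_le_imp_le) (simp only: N_pos zero_less_power)
  define S where "S = {h\<in>V. \<sigma> * N^2 \<le> (M h)^2}"
  have MN: "(M h)^2 \<le> N^2" for h
  proof -
    obtain \<xi> where "norm (fourier (\<lambda>x. complex_of_real (\<Delta> f h x)) \<xi>) = M h" using Mex by blast
    moreover have "norm (fourier (\<lambda>x. complex_of_real (\<Delta> f h x)) \<xi>) \<le> (\<Sum>x\<in>V. 1)"
      unfolding fourier_def using \<Delta>_bound[OF bd(1)] by (intro sum_norm_le) (simp add: norm_mult)
    ultimately show ?thesis by (intro power_mono) (auto simp flip: \<open>_ = M h\<close>)
  qed
  \<comment> \<open>Indices in \<open>S\<close> contribute at most N^2 each. As \<sigma> is half of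
    the lower bound \<tau>^8 for the mean, the remaining ones cannot account for more than half of
    the sum.\<close>
  have "(\<Sum>h\<in>V. (M h)^2) \<le> (\<Sum>h\<in>V. N^2 * of_bool (h \<in> S) + \<sigma> * N^2)"
  proof (intro sum_mono)
    fix h assume "h \<in> V"
    have "0 \<le> \<sigma> * N^2" by (simp add: \<sigma>_def)
    thus "(M h)^2 \<le> N^2 * of_bool (h \<in> S) + \<sigma> * N^2"
      using MN[of h] \<open>h \<in> V\<close> by (auto simp: S_def)
  qed
  also have "\<dots> = N^2 * card S + \<sigma> * N^3"
  proof -
    have "V \<inter> {x. x \<in> S} = S" by (auto simp: S_def)
    thus ?thesis by (simp add: sum.distrib sum_distrib_left[symmetric] power2_eq_square power3_eq_cube)
  qed
  finally have "(\<Sum>h\<in>V. (M h)^2) \<le> N^2 * card S + \<sigma> * N^3" .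
  moreover have "2 * (\<sigma> * N^3) \<le> (\<Sum>h\<in>V. (M h)^2)" using sM by (simp add: \<sigma>_def \<tau>_def)
  ultimately have "\<sigma> * N^3 \<le> N^2 * card S" by linarith
  hence "(\<sigma> * N) * N^2 \<le> card S * N^2"
    by (simp add: power2_eq_square power3_eq_cube mult_ac)
  hence "\<sigma> * N \<le> card S" by simp
  moreover have "S \<subseteq> V" by (auto simp: S_def)
  moreover have "\<exists>\<xi>\<in>V. norm (fourier (\<lambda>x. complex_of_real (\<Delta> f h x)) \<xi>)^2 \<ge> \<sigma> * N^2" if "h \<in> S" for h
  proof -
    obtain \<xi> where "\<xi> \<in> V" "norm (fourier (\<lambda>x. complex_of_real (\<Delta> f h x)) \<xi>) = M h" using Mex by blast
    thus ?thesis using that by (intro bexI[of _ \<xi>]) (auto simp: S_def)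
  qed
  ultimately show ?thesis by blast
qed

section \<open>Additive energy of the graph of frequencies\<close>

text \<open>Cauchy-Schwarz on the Fourier side: the sum of |F|^2 |G|^2 is compared with the fourth
  moments of F and G, and these are the square norms of the autocorrelations, up to the factor
  N.\<close>

lemma corr_autocorr:
  "(\<Sum>k\<in>V. norm (corr f g k)^2)^2 \<le> 
   (\<Sum>k\<in>V. norm (corr (\<lambda>x. cnj (f x)) f k)^2) * (\<Sum>k\<in>V. norm (corr (\<lambda>x. cnj (g x)) g k)^2)"
proof -
  have Fc: "fourier (\<lambda>x. cnj (f x)) (- \<xi>) = cnj (fourier f \<xi>)" for f \<xi>
    by (simp add: fourier_def e_minus')
  have auto4: "N * (\<Sum>k\<in>V. norm (corr (\<lambda>x. cnj (f x)) f k)^2) = (\<Sum>\<xi>\<in>V. (norm (fourier f \<xi>)^2)^2)" for f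
    unfolding parseval[symmetric] by (intro sum.cong refl) (simp add: fourier_corr Fc norm_mult power2_eq_square)
  have "N * (\<Sum>k\<in>V. norm (corr f g k)^2) = (\<Sum>\<xi>\<in>V. norm (fourier f (- \<xi>))^2 * norm (fourier g \<xi>)^2)"
    unfolding parseval[symmetric] by (intro sum.cong) (auto simp: fourier_corr norm_mult power_mult_distrib)
  hence "(N * (\<Sum>k\<in>V. norm (corr f g k)^2))^2 \<le> 
    (\<Sum>\<xi>\<in>V. (norm (fourier f (- \<xi>))^2)^2) * (\<Sum>\<xi>\<in>V. (norm (fourier g \<xi>)^2)^2)"
    by (simp only: Cauchy_Schwarz_ineq_sum)
  also have "(\<Sum>\<xi>\<in>V. (norm (fourier f (- \<xi>))^2)^2) = (\<Sum>\<xi>\<in>V. (norm (fourier f \<xi>)^2)^2)"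
    by (rule sum_reflect[OF subgroup_V])
  finally have "N^2 * (\<Sum>k\<in>V. norm (corr f g k)^2)^2 \<le> 
    N^2 * ((\<Sum>k\<in>V. norm (corr (\<lambda>x. cnj (f x)) f k)^2) * (\<Sum>k\<in>V. norm (corr (\<lambda>x. cnj (g x)) g k)^2))"
    unfolding auto4[symmetric] power_mult_distrib by (simp add: power2_eq_square mult_ac)
  thus ?thesis by simp
qed

text \<open>Expanding the squared coefficients and exchanging the roles of the two shifts turns the
  sum over h into a correlation of the phases \<open>e u (\<phi> h)\<close> with \<Delta> f u.
  Cauchy-Schwarz discards f, and what remains is a fourth moment of the phases. Summation over u
  leaves exactly the quadruples with equal differences both of the h and of the \<phi> h.\<close>

lemma additive_quadruples:
  fixes f :: "'a \<Rightarrow> real" and \<sigma> :: real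
  assumes bd: "\<And>x. \<bar>f x\<bar> \<le> 1" and S: "S \<subseteq> V" and \<phi>: "\<And>h. h \<in> S \<Longrightarrow> \<phi> h \<in> V" and \<sigma>: "\<sigma> \<ge> 0"
    and large: "\<And>h. h \<in> S \<Longrightarrow> norm (fourier (\<lambda>x. complex_of_real (\<Delta> f h x)) (\<phi> h))^2 \<ge> \<sigma> * N^2"
  defines "\<Gamma> \<equiv> (\<lambda>h. (h, \<phi> h)) ` S"
  shows "(card S * \<sigma>)^4 \<le> N * (\<Sum>p\<in>\<Gamma>\<times>\<Gamma>. rep \<Gamma> (fst p - snd p))"
proof -
  have finS: "finite S" using S by (rule finite_subset) simp
  define g where "g u h = (if h \<in> S then e u (\<phi> h) else 0)" for u h
  define D where "D u x = complex_of_real (\<Delta> f u x)" for u x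
  define G where "G u k = corr (\<lambda>x. cnj (g u x)) (g u) k" for u k
  define T where "T u = (\<Sum>y\<in>V. D u y * corr (g u) (D u) y)" for u
  have Dbd: "norm (D u x) \<le> 1" for u x using \<Delta>_bound[OF bd] by (simp add: D_def)
  have Z: "complex_of_real (norm (fourier (D h) (\<phi> h))^2) = (\<Sum>u\<in>V. \<Sum>y\<in>V. D u y * (e u (\<phi> h) * D u (h + y)))"
    if h: "h \<in> V" for h
  proof -
    have "complex_of_real (norm (fourier (D h) (\<phi> h))^2) = fourier (D h) (\<phi> h) * cnj (fourier (D h) (\<phi> h))"
      by (rule complex_norm_square)
    also have "\<dots> = (\<Sum>x\<in>V. \<Sum>y\<in>V. D h x * D h y * e (x - y) (\<phi> h))"
      by (simp add: fourier_def sum_product e_diff mult_ac D_def)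
    also have "\<dots> = (\<Sum>y\<in>V. \<Sum>x\<in>V. D h x * D h y * e (x - y) (\<phi> h))" by (rule sum.swap)
    also have "\<dots> = (\<Sum>y\<in>V. \<Sum>u\<in>V. D h (u + y) * D h y * e u (\<phi> h))"
    proof (rule sum.cong[OF refl])
      fix y assume "y \<in> V"
      from sum_shift[OF subgroup_V this, of "\<lambda>x. D h x * D h y * e (x - y) (\<phi> h)"]
      show "(\<Sum>x\<in>V. D h x * D h y * e (x - y) (\<phi> h)) = (\<Sum>u\<in>V. D h (u + y) * D h y * e u (\<phi> h))"
        by simp
    qed
    \<comment> \<open>Both products consist of the values of f at y, y + h, y + u and y + u +
      h.\<close>
    also have "\<dots> = (\<Sum>y\<in>V. \<Sum>u\<in>V. D u y * (e u (\<phi> h) * D u (h + y)))"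
      by (simp add: D_def \<Delta>_def algebra_simps)
    also have "\<dots> = (\<Sum>u\<in>V. \<Sum>y\<in>V. D u y * (e u (\<phi> h) * D u (h + y)))" by (rule sum.swap)
    finally show ?thesis .
  qed
  have "card S * (\<sigma> * N^2) = (\<Sum>h\<in>S. \<sigma> * N^2)" by simp
  also have "\<dots> \<le> (\<Sum>h\<in>S. norm (fourier (D h) (\<phi> h))^2)" using large by (intro sum_mono) (simp add: D_def[abs_def])
  also have "\<dots> = norm (complex_of_real \<dots>)" unfolding norm_of_real by (rule abs_of_nonneg[symmetric]) (simp add: sum_nonneg)
  also have "complex_of_real (\<Sum>h\<in>S. norm (fourier (D h) (\<phi> h))^2) = (\<Sum>u\<in>V. T u)"
  proof -
    have "complex_of_real (\<Sum>h\<in>S. norm (fourier (D h) (\<phi> h))^2) = 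
       (\<Sum>h\<in>S. \<Sum>u\<in>V. \<Sum>y\<in>V. D u y * (e u (\<phi> h) * D u (h + y)))"
      unfolding of_real_sum using S by (intro sum.cong refl Z) auto
    also have "\<dots> = (\<Sum>u\<in>V. \<Sum>h\<in>S. \<Sum>y\<in>V. D u y * (e u (\<phi> h) * D u (h + y)))" by (rule sum.swap)
    also have "\<dots> = (\<Sum>u\<in>V. \<Sum>y\<in>V. \<Sum>h\<in>S. D u y * (e u (\<phi> h) * D u (h + y)))"
      by (rule sum.cong[OF refl]) (rule sum.swap)
    also have "\<dots> = (\<Sum>u\<in>V. T u)"
      unfolding T_def corr_def sum_distrib_left
      using S by (intro sum.cong refl sum.mono_neutral_cong_left) (auto simp: g_def)
    finally show ?thesis .
  qed
  also have "norm (\<Sum>u\<in>V. T u) \<le> (\<Sum>u\<in>V. norm (T u))" by (rule norm_sum)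
  finally have s1: "card S * (\<sigma> * N^2) \<le> (\<Sum>u\<in>V. norm (T u))" .
  have Tu: "norm (T u)^4 \<le> N^5 * (\<Sum>k\<in>V. norm (G u k)^2)" for u
  proof -
    have "norm (T u) \<le> (\<Sum>y\<in>V. norm (corr (g u) (D u) y))"
      unfolding T_def using Dbd by (intro sum_norm_le) (simp add: norm_mult mult_left_le_one_le)
    hence "norm (T u)^2 \<le> (\<Sum>y\<in>V. norm (corr (g u) (D u) y))^2" by (intro power_mono) auto
    also have "\<dots> \<le> N * (\<Sum>y\<in>V. norm (corr (g u) (D u) y)^2)" by (rule sum_square_le)
    finally have 1: "norm (T u)^2 \<le> N * (\<Sum>y\<in>V. norm (corr (g u) (D u) y)^2)" .
    have "norm (T u)^4 = (norm (T u)^2)^2" by simp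
    also have "\<dots> \<le> N^2 * (\<Sum>y\<in>V. norm (corr (g u) (D u) y)^2)^2"
      unfolding power_mult_distrib[symmetric] using 1 by (intro power_mono) auto
    also have "\<dots> \<le> N^2 * ((\<Sum>k\<in>V. norm (G u k)^2) * (\<Sum>k\<in>V. norm (corr (\<lambda>x. cnj (D u x)) (D u) k)^2))"
      unfolding G_def by (intro mult_left_mono corr_autocorr) auto
    \<comment> \<open>Here the function f disappears: its derivatives are bounded by one, so their
      autocorrelations are bounded by N.\<close>
    also have "\<dots> \<le> N^2 * ((\<Sum>k\<in>V. norm (G u k)^2) * (\<Sum>k\<in>V. N^2))"
    proof (intro mult_left_mono sum_mono power_mono)
      fix k
      show "norm (corr (\<lambda>x. cnj (D u x)) (D u) k) \<le> N"
      proof -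
        have "norm (corr (\<lambda>x. cnj (D u x)) (D u) k) \<le> (\<Sum>x\<in>V. 1)"
          unfolding corr_def using Dbd by (intro sum_norm_le) (simp add: norm_mult mult_le_one)
        thus ?thesis by simp
      qed
    qed (auto intro: sum_nonneg)
    also have "\<dots> = N^5 * (\<Sum>k\<in>V. norm (G u k)^2)" by (simp add: eval_nat_numeral mult_ac)
    finally show ?thesis .
  qed
  have "(card S * (\<sigma> * N^2))^4 \<le> (\<Sum>u\<in>V. norm (T u))^4" using s1 \<sigma> by (intro power_mono) auto
  also have "\<dots> = ((\<Sum>u\<in>V. norm (T u))^2)^2" by simp
  also have "\<dots> \<le> (N * (\<Sum>u\<in>V. norm (T u)^2))^2" by (intro power_mono sum_square_le) auto
  also have "\<dots> = N^2 * (\<Sum>u\<in>V. norm (T u)^2)^2" by (simp add: power_mult_distrib)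
  also have "\<dots> \<le> N^2 * (N * (\<Sum>u\<in>V. (norm (T u)^2)^2))" by (intro mult_left_mono sum_square_le) auto
  also have "\<dots> \<le> N^2 * (N * (\<Sum>u\<in>V. N^5 * (\<Sum>k\<in>V. norm (G u k)^2)))"
    using Tu by (intro mult_left_mono sum_mono) auto
  also have "\<dots> = N^8 * (\<Sum>u\<in>V. \<Sum>k\<in>V. norm (G u k)^2)"
    by (simp add: sum_distrib_left[symmetric] eval_nat_numeral mult_ac)
  finally have s2: "(card S * (\<sigma> * N^2))^4 \<le> N^8 * (\<Sum>u\<in>V. \<Sum>k\<in>V. norm (G u k)^2)" .
  define P where "P = S \<times> S"
  have finP: "finite P" using finS by (simp add: P_def)
  define t where "t p = \<phi> (fst p) - \<phi> (snd p)" for p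
  define s where "s p = (fst p - snd p :: 'a)" for p
  have GP: "G u k = (\<Sum>p\<in>P. of_bool (s p = k) * e u (t p))" if "k \<in> V" for u k
  proof -
    have "G u k = (\<Sum>b\<in>S. cnj (e u (\<phi> b)) * g u (b + k))"
      unfolding G_def corr_def using S by (intro sum.mono_neutral_cong_right) (auto simp: g_def)
    also have "\<dots> = (\<Sum>b\<in>S. \<Sum>a\<in>S. of_bool (a = b + k) * (e u (\<phi> a) * cnj (e u (\<phi> b))))"
    proof (rule sum.cong[OF refl])
      fix b assume "b \<in> S"
      have "(\<Sum>a\<in>S. of_bool (a = b + k) * (e u (\<phi> a) * cnj (e u (\<phi> b)))) = 
        (\<Sum>a\<in>S. if a = b + k then e u (\<phi> a) * cnj (e u (\<phi> b)) else 0)"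
        by (intro sum.cong) auto
      also have "\<dots> = cnj (e u (\<phi> b)) * g u (b + k)"
        using finS by (simp add: g_def)
      finally show "cnj (e u (\<phi> b)) * g u (b + k) = (\<Sum>a\<in>S. of_bool (a = b + k) * (e u (\<phi> a) * cnj (e u (\<phi> b))))" ..
    qed
    also have "\<dots> = (\<Sum>a\<in>S. \<Sum>b\<in>S. of_bool (a = b + k) * (e u (\<phi> a) * cnj (e u (\<phi> b))))"
      by (rule sum.swap)
    also have "\<dots> = (\<Sum>p\<in>P. of_bool (s p = k) * e u (t p))"
      unfolding P_def sum.cartesian_product s_def t_def e_diff'
      by (intro sum.cong refl) (auto simp: algebra_simps)
    finally show ?thesis .
  qed
  have "complex_of_real (\<Sum>u\<in>V. \<Sum>k\<in>V. norm (G u k)^2) = (\<Sum>u\<in>V. \<Sum>k\<in>V. \<Sum>p\<in>P. \<Sum>q\<in>P. 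
      of_bool (s p = k) * of_bool (s q = k) * e u (t p - t q))"
    unfolding of_real_sum
  proof (intro sum.cong refl)
    fix u k assume "k \<in> V"
    have "cnj (of_bool b) = of_bool b" for b by (cases b) auto
    thus "complex_of_real (norm (G u k)^2) = (\<Sum>p\<in>P. \<Sum>q\<in>P. of_bool (s p = k) * of_bool (s q = k) * e u (t p - t q))"
      unfolding complex_norm_square GP[OF \<open>k \<in> V\<close>] by (simp add: sum_product e_diff' mult_ac)
  qed
  also have "\<dots> = (\<Sum>u\<in>V. \<Sum>p\<in>P. \<Sum>q\<in>P. \<Sum>k\<in>V. of_bool (s p = k) * of_bool (s q = k) * e u (t p - t q))"
    by (rule sum.cong[OF refl], subst sum.swap, rule sum.cong[OF refl], rule sum.swap)
  also have "\<dots> = (\<Sum>p\<in>P. \<Sum>q\<in>P. \<Sum>u\<in>V. \<Sum>k\<in>V. of_bool (s p = k) * of_bool (s q = k) * e u (t p - t q))"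
    by (subst sum.swap, rule sum.cong[OF refl], rule sum.swap)
  also have "\<dots> = (\<Sum>p\<in>P. \<Sum>q\<in>P. complex_of_real (N * of_bool (s p = s q \<and> t p = t q)))"
  proof (intro sum.cong refl)
    fix p q assume p: "p \<in> P" "q \<in> P"
    have sV: "s p \<in> V" using p S by (auto simp: P_def s_def intro!: V_closed)
    have tV: "t p - t q \<in> V" using p \<phi> by (auto simp: P_def t_def intro!: V_closed)
    have "(\<Sum>k\<in>V. of_bool (s p = k) * of_bool (s q = k) * e u (t p - t q)) = of_bool (s p = s q) * e u (t p - t q)" for u
    proof -
      have "(\<Sum>k\<in>V. of_bool (s p = k) * of_bool (s q = k) * e u (t p - t q)) = 
         (\<Sum>k\<in>V. if k = s p then of_bool (s q = s p) * e u (t p - t q) else 0)"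
        by (intro sum.cong) auto
      thus ?thesis using sV by (auto simp: eq_commute)
    qed
    thus "(\<Sum>u\<in>V. \<Sum>k\<in>V. of_bool (s p = k) * of_bool (s q = k) * e u (t p - t q)) = 
       complex_of_real (N * of_bool (s p = s q \<and> t p = t q))"
      using e_orth'[OF tV] by (simp add: sum_distrib_left[symmetric])
  qed
  also have "\<dots> = complex_of_real (N * (\<Sum>p\<in>P. \<Sum>q\<in>P. of_bool (s p = s q \<and> t p = t q)))"
    by (simp add: sum_distrib_left)
  finally have s3: "(\<Sum>u\<in>V. \<Sum>k\<in>V. norm (G u k)^2) = N * (\<Sum>p\<in>P. \<Sum>q\<in>P. of_bool (s p = s q \<and> t p = t q))"
    using of_real_eq_iff by blast
  define w where "w p = ((fst p, \<phi> (fst p)), (snd p, \<phi> (snd p)))" for p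
  have bij: "bij_betw w P (\<Gamma>\<times>\<Gamma>)"
    by (auto simp: bij_betw_def inj_on_def w_def P_def \<Gamma>_def image_iff)
  have "(\<Sum>p\<in>\<Gamma>\<times>\<Gamma>. rep \<Gamma> (fst p - snd p)) = (\<Sum>p\<in>P. \<Sum>q\<in>P. of_bool (s p = s q \<and> t p = t q))"
  proof -
    have fin: "finite (\<Gamma>\<times>\<Gamma>)" using finS by (simp add: \<Gamma>_def)
    have "(\<Sum>p\<in>\<Gamma>\<times>\<Gamma>. rep \<Gamma> (fst p - snd p)) = 
      (\<Sum>p\<in>\<Gamma>\<times>\<Gamma>. \<Sum>q\<in>\<Gamma>\<times>\<Gamma>. of_bool (fst q - snd q = fst p - snd p))"
      unfolding rep_def card_sum_of_bool[OF fin] ..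
    also have "\<dots> = (\<Sum>p\<in>P. \<Sum>q\<in>P. of_bool (fst (w q) - snd (w q) = fst (w p) - snd (w p)))"
      by (simp only: sum.reindex_bij_betw[OF bij, symmetric])
    also have "\<dots> = (\<Sum>p\<in>P. \<Sum>q\<in>P. of_bool (s p = s q \<and> t p = t q))"
      by (intro sum.cong refl arg_cong[of _ _ of_bool]) (auto simp: w_def s_def t_def)
    finally show ?thesis .
  qed
  with s2 s3 have "(card S * (\<sigma> * N^2))^4 \<le> N^8 * (N * (\<Sum>p\<in>\<Gamma>\<times>\<Gamma>. rep \<Gamma> (fst p - snd p)))" by simp
  moreover have "(card S * (\<sigma> * N^2))^4 = N^8 * (card S * \<sigma>)^4" 
    by (simp add: power_mult_distrib mult_ac flip: power_mult)
  ultimately show ?thesis by simp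
qed

end

section \<open>Freiman homomorphisms\<close>

context dual_group
begin

lemma pigeonhole_characters:
  fixes t :: "'b \<Rightarrow> 'a"
  assumes "finite X" "finite B"
  shows "\<exists>B'\<subseteq>B. card B \<le> 5 ^ card X * card B' \<and> (\<forall>b\<in>B'. \<forall>b'\<in>B'. \<forall>\<xi>\<in>X. e (t b) \<xi> = e (t b') \<xi>)"
  using assms(1)
proof induction
  case empty thus ?case by (intro exI[of _ B]) auto
next
  case (insert \<xi> X)
  then obtain B' where B': "B' \<subseteq> B" "card B \<le> 5 ^ card X * card B'"
    "\<forall>b\<in>B'. \<forall>b'\<in>B'. \<forall>\<xi>\<in>X. e (t b) \<xi> = e (t b') \<xi>" by blast
  obtain z where z: "card B' \<le> 5 * card {b\<in>B'. e (t b) \<xi> = z}"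
    using pigeonhole_roots[of B' "\<lambda>b. e (t b) \<xi>"] e_pow5 B' assms(2) finite_subset by blast
  have "card B \<le> 5 ^ card X * (5 * card {b\<in>B'. e (t b) \<xi> = z})"
    using B'(2) z by (meson mult_le_mono2 order_trans)
  hence "card B \<le> 5 ^ card (insert \<xi> X) * card {b\<in>B'. e (t b) \<xi> = z}" using insert by (simp add: mult_ac)
  thus ?case using B' by (intro exI[of _ "{b\<in>B'. e (t b) \<xi> = z}"]) auto
qed

text \<open>The characters trivial at y form a proper subgroup, which is disjoint from its translate
  by a character that is not.\<close>

lemma card_kernel_le_half:
  assumes "y \<in> V" "y \<noteq> 0" shows "2 * card {\<xi>\<in>V. e y \<xi> = 1} \<le> card V"
proof -
  let ?K = "{\<xi>\<in>V. e y \<xi> = 1}"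
  obtain \<xi>0 where x: "\<xi>0 \<in> V" "e y \<xi>0 \<noteq> 1" using ex_separating[OF assms] .
  have "2 * card ?K = card ?K + card ((\<lambda>\<xi>. \<xi> + \<xi>0) ` ?K)" by (simp add: card_image)
  also have "\<dots> = card (?K \<union> (\<lambda>\<xi>. \<xi> + \<xi>0) ` ?K)"
    using x by (intro card_Un_disjoint[symmetric]) (auto simp: e_add')
  also have "\<dots> \<le> card V" using x by (intro card_mono) (auto intro: V_closed)
  finally show ?thesis .
qed

text \<open>A random character is trivial at a given nonzero point with probability at most 1/2. So
  some character leaves at most half of the points unseparated, and the number of characters needed
  is about the binary logarithm of the size of \<open>D\<close>.\<close>

lemma separating_characters:
  assumes "finite D" "D \<subseteq> V" "card (D - {0}) < 2 ^ m"
  shows "\<exists>X. finite X \<and> card X \<le> m \<and> (\<forall>y\<in>D. y \<noteq> 0 \<longrightarrow> (\<exists>\<xi>\<in>X. e y \<xi> \<noteq> 1))"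
  using assms
proof (induction m arbitrary: D)
  case 0
  hence "D - {0} = {}" by simp
  thus ?case by (intro exI[of _ "{}"]) auto
next
  case (Suc m)
  define E where "E = D - {0}"
  have finE: "finite E" using Suc by (simp add: E_def)
  have "\<exists>\<xi>\<in>V. 2 * card {y\<in>E. e y \<xi> = 1} \<le> card E"
  proof (rule ccontr)
    assume "\<not> ?thesis"
    hence n: "card E < 2 * card {y\<in>E. e y \<xi> = 1}" if "\<xi> \<in> V" for \<xi> using that by (simp add: not_le)
    have "(\<Sum>\<xi>\<in>V. card E) < (\<Sum>\<xi>\<in>V. 2 * card {y\<in>E. e y \<xi> = 1})"
      using n by (intro sum_strict_mono) auto
    also have "\<dots> = 2 * (\<Sum>\<xi>\<in>V. \<Sum>y\<in>E. of_bool (e y \<xi> = 1))"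
      using finE by (simp add: sum_distrib_left Int_def)
    also have "\<dots> = (\<Sum>y\<in>E. 2 * card {\<xi>\<in>V. e y \<xi> = 1})"
      by (subst sum.swap) (simp add: sum_distrib_left Int_def)
    also have "\<dots> \<le> (\<Sum>y\<in>E. card V)"
      using Suc.prems by (intro sum_mono card_kernel_le_half) (auto simp: E_def)
    finally show False by simp
  qed
  then obtain \<xi> where \<xi>: "\<xi> \<in> V" "2 * card {y\<in>E. e y \<xi> = 1} \<le> card E" by blast
  let ?D = "{y\<in>E. e y \<xi> = 1}"
  have "card (?D - {0}) \<le> card ?D" using finE by (intro card_mono) auto
  hence "card (?D - {0}) < 2 ^ m" using \<xi>(2) Suc.prems(3) by (simp add: E_def)
  moreover have "finite ?D" "?D \<subseteq> V" using finE Suc.prems by (auto simp: E_def)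
  ultimately obtain X where X: "finite X" "card X \<le> m" "\<forall>y\<in>?D. y \<noteq> 0 \<longrightarrow> (\<exists>\<xi>\<in>X. e y \<xi> \<noteq> 1)"
    using Suc.IH by meson
  show ?case
    using X by (intro exI[of _ "insert \<xi> X"]) (auto simp: E_def card_insert_if)
qed

lemma ksum_fst_snd_V:
  assumes "X \<subseteq> V \<times> V" shows "ksum k X \<subseteq> V \<times> V"
proof (induction k)
  case (Suc k) thus ?case using assms by (auto simp: plus_prod_def intro!: V_closed; blast)
qed (auto simp: zero_prod_def)

lemma ksum_character_trivial:
  assumes "\<And>x. x \<in> X \<Longrightarrow> e (snd x) \<xi> = 1" shows "z \<in> ksum k X \<Longrightarrow> e (snd z) \<xi> = 1"
proof (induction k arbitrary: z)
  case (Suc k) thus ?case using assms by (auto simp: e_add)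
qed auto

text \<open>Small doubling bounds the vertical fibre \<open>D\<close> of the sixfold sums, but does
  not make it trivial. Characters are chosen that separate \<open>D\<close> from 0, and the graph is
  restricted to points at which each of them is constant. They are then trivial on all sums of
  differences, so only 0 survives in the fibre.\<close>

lemma freiman_model:
  fixes c :: real
  assumes S: "S \<subseteq> V" "S \<noteq> {}" and \<phi>: "\<And>h. h \<in> S \<Longrightarrow> \<phi> h \<in> V" and c: "0 < c" "c \<le> 1"
  defines "\<Gamma> \<equiv> (\<lambda>h. (h, \<phi> h)) ` S"
  assumes energy: "(\<Sum>p\<in>\<Gamma>\<times>\<Gamma>. rep \<Gamma> (fst p - snd p)) \<ge> c * card S^3"
  shows "\<exists>S'\<subseteq>S. card S' \<ge> c^721 / (12 * 2^1623) * card S \<and>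
    (\<forall>z\<in>ksum 6 {(a - b, \<phi> a - \<phi> b) |a b. a \<in> S' \<and> b \<in> S'}. fst z = 0 \<longrightarrow> snd z = 0)"
proof -
  have finS: "finite S" using S(1) by (rule finite_subset) simp
  have injG: "inj_on fst \<Gamma>" by (auto simp: \<Gamma>_def inj_on_def)
  have cardG: "card \<Gamma> = card S" unfolding \<Gamma>_def by (intro card_image) (auto simp: inj_on_def)
  have finG: "finite \<Gamma>" using finS by (simp add: \<Gamma>_def)
  have neG: "\<Gamma> \<noteq> {}" using S by (simp add: \<Gamma>_def)
  obtain A where A: "A \<subseteq> \<Gamma>" "card A \<ge> c/6 * card S"
    "real (card {a - b |a b. a\<in>A \<and> b\<in>A}) \<le> 2^19 / c^9 * card S"
    using balog_szemeredi_gowers[OF finG neG c(1)] energy cardG by auto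
  \<comment> \<open>The size of the difference set is 2^19/c^9 times that of \<open>S\<close>, and
    \<open>S\<close> is at most 6/c times larger than \<open>A\<close>; 6 is rounded up to
    2^3.\<close>
  define K where "K = 2^22 / c^10"
  have K: "K > 0" using c by (simp add: K_def)
  have S0: "card S > 0" using S finS by (simp add: card_gt_0_iff)
  have A0: "card A > 0" 
  proof -
    have "0 < c/6 * card S" using c S0 by simp
    thus ?thesis using A(2) by linarith
  qed
  have finA: "finite A" using A finG finite_subset by auto
  have dbl: "card {a - b |a b. a\<in>A \<and> b\<in>A} \<le> K * card A"
  proof -
    have "card S \<le> 6 / c * card A" using A(2) c by (simp add: field_simps)
    hence "2^19 / c^9 * card S \<le> 2^19 / c^9 * (6 / c * card A)" using c by (intro mult_left_mono) auto
    also have "\<dots> \<le> K * card A" using c by (simp add: K_def field_simps) (simp add: eval_nat_numeral)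
    finally show ?thesis using A(3) by linarith
  qed
  have injA: "inj_on fst A" using injG A(1) by (rule inj_on_subset)
  have neA: "A \<noteq> {}" using A0 by auto
  obtain B where B: "B \<subseteq> A" "card A \<le> 2 * card B"
    and D: "finite {y. (0, y) \<in> ksum 6 {x - y |x y. x \<in> B \<and> y \<in> B}}"
      "card {y. (0, y) \<in> ksum 6 {x - y |x y. x \<in> B \<and> y \<in> B}} \<le> (2 * K^2)^(2*6)"
    using graph_vertical_fibre[OF finA neA K injA dbl, of 6] by blast
  define XB where "XB = {x - y |x y. x \<in> B \<and> y \<in> B}"
  define D where "D = {y. (0, y) \<in> ksum 6 XB}"
  have BV: "B \<subseteq> V \<times> V" using B(1) A(1) S \<phi> by (auto simp: \<Gamma>_def)
  have "XB \<subseteq> V \<times> V" using BV by (auto simp: XB_def minus_prod_def intro!: V_closed; blast)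
  hence DV: "D \<subseteq> V" using ksum_fst_snd_V by (auto simp: D_def)
  have finB: "finite B" using B finA finite_subset by auto
  have "B \<noteq> {}" using B(2) A0 by auto
  then obtain b where "b \<in> B" by blast
  hence "b - b \<in> XB" unfolding XB_def by blast
  hence "0 \<in> XB" by simp
  hence "0 \<in> ksum k XB" for k by (rule ksum_zero)
  hence D0: "0 \<in> D" by (simp add: D_def zero_prod_def)
  have finD: "finite D" using D(1) by (simp add: D_def XB_def)
  hence cD: "card D > 0" using D0 by (auto simp: card_gt_0_iff)
  have "\<exists>m. card D < 2 ^ m \<and> 2 ^ m \<le> 2 * card D"
  proof -
    obtain m where m: "2 ^ m \<le> card D" "card D < 2 ^ (m + 1)"
      using ex_power_ivl1[of 2 "card D"] cD by auto
    thus ?thesis by (intro exI[of _ "m+1"]) auto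
  qed
  then obtain m where m: "card D < 2 ^ m" "2 ^ m \<le> 2 * card D" by blast
  have "card (D - {0}) < 2 ^ m" using m(1) finD by (meson card_Diff1_le le_less_trans)
  from separating_characters[OF finD DV this]
  obtain X where X: "finite X" "card X \<le> m" "\<forall>y\<in>D. y \<noteq> 0 \<longrightarrow> (\<exists>\<xi>\<in>X. e y \<xi> \<noteq> 1)"
    by (elim exE conjE)
  obtain B' where B': "B' \<subseteq> B" "card B \<le> 5 ^ card X * card B'" 
    "\<forall>b\<in>B'. \<forall>b'\<in>B'. \<forall>\<xi>\<in>X. e (snd b) \<xi> = e (snd b') \<xi>"
    using pigeonhole_characters[OF X(1) finB, of snd] by (elim exE conjE)
  define S' where "S' = fst ` B'"
  have B'\<Gamma>: "B' \<subseteq> \<Gamma>" using B' B A by auto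
  have B'eq: "B' = (\<lambda>h. (h, \<phi> h)) ` S'" using B'\<Gamma> by (force simp: S'_def \<Gamma>_def)
  have cS': "card S' = card B'"
    unfolding S'_def by (intro card_image inj_on_subset[OF injG B'\<Gamma>])
  define X' where "X' = {x - y |x y. x \<in> B' \<and> y \<in> B'}"
  have X'eq: "{(a - b, \<phi> a - \<phi> b) |a b. a \<in> S' \<and> b \<in> S'} = X'"
    unfolding X'_def B'eq by (force simp: minus_prod_def)
  have "X' \<subseteq> XB" unfolding X'_def XB_def using B'(1) by blast
  hence sub: "ksum 6 X' \<subseteq> ksum 6 XB" by (rule ksum_mono)
  have fr: "snd z = 0" if z: "z \<in> ksum 6 X'" "fst z = 0" for z
  proof (rule ccontr)
    assume "snd z \<noteq> 0"
    moreover have "snd z \<in> D" using z sub by (cases z) (auto simp: D_def)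
    ultimately obtain \<xi> where \<xi>: "\<xi> \<in> X" "e (snd z) \<xi> \<noteq> 1" using X(3) by blast
    have "e (snd x) \<xi> = 1" if x: "x \<in> X'" for x
    proof -
      obtain b b' where "x = b - b'" "b \<in> B'" "b' \<in> B'" using x unfolding X'_def by blast
      moreover hence "e (snd b) \<xi> = e (snd b') \<xi>" using B'(3) \<xi> by blast
      ultimately show ?thesis using e_minus[of "snd b'" \<xi>] e_add[of "snd b'" "- snd b'" \<xi>]
        by (simp add: e_diff)
    qed
    thus False using ksum_character_trivial z(1) \<xi>(2) by blast
  qed
  \<comment> \<open>The fibre has at most (2 K^2)^12 = 2^540 / c^240 points. With 5 \<le> 2^3 and
    2^m at most twice the size of \<open>D\<close>, fixing the m character values costs at most the
    cube (2^541 / c^240)^3 = 2^1623 / c^720. The remaining c/12 is c/6 from the step to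
    \<open>A\<close> and 1/2 from the step to \<open>B\<close>.\<close>
  have "c^721 / (12 * 2^1623) * card S \<le> card S'"
  proof -
    have k0: "2 * K^2 = 2^45 / c^20" by (simp add: K_def power_divide flip: power_mult)
    have "card D \<le> (2 * K^2)^(2*6)" using D(2) by (simp add: D_def XB_def)
    also have "\<dots> = 2^540 / c^240" unfolding k0 by (simp add: power_divide flip: power_mult)
    finally have Dle: "real (card D) \<le> 2^540 / c^240" .
    have "(5::real) ^ card X \<le> 5 ^ m" using X(2) by (intro power_increasing) auto
    also have "(5::real) ^ m \<le> (2^3) ^ m" by (intro power_mono) auto
    also have "\<dots> = (real (2 ^ m))^3" by (simp only: power_mult[symmetric] mult.commute of_nat_power of_nat_numeral)
    also have "\<dots> \<le> (real (2 * card D))^3" using m(2) by (intro power_mono) (simp_all only: of_nat_le_iff of_nat_0_le_iff)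
    also have "\<dots> \<le> (2 * (2^540 / c^240))^3" using Dle by (intro power_mono) auto
    also have "\<dots> = 2^1623 / c^720" by (simp add: power_divide flip: power_mult)
    finally have 5: "(5::real) ^ card X \<le> 2^1623 / c^720" .
    define q :: real where "q = 2^1623"
    have q: "q > 0" by (simp only: q_def zero_less_power zero_less_numeral)
    have "c/12 * card S \<le> real (card B)" using A(2) B(2) by linarith
    also have "\<dots> \<le> 5 ^ card X * real (card B')" using B'(2) by (metis of_nat_le_iff of_nat_mult of_nat_numeral of_nat_power)
    also have "\<dots> \<le> q / c^720 * card B'" unfolding q_def by (rule mult_right_mono[OF 5]) simp
    finally have "c/12 * card S * (c^720 / q) \<le> q / c^720 * card B' * (c^720 / q)"
      using c q by (intro mult_right_mono) auto
    also have "\<dots> = card B'" using c q by simp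
    also have "c/12 * card S * (c^720 / q) = (c * c^720) / (12 * q) * card S" by simp
    also have "c * c^720 = c^721" by (simp flip: power_Suc)
    finally show ?thesis unfolding q_def cS' .
  qed
  moreover have "S' \<subseteq> S" using B'\<Gamma> by (auto simp: S'_def \<Gamma>_def)
  ultimately show ?thesis using fr X'eq by (intro exI[of _ S']) auto
qed

end

section \<open>Linearisation\<close>

text \<open>
  The value \<open>z + z\<inverse> = z + z\<^sup>4\<close> determines \<open>z\<close> up to inversion, and is a root of \<open>t\<^sup>2 + t - 1\<close> if \<open>z \<noteq> 1\<close>.
\<close>

lemma fifth_roots_pair:
  fixes z1 z2 z3 :: complex
  assumes "z1^5 = 1" "z2^5 = 1" "z3^5 = 1" "z1 \<noteq> 1" "z2 \<noteq> 1" "z3 \<noteq> 1"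
  shows "(z1 = z2 \<or> z1 * z2 = 1) \<or> (z1 = z3 \<or> z1 * z3 = 1) \<or> (z2 = z3 \<or> z2 * z3 = 1)"
proof -
  define t where "t z = z + z^4" for z :: complex
  have q: "t z ^ 2 + t z = 1" if "z^5 = 1" "z \<noteq> 1" for z
  proof -
    have "(z - 1) * (z^4 + z^3 + z^2 + z + 1) = z^5 - 1" by (simp add: algebra_simps eval_nat_numeral)
    hence g: "z^4 + z^3 + z^2 + z + 1 = 0" using that by simp
    have "t z ^ 2 + t z = z^2 + 2 * z^5 + z^5 * z^3 + z + z^4"
      by (simp add: t_def algebra_simps eval_nat_numeral)
    also have "\<dots> = 1 + (z^4 + z^3 + z^2 + z + 1)" using that by simp
    finally show ?thesis using g by simp
  qed
  have p: "z = w \<or> z * w = 1" if "t z = t w" "z^5 = 1" "w^5 = 1" for z w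
  proof -
    have "z * w * (z + z^4) = z * w * (w + w^4)" using that by (simp add: t_def)
    hence "z * (z * w) + z^5 * w = w * (z * w) + w^5 * z" by (simp add: algebra_simps eval_nat_numeral)
    hence "(z - w) * (z * w - 1) = 0" using that by (simp add: algebra_simps)
    thus ?thesis by simp
  qed
  have "t z1 = t z2 \<or> t z1 = t z3 \<or> t z2 = t z3"
  proof (rule ccontr)
    assume n: "\<not> ?thesis"
    have "(t z1 - t z2) * (t z1 + t z2 + 1) = (t z1 ^ 2 + t z1) - (t z2 ^ 2 + t z2)"
      "(t z1 - t z3) * (t z1 + t z3 + 1) = (t z1 ^ 2 + t z1) - (t z3 ^ 2 + t z3)"
      by (simp_all add: algebra_simps power2_eq_square)
    hence "t z1 + t z2 + 1 = 0" "t z1 + t z3 + 1 = 0" using n q assms by auto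
    thus False using n by (metis add_left_cancel add_right_cancel)
  qed
  thus ?thesis using p assms by blast
qed

context dual_group
begin

lemma fourier_autocorr: "\<xi> \<in> V \<Longrightarrow> fourier (corr (\<lambda>x. cnj (f x)) f) \<xi> = complex_of_real (norm (fourier f \<xi>)^2)"
  using complex_norm_square[of "fourier f \<xi>"]
  by (simp add: fourier_corr) (simp add: fourier_def e_minus' mult.commute)

text \<open>
  If \<open>v\<close> is annihilated by the large spectrum, then by Parseval the autocorrelation \<open>r\<close> of \<open>S\<close> is close in \<open>L\<^sup>2\<close> to its
  translate by \<open>v\<close>, so the supports of the two cannot be disjoint.
\<close>

lemma bogolyubov:
  assumes S: "S \<subseteq> V" "S \<noteq> {}"
  shows "\<exists>X. finite X \<and> card X \<le> 4 * (N / card S)^2 \<and>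
    (\<forall>v\<in>V. (\<forall>\<xi>\<in>X. e v \<xi> = 1) \<longrightarrow> (\<exists>a\<in>S. \<exists>b\<in>S. \<exists>c\<in>S. \<exists>d\<in>S. v = (a - b) + (c - d)))"
proof -
  define m where "m = real (card S)"
  have finS: "finite S" using S(1) by (rule finite_subset) simp
  have m0: "m > 0" using S finS by (simp add: m_def card_gt_0_iff)
  define i :: "'a \<Rightarrow> complex" where "i x = of_bool (x \<in> S)" for x
  have VS: "V \<inter> S = S" using S by auto
  have isum: "(\<Sum>x\<in>V. norm (i x)^2) = m"
  proof -
    have "(\<Sum>x\<in>V. norm (i x)^2) = (\<Sum>x\<in>V. of_bool (x \<in> S))" by (intro sum.cong) (auto simp: i_def)
    thus ?thesis by (simp add: VS m_def)
  qed
  \<comment> \<open>With this value the contribution of the small coefficients, 4 \<theta> N m,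
    equals m^4, whereas disjoint supports would give at least 2 m^4. Parseval then bounds the large
    spectrum by N m / \<theta> = 4 (N/m)^2.\<close>
  define \<theta> where "\<theta> = m^3 / (4 * N)"
  have \<theta>: "\<theta> > 0" using m0 N_pos by (simp add: \<theta>_def)
  define X where "X = {\<xi>\<in>V. norm (fourier i \<xi>)^2 \<ge> \<theta>}"
  have finX: "finite X" by (simp add: X_def)
  have "card X * \<theta> = (\<Sum>\<xi>\<in>X. \<theta>)" by simp
  also have "\<dots> \<le> (\<Sum>\<xi>\<in>X. norm (fourier i \<xi>)^2)" by (intro sum_mono) (auto simp: X_def)
  also have "\<dots> \<le> (\<Sum>\<xi>\<in>V. norm (fourier i \<xi>)^2)" by (intro sum_mono2) (auto simp: X_def)
  also have "\<dots> = N * m" by (simp add: parseval isum)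
  finally have "card X * \<theta> \<le> N * m" .
  moreover have "N * m = 4 * (N/m)^2 * \<theta>" using m0 N_neq by (simp add: \<theta>_def power2_eq_square power3_eq_cube)
  ultimately have cX: "card X \<le> 4 * (N / m)^2" using \<theta> by (metis mult_le_cancel_right_pos)
  define r where "r k = real (card {x\<in>S. x + k \<in> S})" for k
  define c where "c = corr (\<lambda>x. cnj (i x)) i"
  have cr: "c k = complex_of_real (r k)" for k
  proof -
    have "c k = (\<Sum>x\<in>V. of_bool (x \<in> S \<and> x + k \<in> S))"
      unfolding c_def corr_def by (intro sum.cong) (auto simp: i_def)
    also have "\<dots> = of_nat (card (V \<inter> {x. x \<in> S \<and> x + k \<in> S}))" by simp
    also have "V \<inter> {x. x \<in> S \<and> x + k \<in> S} = {x\<in>S. x + k \<in> S}" using S by auto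
    finally show ?thesis by (simp add: r_def)
  qed
  have rsum: "(\<Sum>k\<in>V. r k) = m^2"
  proof -
    have "(\<Sum>k\<in>V. r k) = (\<Sum>k\<in>V. \<Sum>x\<in>S. of_bool (x + k \<in> S))"
      unfolding r_def card_sum_of_bool[OF finS] ..
    also have "\<dots> = (\<Sum>x\<in>S. \<Sum>k\<in>V. of_bool (x + k \<in> S))" by (rule sum.swap)
    also have "\<dots> = (\<Sum>x\<in>S. \<Sum>k\<in>V. of_bool (k \<in> S))"
    proof (rule sum.cong[OF refl])
      fix x assume "x \<in> S"
      hence "x \<in> V" using S by auto
      from sum_shift'[OF subgroup_V this, of "\<lambda>k. of_bool (k \<in> S)"]
      show "(\<Sum>k\<in>V. of_bool (x + k \<in> S)) = (\<Sum>k\<in>V. of_bool (k \<in> S) :: real)" .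
    qed
    also have "\<dots> = m^2" by (simp add: VS m_def power2_eq_square)
    finally show ?thesis .
  qed
  have r2: "m^4 \<le> N * (\<Sum>k\<in>V. r k^2)"
  proof -
    have "m^4 = (\<Sum>k\<in>V. r k)^2" by (simp add: rsum flip: power_mult)
    thus ?thesis using sum_square_le[of r] by simp
  qed
  have "\<exists>a\<in>S. \<exists>b\<in>S. \<exists>c\<in>S. \<exists>d\<in>S. v = (a - b) + (c - d)" if v: "v \<in> V" "\<forall>\<xi>\<in>X. e v \<xi> = 1" for v
  proof (rule ccontr)
    assume n: "\<not> ?thesis"
    \<comment> \<open>If k and k + v were both differences of \<open>S\<close>, then v would be a
      sum of two differences.\<close>
    have disj: "r k * r (k + v) = 0" for k
    proof (rule ccontr)
      assume "r k * r (k + v) \<noteq> 0"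
      hence "{x\<in>S. x + k \<in> S} \<noteq> {}" "{x\<in>S. x + (k + v) \<in> S} \<noteq> {}" by (auto simp: r_def simp del: Collect_empty_eq)
      then obtain x y where xy: "x \<in> S" "x + k \<in> S" "y \<in> S" "y + (k + v) \<in> S" by blast
      have "v = ((y + (k + v)) - y) + (x - (x + k))" by simp
      thus False using n xy by blast
    qed
    define d where "d k = c (k + v) - c k" for k
    have Fd: "fourier d \<xi> = fourier c \<xi> * (cnj (e v \<xi>) - 1)" for \<xi>
    proof -
      have "(\<Sum>k\<in>V. c (k + v) * e k \<xi>) = (\<Sum>k\<in>V. c (k + v) * e (k + v) \<xi> * cnj (e v \<xi>))"
      proof (intro sum.cong refl)
        fix k
        have "e v \<xi> * cnj (e v \<xi>) = 1" using complex_norm_square[of "e v \<xi>"] by simp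
        thus "c (k + v) * e k \<xi> = c (k + v) * e (k + v) \<xi> * cnj (e v \<xi>)" by (simp add: e_add mult.assoc)
      qed
      also have "\<dots> = (\<Sum>k\<in>V. c k * e k \<xi> * cnj (e v \<xi>))"
        by (rule sum_shift[OF subgroup_V v(1), where f="\<lambda>k. c k * e k \<xi> * cnj (e v \<xi>)"])
      finally show ?thesis
        by (simp add: fourier_def d_def left_diff_distrib right_diff_distrib sum_subtractf sum_distrib_right mult.assoc)
    qed
    have "N * (2 * (\<Sum>k\<in>V. r k^2)) = N * (\<Sum>k\<in>V. norm (d k)^2)"
    proof -
      have "norm (d k)^2 = r (k + v)^2 + r k^2" for k
      proof -
        have "d k = complex_of_real (r (k + v) - r k)" by (simp add: d_def cr)
        hence "norm (d k)^2 = (r (k + v) - r k)^2" by (simp only: norm_of_real power2_abs)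
        also have "\<dots> = r (k + v)^2 + r k^2 - 2 * (r k * r (k + v))" by (simp add: power2_eq_square algebra_simps)
        finally show ?thesis using disj by simp
      qed
      thus ?thesis using sum_shift[OF subgroup_V v(1), of "\<lambda>k. r k^2"] by (simp add: sum.distrib)
    qed
    also have "\<dots> = (\<Sum>\<xi>\<in>V. norm (fourier d \<xi>)^2)" by (simp add: parseval)
    also have "\<dots> \<le> (\<Sum>\<xi>\<in>V. 4 * \<theta> * norm (fourier i \<xi>)^2)"
    proof (rule sum_mono)
      fix \<xi> assume \<xi>: "\<xi> \<in> V"
      show "norm (fourier d \<xi>)^2 \<le> 4 * \<theta> * norm (fourier i \<xi>)^2"
      proof (cases "\<xi> \<in> X")
        case True thus ?thesis using v \<theta> by (simp add: Fd)
      next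
        case False
        hence "norm (fourier i \<xi>)^2 \<le> \<theta>" using \<xi> by (simp add: X_def)
        moreover have "norm (cnj (e v \<xi>) - 1) \<le> 2" using norm_triangle_ineq4[of "cnj (e v \<xi>)" 1] by simp
        moreover have "norm (fourier d \<xi>) = norm (fourier i \<xi>)^2 * norm (cnj (e v \<xi>) - 1)"
          by (simp add: Fd c_def fourier_autocorr[OF \<xi>] norm_mult norm_power)
        ultimately have "norm (fourier d \<xi>)^2 \<le> (norm (fourier i \<xi>)^2)^2 * 2^2"
          by (simp only: power_mult_distrib) (intro mult_left_mono power_mono, auto)
        also have "\<dots> = norm (fourier i \<xi>)^2 * norm (fourier i \<xi>)^2 * 4" by (simp add: power2_eq_square)
        also have "\<dots> \<le> \<theta> * norm (fourier i \<xi>)^2 * 4" using \<open>norm (fourier i \<xi>)^2 \<le> \<theta>\<close> by (intro mult_right_mono) auto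
        finally show ?thesis by (simp add: mult_ac)
      qed
    qed
    also have "\<dots> = 4 * \<theta> * (N * m)" by (simp only: sum_distrib_left[symmetric] parseval isum)
    also have "\<dots> = m^4" using N_neq by (simp add: \<theta>_def eval_nat_numeral)
    finally have "2 * (N * (\<Sum>k\<in>V. r k^2)) \<le> m^4" by simp
    moreover have "m^4 > 0" using m0 by simp
    ultimately show False using r2 by linarith
  qed
  thus ?thesis using finX cX unfolding m_def by (intro exI[of _ X] conjI ballI impI)
qed

definition additive_on :: "'a set \<Rightarrow> ('a \<Rightarrow> 'a) \<Rightarrow> bool" where
  "additive_on H \<psi> \<longleftrightarrow> (\<forall>u\<in>H. \<forall>v\<in>H. \<psi> (u + v) = \<psi> u + \<psi> v)"

lemma additive_onD: "additive_on H \<psi> \<Longrightarrow> u \<in> H \<Longrightarrow> v \<in> H \<Longrightarrow> \<psi> (u + v) = \<psi> u + \<psi> v"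
  by (simp add: additive_on_def)

lemma additive_on_subset: "additive_on H \<psi> \<Longrightarrow> H' \<subseteq> H \<Longrightarrow> additive_on H' \<psi>"
  by (auto simp: additive_on_def)

text \<open>Over each v in \<open>H\<close> lies a sum of two differences of the graph, and its
  height defines \<psi> v. Two heights over the same point agree as long as their comparison
  involves at most six differences; additivity uses 2 + 2 + 2 of them.\<close>

lemma freiman_linear:
  fixes \<phi> :: "'a \<Rightarrow> 'a"
  assumes S: "S \<noteq> {}"
  defines "X \<equiv> {(a - b, \<phi> a - \<phi> b) |a b. a \<in> S \<and> b \<in> S}"
  assumes freiman: "\<And>z. z \<in> ksum 6 X \<Longrightarrow> fst z = 0 \<Longrightarrow> snd z = 0"
    and H: "fin_subgroup H" "\<And>v. v \<in> H \<Longrightarrow> \<exists>a\<in>S. \<exists>b\<in>S. \<exists>c\<in>S. \<exists>d\<in>S. v = (a - b) + (c - d)"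
  shows "\<exists>\<psi>. additive_on H \<psi> \<and>
    (\<forall>a\<in>S. \<forall>b\<in>S. a - b \<in> H \<longrightarrow> \<phi> a = \<phi> b + \<psi> (a - b))"
proof -
  have X_neg: "- x \<in> X" if x: "x \<in> X" for x
  proof -
    obtain a b where "x = (a - b, \<phi> a - \<phi> b)" "a \<in> S" "b \<in> S" using x unfolding X_def by blast
    moreover hence "- x = (b - a, \<phi> b - \<phi> a)" by simp
    ultimately show ?thesis unfolding X_def by blast
  qed
  obtain s where "s \<in> S" using S by blast
  hence "(s - s, \<phi> s - \<phi> s) \<in> X" unfolding X_def by blast
  hence X0: "0 \<in> X" by (simp add: zero_prod_def)
  define \<psi> where "\<psi> v = (SOME y. (v, y) \<in> ksum 2 X)" for v
  have \<psi>: "(v, \<psi> v) \<in> ksum 2 X" if v: "v \<in> H" for v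
  proof -
    obtain a b c d where s: "a \<in> S" "b \<in> S" "c \<in> S" "d \<in> S" "v = (a - b) + (c - d)" using H(2)[OF v] by blast
    have "(a - b, \<phi> a - \<phi> b) \<in> X" "(c - d, \<phi> c - \<phi> d) \<in> X" unfolding X_def using s by blast+
    hence "(a - b, \<phi> a - \<phi> b) + (c - d, \<phi> c - \<phi> d) \<in> ksum (1 + 1) X" by (intro ksum_add ksum_1)
    hence "\<exists>y. (v, y) \<in> ksum 2 X" using s by (auto simp: one_add_one simp del: One_nat_def)
    thus ?thesis unfolding \<psi>_def by (rule someI_ex)
  qed
  have "\<psi> (v + w) = \<psi> v + \<psi> w" if v: "v \<in> H" "w \<in> H" for v w
  proof -
    have "(v, \<psi> v) + (w, \<psi> w) \<in> ksum (2 + 2) X" using \<psi> v by (intro ksum_add) auto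
    moreover have "- (v + w, \<psi> (v + w)) \<in> ksum 2 X" using \<psi> v fin_subgroup_add[OF H(1)] X_neg by (intro ksum_uminus) auto
    ultimately have "((v, \<psi> v) + (w, \<psi> w)) + - (v + w, \<psi> (v + w)) \<in> ksum ((2 + 2) + 2) X" by (rule ksum_add)
    hence "((v, \<psi> v) + (w, \<psi> w)) + - (v + w, \<psi> (v + w)) \<in> ksum 6 X" by simp
    from freiman[OF this] show ?thesis by simp
  qed
  moreover have "\<phi> a = \<phi> b + \<psi> (a - b)" if ab: "a \<in> S" "b \<in> S" "a - b \<in> H" for a b
  proof -
    have "(a - b, \<phi> a - \<phi> b) \<in> X" unfolding X_def using ab by blast
    \<comment> \<open>One difference against the two behind \<psi> makes only three; zeros fill up
      to the required six.\<close>
    hence "(a - b, \<phi> a - \<phi> b) + 0 \<in> ksum (Suc 3) X" unfolding ksum.simps(2) using ksum_zero[OF X0] by blast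
    moreover have "- (a - b, \<psi> (a - b)) \<in> ksum 2 X" using \<psi> ab X_neg by (intro ksum_uminus) auto
    ultimately have "((a - b, \<phi> a - \<phi> b) + 0) + - (a - b, \<psi> (a - b)) \<in> ksum (Suc 3 + 2) X" by (rule ksum_add)
    hence "((a - b, \<phi> a - \<phi> b) + 0) + - (a - b, \<psi> (a - b)) \<in> ksum 6 X" by simp
    from freiman[OF this] show ?thesis by (simp add: algebra_simps zero_prod_def)
  qed
  ultimately show ?thesis unfolding additive_on_def by (intro exI[of _ \<psi>] conjI ballI impI)
qed

end

section \<open>Isotropic subgroups and correlation on cosets\<close>

context dual_group
begin

lemma e_of_nat: "e (of_nat i * v) y = e v y ^ i"
  by (induction i) (auto simp: e_add algebra_simps)

text \<open>Three characters are made trivial, each at the cost of a factor 5. Two of them give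
  orthogonality to v in both orders, as \<psi> need not be symmetric. The third, \<xi>, is
  nontrivial at v and thereby witnesses that v is independent of \<open>H'\<close>.\<close>

lemma perp_subgroup:
  assumes H: "fin_subgroup H" "H \<subseteq> V" and \<psi>: "additive_on H \<psi>"
    and v: "v \<in> H" "v \<noteq> 0"
  shows "\<exists>\<xi> H'. H' \<subseteq> H \<and> fin_subgroup H' \<and> card H \<le> 125 * card H' \<and> e v \<xi> \<noteq> 1 \<and>
    (\<forall>u\<in>H'. e u (\<psi> v) = 1 \<and> e v (\<psi> u) = 1 \<and> e u \<xi> = 1)"
proof -
  obtain \<xi> where \<xi>: "e v \<xi> \<noteq> 1" using ex_separating v H by blast
  define H1 where "H1 = {u\<in>H. e u (\<psi> v) = 1}"
  define H2 where "H2 = {u\<in>H1. e v (\<psi> u) = 1}"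
  define H3 where "H3 = {u\<in>H2. e u \<xi> = 1}"
  have 1: "fin_subgroup H1" "card H \<le> 5 * card H1"
    unfolding H1_def by (rule hom_ker[OF H(1)]; simp add: e_add e_pow5)+
  have 2: "fin_subgroup H2" "card H1 \<le> 5 * card H2"
    unfolding H2_def by (rule hom_ker[OF 1(1)]; simp add: H1_def additive_onD[OF \<psi>] e_add' e_pow5)+
  have 3: "fin_subgroup H3" "card H2 \<le> 5 * card H3"
    unfolding H3_def by (rule hom_ker[OF 2(1)]; simp add: e_add e_pow5)+
  have "card H \<le> 125 * card H3" using 1 2 3 by linarith
  moreover have "H3 \<subseteq> H" "\<forall>u\<in>H3. e u (\<psi> v) = 1 \<and> e v (\<psi> u) = 1 \<and> e u \<xi> = 1"
    by (auto simp: H3_def H2_def H1_def)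
  ultimately show ?thesis using 3(1) \<xi> by (intro exI[of _ \<xi>] exI[of _ H3] conjI)
qed

lemma ex_nonzero: "card H > 1 \<Longrightarrow> \<exists>v\<in>H. v \<noteq> 0"
  using card_mono[of "{0}" H] by fastforce

text \<open>
  Among three vectors that are orthogonal to each other in both orders, two have values \<open>e a (\<psi> a)\<close>, \<open>e b (\<psi> b)\<close> that
  are equal or inverse to each other; since \<open>1 + 2\<^sup>2 = 0\<close> modulo 5, one of \<open>a + 2b\<close>, \<open>a + b\<close> is then isotropic.
\<close>

lemma isotropic_vector:
  assumes H: "fin_subgroup H" "H \<subseteq> V" and \<psi>: "additive_on H \<psi>"
    and big: "card H > 125^2"
  shows "\<exists>v\<in>H. v \<noteq> 0 \<and> e v (\<psi> v) = 1"
proof -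
  have pair: "\<exists>v\<in>H. v \<noteq> 0 \<and> e v (\<psi> v) = 1"
    if ab: "a \<in> H" "b \<in> H" "e a \<xi> \<noteq> 1" "e b \<xi> = 1" "e a (\<psi> b) = 1" "e b (\<psi> a) = 1"
      and c: "e a (\<psi> a) = e b (\<psi> b) \<or> e a (\<psi> a) * e b (\<psi> b) = 1" for a b \<xi>
    using c
  proof
    assume c: "e a (\<psi> a) = e b (\<psi> b)"
    \<comment> \<open>The vector is a + 2b, with value the product of the first and the fourth power
      of the second. The character \<xi> is trivial at b but not at a, so neither a + 2b nor a + b
      vanishes.\<close>
    have bb: "b + b \<in> H" using ab fin_subgroup_add H by blast
    have pe: "\<psi> (a + (b + b)) = \<psi> a + (\<psi> b + \<psi> b)" using additive_onD[OF \<psi>] ab bb by metis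
    have "e (a + (b + b)) (\<psi> (a + (b + b))) = e a (\<psi> a) * e b (\<psi> b) ^ 4"
      unfolding pe e_add e_add' using ab by (simp add: eval_nat_numeral)
    also have "\<dots> = e b (\<psi> b) ^ 5" using c by (simp add: eval_nat_numeral)
    finally have "e (a + (b + b)) (\<psi> (a + (b + b))) = 1" by (simp add: e_pow5)
    moreover have "a + (b + b) \<noteq> 0"
    proof
      assume "a + (b + b) = 0"
      hence "e (a + (b + b)) \<xi> = 1" by (simp only: e_0)
      thus False unfolding e_add using ab by simp
    qed
    ultimately show ?thesis using ab bb fin_subgroup_add H by blast
  next
    assume c: "e a (\<psi> a) * e b (\<psi> b) = 1"
    have "e (a + b) (\<psi> (a + b)) = e a (\<psi> a) * e b (\<psi> b)"
      using additive_onD[OF \<psi>] ab by (simp add: e_add e_add')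
    moreover have "a + b \<noteq> 0"
    proof
      assume "a + b = 0"
      hence "e (a + b) \<xi> = 1" by simp
      thus False using ab by (simp add: e_add)
    qed
    ultimately show ?thesis using ab c fin_subgroup_add H by (intro bexI[of _ "a + b"]) auto
  qed
  have "card H > 1" using big by simp
  then obtain a where a: "a \<in> H" "a \<noteq> 0" by (meson ex_nonzero)
  obtain \<xi> H1 where H1: "H1 \<subseteq> H" "fin_subgroup H1" "card H \<le> 125 * card H1" "e a \<xi> \<noteq> 1"
    "\<forall>u\<in>H1. e u (\<psi> a) = 1 \<and> e a (\<psi> u) = 1 \<and> e u \<xi> = 1"
    using perp_subgroup[OF H \<psi> a] by (elim exE conjE)
  have "card H1 > 1" using big H1(3) by simp
  then obtain b where b: "b \<in> H1" "b \<noteq> 0" by (meson ex_nonzero)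
  have \<psi>1: "additive_on H1 \<psi>" using additive_on_subset[OF \<psi> H1(1)] .
  have H1V: "H1 \<subseteq> V" using H1(1) H(2) by blast
  obtain \<xi>' H2 where H2: "H2 \<subseteq> H1" "fin_subgroup H2" "card H1 \<le> 125 * card H2" "e b \<xi>' \<noteq> 1"
    "\<forall>u\<in>H2. e u (\<psi> b) = 1 \<and> e b (\<psi> u) = 1 \<and> e u \<xi>' = 1"
    using perp_subgroup[OF H1(2) H1V \<psi>1 b] by (elim exE conjE)
  have "card H2 > 1" using big H1(3) H2(3) by simp
  then obtain c where c: "c \<in> H2" "c \<noteq> 0" by (meson ex_nonzero)
  have mem: "a \<in> H" "b \<in> H" "c \<in> H" "c \<in> H1" using a b c H1 H2 by auto
  show ?thesis
  proof (cases "e a (\<psi> a) = 1 \<or> e b (\<psi> b) = 1 \<or> e c (\<psi> c) = 1")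
    case True thus ?thesis using a b c mem by blast
  next
    case False
    hence "(e a (\<psi> a) = e b (\<psi> b) \<or> e a (\<psi> a) * e b (\<psi> b) = 1) \<or>
      (e a (\<psi> a) = e c (\<psi> c) \<or> e a (\<psi> a) * e c (\<psi> c) = 1) \<or>
      (e b (\<psi> b) = e c (\<psi> c) \<or> e b (\<psi> b) * e c (\<psi> c) = 1)"
      by (intro fifth_roots_pair) (auto simp: e_pow5)
    moreover have "e b \<xi> = 1" "e a (\<psi> b) = 1" "e b (\<psi> a) = 1" "e c \<xi> = 1" "e a (\<psi> c) = 1" "e c (\<psi> a) = 1"
      "e c \<xi>' = 1" "e b (\<psi> c) = 1" "e c (\<psi> b) = 1"
      using H1(5) H2(5) b c mem by simp_all
    ultimately show ?thesis
      using pair[OF mem(1,2) H1(4)] pair[OF mem(1,3) H1(4)] pair[OF mem(2,3) H2(4)] by argo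
  qed
qed

text \<open>Greedy choice: take an isotropic v, find an isotropic subgroup in the part of
  \<open>H\<close> orthogonal to v on both sides, and adjoin the multiples of v. A step costs a
  factor 125 and at least doubles the subgroup. The two spare factors 125 are what finding an
  isotropic vector consumes.\<close>

lemma isotropic_subgroup:
  assumes "fin_subgroup H" "H \<subseteq> V" "additive_on H \<psi>"
    and "125^(j+2) \<le> card H"
  shows "\<exists>W\<subseteq>H. fin_subgroup W \<and> 2^j \<le> card W \<and> (\<forall>u\<in>W. \<forall>w\<in>W. e u (\<psi> w) = 1)"
  using assms
proof (induction j arbitrary: H)
  case 0
  have "\<psi> 0 = \<psi> 0 + \<psi> 0" using additive_onD[OF 0(3), of 0 0] fin_subgroup_0[OF 0(1)] by simp
  hence "fin_subgroup {0}" "\<psi> 0 = 0" by (auto simp: fin_subgroup_def)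
  thus ?case using fin_subgroup_0[OF 0(1)] by (intro exI[of _ "{0}"]) auto
next
  case (Suc j)
  note \<psi> = Suc.prems(3) and sgH = Suc.prems(1)
  have big: "card H > 125^2"
  proof -
    have "(125::nat)^2 < 125^(Suc j + 2)" by (intro power_strict_increasing) auto
    thus ?thesis using Suc.prems(4) by linarith
  qed
  obtain v where v: "v \<in> H" "v \<noteq> 0" "e v (\<psi> v) = 1"
    using isotropic_vector[OF Suc.prems(1,2) \<psi> big] by (elim bexE conjE)
  obtain \<xi> H' where H': "H' \<subseteq> H" "fin_subgroup H'" "card H \<le> 125 * card H'" "e v \<xi> \<noteq> 1"
    "\<forall>u\<in>H'. e u (\<psi> v) = 1 \<and> e v (\<psi> u) = 1 \<and> e u \<xi> = 1"
    using perp_subgroup[OF Suc.prems(1,2) \<psi> v(1,2)] by (elim exE conjE)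
  have "125^(j+2) \<le> card H'" using H'(3) Suc.prems(4) by simp
  then obtain W where W: "W \<subseteq> H'" "fin_subgroup W" "2^j \<le> card W" "\<And>u w. u \<in> W \<Longrightarrow> w \<in> W \<Longrightarrow> e u (\<psi> w) = 1"
  proof -
    have "H' \<subseteq> V" "additive_on H' \<psi>"
      using H'(1) Suc.prems(2) additive_on_subset[OF \<psi>] by blast+
    from Suc.IH[OF H'(2) this \<open>125^(j+2) \<le> card H'\<close>] show ?thesis using that by (elim exE conjE) simp
  qed
  define W' where "W' = {w + of_nat i * v |w i. w \<in> W}"
  have iv: "of_nat i * v \<in> H" for i
    by (induction i) (use v fin_subgroup_0[OF Suc.prems(1)] fin_subgroup_add[OF Suc.prems(1)] in \<open>auto simp: algebra_simps\<close>)
  have WH: "W \<subseteq> H" using W(1) H'(1) by blast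
  have W'H: "W' \<subseteq> H" using WH iv fin_subgroup_add[OF Suc.prems(1)] unfolding W'_def by blast
  have fin: "finite W'" using W'H fin_subgroup_finite[OF Suc.prems(1)] finite_subset by blast
  have WW': "W \<subseteq> W'" 
  proof
    fix w assume "w \<in> W"
    hence "w + of_nat 0 * v \<in> W'" unfolding W'_def by blast
    thus "w \<in> W'" by simp
  qed
  have vW: "(\<lambda>w. w + v) ` W \<subseteq> W'"
  proof clarify
    fix w assume "w \<in> W"
    hence "w + of_nat 1 * v \<in> W'" unfolding W'_def by blast
    thus "w + v \<in> W'" by simp
  qed
  have sgW': "fin_subgroup W'"
    unfolding fin_subgroup_def
  proof (intro conjI ballI)
    show "finite W'" by (rule fin)
    show "0 \<in> W'" using WW' fin_subgroup_0[OF W(2)] by blast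
  next
    fix x y assume "x \<in> W'" "y \<in> W'"
    then obtain w i w' i' where "x = w + of_nat i * v" "y = w' + of_nat i' * v" "w \<in> W" "w' \<in> W"
      unfolding W'_def by blast
    hence "x + y = (w + w') + of_nat (i + i') * v" "w + w' \<in> W" using fin_subgroup_add[OF W(2)] by (auto simp: algebra_simps)
    thus "x + y \<in> W'" unfolding W'_def by blast
  next
    fix x assume "x \<in> W'"
    then obtain w i where x: "x = w + of_nat i * v" "w \<in> W" unfolding W'_def by blast
    \<comment> \<open>Natural multiples of v are closed under negation because 4 = -1 here.\<close>
    have "- x = - w + of_nat (4 * i) * v" using x four by simp
    thus "- x \<in> W'" unfolding W'_def using fin_subgroup_minus[OF W(2) x(2)] by blast
  qed
  have card2: "2 ^ Suc j \<le> card W'"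
  proof -
    \<comment> \<open>The character \<xi> is trivial on \<open>W\<close> and nontrivial at v, so it
      separates \<open>W\<close> from its translate.\<close>
    have "W \<inter> (\<lambda>w. w + v) ` W = {}"
    proof (rule ccontr)
      assume "\<not> ?thesis"
      then obtain w where "w \<in> W" "w + v \<in> W" by blast
      hence "e w \<xi> = 1" "e (w + v) \<xi> = 1" using H'(5) W(1) by blast+
      thus False using H'(4) by (simp add: e_add)
    qed
    hence "card (W \<union> (\<lambda>w. w + v) ` W) = card W + card W"
      using fin_subgroup_finite[OF W(2)] by (subst card_Un_disjoint) (auto simp: card_image)
    moreover have "card (W \<union> (\<lambda>w. w + v) ` W) \<le> card W'" using WW' vW fin by (intro card_mono) auto
    ultimately show ?thesis using W(3) by simp
  qed
  have \<psi>i: "e x (\<psi> (w + of_nat i * v)) = e x (\<psi> w) * e x (\<psi> v) ^ i" if "w \<in> H" for x w i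
  proof (induction i)
    case (Suc i)
    have "\<psi> (w + of_nat (Suc i) * v) = \<psi> ((w + of_nat i * v) + v)" by (simp add: algebra_simps)
    also have "\<dots> = \<psi> (w + of_nat i * v) + \<psi> v"
      using that iv v fin_subgroup_add[OF sgH] by (intro additive_onD[OF \<psi>]) auto
    finally show ?case using Suc by (simp add: e_add' mult_ac)
  qed auto
  have "e u (\<psi> x) = 1" if ux: "u \<in> W'" "x \<in> W'" for u x
  proof -
    obtain w i w' i' where "u = w + of_nat i * v" "x = w' + of_nat i' * v" "w \<in> W" "w' \<in> W"
      using ux unfolding W'_def by blast
    moreover hence "w \<in> H'" "w' \<in> H'" "w' \<in> H" using W(1) WH by auto
    ultimately show ?thesis using H'(5) v(3) W(4) by (simp add: \<psi>i e_add e_of_nat)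
  qed
  thus ?case using sgW' card2 W'H by blast
qed

section \<open>From large derivatives to increased density on a coset\<close>

text \<open>A character is constant on cosets of its kernel, so correlation with it means that the
  sums of f over these cosets are large in absolute value on average. As f has mean zero, large
  absolute values force some large positive value.\<close>

lemma increment_of_correlation:
  fixes f c :: "'a \<Rightarrow> real" and \<kappa> :: real
  assumes W: "fin_subgroup W" "W \<subseteq> V" and f0: "(\<Sum>x\<in>V. f x) = 0" and \<kappa>: "\<kappa> > 0"
    and cs: "\<And>s. s \<in> V \<Longrightarrow> \<exists>\<xi>. norm (\<Sum>u\<in>W. complex_of_real (f (s + u)) * e u \<xi>) \<ge> c s * card W"
    and csum: "(\<Sum>s\<in>V. c s) \<ge> 3 * \<kappa> * N"
  shows "\<exists>s\<in>V. \<exists>\<xi>. (\<Sum>u\<in>{u\<in>W. e u \<xi> = 1}. f (s + u)) \<ge> \<kappa> * card {u\<in>W. e u \<xi> = 1}"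
proof (rule ccontr)
  assume n: "\<not> ?thesis"
  have "c s * card W \<le> 2 * \<kappa> * card W - (\<Sum>t\<in>W. f (s + t))" if s: "s \<in> V" for s
  proof -
    obtain \<xi> where \<xi>: "norm (\<Sum>u\<in>W. complex_of_real (f (s + u)) * e u \<xi>) \<ge> c s * card W" using cs[OF s] by blast
    define K where "K = {u\<in>W. e u \<xi> = 1}"
    have K: "fin_subgroup K" unfolding K_def by (rule card_ker_ge[OF W(1)])
    have KW: "K \<subseteq> W" by (auto simp: K_def)
    define I where "I t = (\<Sum>u\<in>K. f ((s + t) + u))" for t
    \<comment> \<open>If every coset sum stays below \<kappa> times the size of the coset, its
      absolute value is bounded by an expression linear in it. The linear term averages to zero over
      all s, leaving 2 \<kappa> N against the assumed 3 \<kappa> N.\<close>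
    have I: "\<bar>I t\<bar> \<le> 2 * \<kappa> * card K - I t" if "t \<in> W" for t
    proof -
      have "s + t \<in> V" using s that W V_closed by blast
      hence "I t < \<kappa> * card K" using n unfolding I_def K_def by (auto simp: not_le)
      moreover have "\<kappa> * card K \<ge> 0" using \<kappa> by simp
      ultimately show ?thesis by (simp add: abs_if)
    qed
    have "card K * (\<Sum>u\<in>W. complex_of_real (f (s + u)) * e u \<xi>) = 
      (\<Sum>u\<in>K. \<Sum>t\<in>W. complex_of_real (f (s + t)) * e t \<xi>)" by simp
    also have "\<dots> = (\<Sum>u\<in>K. \<Sum>t\<in>W. complex_of_real (f (s + (t + u))) * e (t + u) \<xi>)"
    proof (rule sum.cong[OF refl])
      fix u assume "u \<in> K"
      hence "u \<in> W" using KW by auto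
      from sum_shift[OF W(1) this, of "\<lambda>t. complex_of_real (f (s + t)) * e t \<xi>"]
      show "(\<Sum>t\<in>W. complex_of_real (f (s + t)) * e t \<xi>) = (\<Sum>t\<in>W. complex_of_real (f (s + (t + u))) * e (t + u) \<xi>)" ..
    qed
    also have "\<dots> = (\<Sum>t\<in>W. \<Sum>u\<in>K. complex_of_real (f (s + (t + u))) * e (t + u) \<xi>)" by (rule sum.swap)
    also have "\<dots> = (\<Sum>t\<in>W. e t \<xi> * complex_of_real (I t))"
      unfolding I_def of_real_sum sum_distrib_left
      by (intro sum.cong refl) (auto simp: K_def e_add add.assoc)
    finally have eq: "card K * (\<Sum>u\<in>W. complex_of_real (f (s + u)) * e u \<xi>) = (\<Sum>t\<in>W. e t \<xi> * complex_of_real (I t))" .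
    have "card K * (c s * card W) \<le> card K * norm (\<Sum>u\<in>W. complex_of_real (f (s + u)) * e u \<xi>)"
      using \<xi> by (intro mult_left_mono) auto
    also have "\<dots> = norm (card K * (\<Sum>u\<in>W. complex_of_real (f (s + u)) * e u \<xi>))" by (simp add: norm_mult)
    also have "\<dots> \<le> (\<Sum>t\<in>W. norm (e t \<xi> * complex_of_real (I t)))" unfolding eq by (rule norm_sum)
    also have "\<dots> \<le> (\<Sum>t\<in>W. 2 * \<kappa> * card K - I t)" using I by (intro sum_mono) (simp add: norm_mult)
    also have "\<dots> = card W * (2 * \<kappa> * card K) - (\<Sum>t\<in>W. I t)" by (simp add: sum_subtractf)
    also have "(\<Sum>t\<in>W. I t) = (\<Sum>u\<in>K. \<Sum>t\<in>W. f (s + (t + u)))"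
      unfolding I_def add.assoc by (rule sum.swap)
    also have "\<dots> = (\<Sum>u\<in>K. \<Sum>t\<in>W. f (s + t))"
    proof (rule sum.cong[OF refl])
      fix u assume "u \<in> K"
      hence "u \<in> W" using KW by auto
      from sum_shift[OF W(1) this, of "\<lambda>t. f (s + t)"]
      show "(\<Sum>t\<in>W. f (s + (t + u))) = (\<Sum>t\<in>W. f (s + t))" .
    qed
    finally have "card K * (c s * card W) \<le> card K * (2 * \<kappa> * card W - (\<Sum>t\<in>W. f (s + t)))"
      by (simp add: algebra_simps)
    thus ?thesis using fin_subgroup_card[OF K] by simp
  qed
  hence "(\<Sum>s\<in>V. c s * card W) \<le> (\<Sum>s\<in>V. 2 * \<kappa> * card W - (\<Sum>t\<in>W. f (s + t)))" by (intro sum_mono)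
  also have "\<dots> = N * (2 * \<kappa> * card W) - (\<Sum>s\<in>V. \<Sum>t\<in>W. f (s + t))" by (simp add: sum_subtractf)
  also have "(\<Sum>s\<in>V. \<Sum>t\<in>W. f (s + t)) = (\<Sum>t\<in>W. \<Sum>s\<in>V. f (s + t))" by (rule sum.swap)
  also have "\<dots> = (\<Sum>t\<in>W. 0)" using W sum_shift[OF subgroup_V, of _ f] f0 by (intro sum.cong refl) auto
  finally have "(\<Sum>s\<in>V. c s) * card W \<le> 2 * \<kappa> * N * card W" by (simp add: sum_distrib_right mult_ac)
  hence "(\<Sum>s\<in>V. c s) \<le> 2 * \<kappa> * N" using fin_subgroup_card[OF W(1)] by simp
  moreover have "\<kappa> * N > 0" using \<kappa> N_pos by simp
  ultimately show False using csum by linarith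
qed

text \<open>Write x = s + u with u in \<open>W\<close>. Isotropy removes \<psi> w from the phase in
  u, which becomes the fixed character b, so the inner sum is a correlation at w of two functions
  living on \<open>W\<close>. By \<open>corr_bound\<close>, its average over w is controlled by a
  single Fourier coefficient of the first function.\<close>

lemma coset_correlation:
  fixes f :: "'a \<Rightarrow> real" and \<eta> :: real
  assumes bd: "\<And>x. \<bar>f x\<bar> \<le> 1" and W: "fin_subgroup W" "W \<subseteq> V" and h0: "h0 \<in> V" and \<eta>: "\<eta> \<ge> 0"
    and iso: "\<And>u w. u \<in> W \<Longrightarrow> w \<in> W \<Longrightarrow> e u (\<psi> w) = 1"
    and W': "W' \<subseteq> W" and large: "\<And>w. w \<in> W' \<Longrightarrow> norm (fourier (\<lambda>x. complex_of_real (\<Delta> f (h0 + w) x)) (b + \<psi> w)) \<ge> \<eta> * N"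
  shows "\<exists>c :: 'a \<Rightarrow> real. (\<Sum>s\<in>V. c s) * card W \<ge> \<eta> * card W' * N \<and> 
    (\<forall>s\<in>V. \<exists>\<xi>. norm (\<Sum>u\<in>W. complex_of_real (f (s + u)) * e u \<xi>) \<ge> c s * card W)"
proof -
  define f1 where "f1 s u = of_bool (u \<in> W) * complex_of_real (f (s + u)) * e u b" for s u
  define f2 where "f2 s u = of_bool (u \<in> W) * complex_of_real (f (s + h0 + u))" for s u
  define M where "M s = Max ((\<lambda>\<xi>. norm (fourier (f1 s) \<xi>)) ` V)" for s
  have finW: "finite W" using fin_subgroup_finite[OF W(1)] .
  have VW: "V \<inter> W = W" using W(2) by auto
  have W0: "real (card W) > 0" using fin_subgroup_card[OF W(1)] by simp
  have M: "norm (fourier (f1 s) \<xi>) \<le> M s" if "\<xi> \<in> V" for s \<xi>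
    unfolding M_def using that by (intro Max_ge) auto
  have M0: "M s \<ge> 0" for s using M[of 0 s] norm_ge_zero[of "fourier (f1 s) 0"] by (simp del: norm_ge_zero)
  have Mex: "\<exists>\<xi>. norm (\<Sum>u\<in>W. complex_of_real (f (s + u)) * e u \<xi>) = M s" for s
  proof -
    have "M s \<in> (\<lambda>\<xi>. norm (fourier (f1 s) \<xi>)) ` V" unfolding M_def by (intro Max_in) auto
    then obtain \<xi> where \<xi>: "M s = norm (fourier (f1 s) \<xi>)" by blast
    have "fourier (f1 s) \<xi> = (\<Sum>u\<in>W. complex_of_real (f (s + u)) * e u (b + \<xi>))"
      unfolding fourier_def using W(2) by (intro sum.mono_neutral_cong_right) (auto simp: f1_def e_add')
    thus ?thesis using \<xi> by auto
  qed
  have key: "\<eta> * N * card W \<le> (\<Sum>s\<in>V. norm (\<Sum>u\<in>V. f1 s u * f2 s (u + w)))" if w: "w \<in> W'" for w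
  proof -
    let ?g = "\<lambda>x. complex_of_real (\<Delta> f (h0 + w) x) * e x (b + \<psi> w)"
    have wW: "w \<in> W" using w W' by auto
    \<comment> \<open>Averaging over translations by \<open>W\<close> replaces a choice of coset
      representatives.\<close>
    have "card W * (\<Sum>x\<in>V. ?g x) = (\<Sum>u\<in>W. \<Sum>s\<in>V. ?g (s + u))"
    proof -
      have "(\<Sum>s\<in>V. ?g (s + u)) = (\<Sum>x\<in>V. ?g x)" if "u \<in> W" for u
        using that W(2) by (intro sum_shift[OF subgroup_V]) auto
      thus ?thesis by simp
    qed
    also have "\<dots> = (\<Sum>s\<in>V. \<Sum>u\<in>W. ?g (s + u))" by (rule sum.swap)
    also have "\<dots> = (\<Sum>s\<in>V. e s (b + \<psi> w) * (\<Sum>u\<in>V. f1 s u * f2 s (u + w)))"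
    proof (rule sum.cong[OF refl])
      fix s
      have mem: "u + w \<in> W" if "u \<in> W" for u using fin_subgroup_add[OF W(1)] that wW by blast
      have "(\<Sum>u\<in>V. f1 s u * f2 s (u + w)) = (\<Sum>u\<in>W. complex_of_real (f (s + u)) * e u b * complex_of_real (f (s + h0 + (u + w))))"
        using W(2) mem by (intro sum.mono_neutral_cong_right) (auto simp: f1_def f2_def)
      thus "(\<Sum>u\<in>W. ?g (s + u)) = e s (b + \<psi> w) * (\<Sum>u\<in>V. f1 s u * f2 s (u + w))"
        using iso[OF _ wW] by (simp add: sum_distrib_left \<Delta>_def e_add e_add' algebra_simps)
    qed
    finally have eq: "card W * fourier (\<lambda>x. complex_of_real (\<Delta> f (h0 + w) x)) (b + \<psi> w) = 
       (\<Sum>s\<in>V. e s (b + \<psi> w) * (\<Sum>u\<in>V. f1 s u * f2 s (u + w)))" by (simp add: fourier_def)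
    have "\<eta> * N * card W \<le> norm (fourier (\<lambda>x. complex_of_real (\<Delta> f (h0 + w) x)) (b + \<psi> w)) * card W"
      using large[OF w] by (intro mult_right_mono) auto
    also have "\<dots> = norm (card W * fourier (\<lambda>x. complex_of_real (\<Delta> f (h0 + w) x)) (b + \<psi> w))"
      by (simp add: norm_mult)
    also have "\<dots> \<le> (\<Sum>s\<in>V. norm (e s (b + \<psi> w) * (\<Sum>u\<in>V. f1 s u * f2 s (u + w))))"
      unfolding eq by (rule norm_sum)
    finally show ?thesis by (simp add: norm_mult)
  qed
  have bound: "(\<Sum>w\<in>W. norm (\<Sum>u\<in>V. f1 s u * f2 s (u + w))) \<le> M s * card W" for s
  proof (rule power2_le_imp_le)
    have "(\<Sum>w\<in>W. norm (\<Sum>u\<in>V. f1 s u * f2 s (u + w)))^2 \<le> (\<Sum>w\<in>W. norm (\<Sum>u\<in>V. f1 s u * f2 s (u + w))^2) * card W"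
      by (rule sum_squared_le_sum_of_squares)
    also have "\<dots> \<le> (\<Sum>w\<in>V. norm (\<Sum>u\<in>V. f1 s u * f2 s (u + w))^2) * card W"
      using W(2) by (intro mult_right_mono sum_mono2) auto
    also have "\<dots> \<le> (M s)^2 * (\<Sum>x\<in>V. norm (f2 s x)^2) * card W"
      using M by (intro mult_right_mono corr_bound) auto
    also have "\<dots> \<le> (M s)^2 * (\<Sum>x\<in>V. of_bool (x \<in> W)) * card W"
      using bd by (intro mult_right_mono mult_left_mono sum_mono) (auto simp: f2_def norm_mult abs_square_le_1)
    also have "\<dots> = (M s * card W)^2" by (simp add: VW power2_eq_square)
    finally show "(\<Sum>w\<in>W. norm (\<Sum>u\<in>V. f1 s u * f2 s (u + w)))^2 \<le> (M s * card W)^2" .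
    show "0 \<le> M s * card W" using M0 by simp
  qed
  have "\<eta> * N * card W * card W' = (\<Sum>w\<in>W'. \<eta> * N * card W)" by simp
  also have "\<dots> \<le> (\<Sum>w\<in>W'. \<Sum>s\<in>V. norm (\<Sum>u\<in>V. f1 s u * f2 s (u + w)))" using key by (intro sum_mono)
  also have "\<dots> \<le> (\<Sum>w\<in>W. \<Sum>s\<in>V. norm (\<Sum>u\<in>V. f1 s u * f2 s (u + w)))"
    using W' finW by (intro sum_mono2) (auto intro: sum_nonneg)
  also have "\<dots> = (\<Sum>s\<in>V. \<Sum>w\<in>W. norm (\<Sum>u\<in>V. f1 s u * f2 s (u + w)))" by (rule sum.swap)
  also have "\<dots> \<le> (\<Sum>s\<in>V. M s * card W)" using bound by (intro sum_mono)
  also have "\<dots> = (\<Sum>s\<in>V. M s) * card W" by (simp add: sum_distrib_right)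
  finally have "\<eta> * card W' * N * card W \<le> (\<Sum>s\<in>V. M s) * card W" by (simp add: mult_ac)
  hence "\<eta> * card W' * N \<le> (\<Sum>s\<in>V. M s)" using W0 by simp
  also have "\<dots> = (\<Sum>s\<in>V. M s / card W) * card W" using W0 by (simp flip: sum_divide_distrib)
  finally have "\<eta> * card W' * N \<le> (\<Sum>s\<in>V. M s / card W) * card W" .
  moreover have "\<exists>\<xi>. norm (\<Sum>u\<in>W. complex_of_real (f (s + u)) * e u \<xi>) \<ge> M s / card W * card W" for s
  proof -
    obtain \<xi> where "norm (\<Sum>u\<in>W. complex_of_real (f (s + u)) * e u \<xi>) = M s" using Mex by blast
    thus ?thesis using W0 by (intro exI[of _ \<xi>]) simp
  qed
  ultimately show ?thesis by (intro exI[of _ "\<lambda>s. M s / card W"] conjI ballI)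
qed

end

section \<open>The density increment\<close>

context dual_group
begin

text \<open>Here \<sigma> bounds from below the density of the shifts with large derivatives and
  their normalised squared coefficients, \<beta> the proportion of these shifts surviving
  linearisation, and \<beta> \<sigma> the density of the survivors in \<open>V\<close>. The number d
  bounds the characters needed by Bogolyubov's argument, and j the steps of the greedy choice.
  Inequalities instead of exact values allow pure powers of \<delta>/2 to be inserted.\<close>

lemma density_increment:
  fixes \<delta> \<sigma> \<beta> \<kappa> :: real and d j :: nat
  assumes A: "A \<subseteq> V" "ap4_free A" and \<delta>: "card A = \<delta> * N" and big: "2 \<le> \<delta>^3 * N"
    and \<sigma>: "0 < \<sigma>" "\<sigma> \<le> (\<delta>^4/8)^8 / 2" "\<sigma> \<le> 1" and \<beta>: "0 < \<beta>" "\<beta> \<le> (\<sigma>^5)^721 / (12 * 2^1623)"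
    and \<kappa>: "0 < \<kappa>" "3 * \<kappa> \<le> \<sigma> * (\<beta> * \<sigma>)" and d: "4 / (\<beta> * \<sigma>)^2 \<le> real d"
    and j: "125^(j+2) * 5^d \<le> card V"
  shows "\<exists>s\<in>V. \<exists>W\<subseteq>V. fin_subgroup W \<and> 2^j \<le> 5 * card W \<and> card {u\<in>W. s + u \<in> A} \<ge> (\<delta> + \<kappa>) * card W"
proof -
  define f where "f x = of_bool (x \<in> A) - \<delta>" for x
  have \<delta>0: "\<delta> \<ge> 0"
  proof -
    have "0 \<le> \<delta> * N" using \<delta> by (metis of_nat_0_le_iff)
    thus ?thesis using N_pos by (metis mult_le_cancel_right_pos mult_zero_left)
  qed
  have "card A \<le> card V" using A by (intro card_mono) auto
  hence \<delta>1: "\<delta> \<le> 1" using \<delta> N_pos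
    by (metis mult_le_cancel_right_pos mult_1 of_nat_le_iff)
  have bd: "\<bar>f x\<bar> \<le> 1" for x using \<delta>0 \<delta>1 by (auto simp: f_def)
  have VA: "V \<inter> A = A" using A by auto
  have f0: "(\<Sum>x\<in>V. f x) = 0"
    using \<delta> by (simp add: f_def sum_subtractf VA)
  define \<sigma>' where "\<sigma>' = (\<delta>^4/8)^8 / 2"
  have \<sigma>\<sigma>': "\<sigma> \<le> \<sigma>'" using \<sigma> by (simp add: \<sigma>'_def)
  obtain S where S: "S \<subseteq> V" "card S \<ge> \<sigma>' * N"
    and S\<xi>: "\<forall>h\<in>S. \<exists>\<xi>\<in>V. norm (fourier (\<lambda>x. complex_of_real (\<Delta> f h x)) \<xi>)^2 \<ge> \<sigma>' * N^2"
    using ap4_free_large_derivatives[OF A \<delta> big] unfolding f_def[symmetric] \<sigma>'_def[symmetric] by (elim exE conjE)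
  have "\<sigma> * N \<le> \<sigma>' * N" using \<sigma>\<sigma>' by (intro mult_right_mono) auto
  hence cS: "card S \<ge> \<sigma> * N" using S(2) by linarith
  have "\<sigma> * N^2 \<le> \<sigma>' * N^2" using \<sigma>\<sigma>' by (intro mult_right_mono) auto
  hence "\<forall>h\<in>S. \<exists>\<xi>. \<xi> \<in> V \<and> norm (fourier (\<lambda>x. complex_of_real (\<Delta> f h x)) \<xi>)^2 \<ge> \<sigma> * N^2" 
    using S\<xi> by (meson order_trans)
  then obtain \<phi> where \<phi>: "\<forall>h\<in>S. \<phi> h \<in> V \<and> norm (fourier (\<lambda>x. complex_of_real (\<Delta> f h x)) (\<phi> h))^2 \<ge> \<sigma> * N^2"
    by (rule bchoice[elim_format]) (elim exE)
  have \<phi>V: "\<And>h. h \<in> S \<Longrightarrow> \<phi> h \<in> V" using \<phi> by blast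
  have "0 < \<sigma> * N" using \<sigma> N_pos by simp
  hence S0: "real (card S) > 0" using cS by linarith
  hence Sne: "S \<noteq> {}" by auto
  define \<Gamma> where "\<Gamma> = (\<lambda>h. (h, \<phi> h)) ` S"
  define E where "E = (\<Sum>p\<in>\<Gamma>\<times>\<Gamma>. rep \<Gamma> (fst p - snd p))"
  have "(card S * \<sigma>)^4 \<le> N * E"
    unfolding E_def \<Gamma>_def using \<phi> \<sigma>(1) by (intro additive_quadruples[where f=f, OF bd S(1)]) auto
  \<comment> \<open>One factor \<open>card S\<close> is traded for \<sigma> N, which yields the
    energy parameter \<sigma>^5.\<close>
  moreover have "N * (\<sigma>^5 * card S^3) \<le> (card S * \<sigma>)^4"
  proof -
    have "N * (\<sigma>^5 * card S^3) = (\<sigma> * N) * (\<sigma>^4 * card S^3)" by (simp add: eval_nat_numeral mult_ac)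
    also have "\<dots> \<le> card S * (\<sigma>^4 * card S^3)" using cS \<sigma>(1) by (intro mult_right_mono) auto
    also have "\<dots> = (card S * \<sigma>)^4" by (simp add: eval_nat_numeral mult_ac)
    finally show ?thesis .
  qed
  ultimately have "N * (\<sigma>^5 * card S^3) \<le> N * E" by linarith
  hence energy: "\<sigma>^5 * card S^3 \<le> E" by (rule mult_left_le_imp_le) (rule N_pos)
  have \<sigma>5: "0 < \<sigma>^5" "\<sigma>^5 \<le> 1" using \<sigma> by (auto intro: power_le_one)
  obtain S' where S': "S' \<subseteq> S" "card S' \<ge> (\<sigma>^5)^721 / (12 * 2^1623) * card S"
    and fr: "\<forall>z\<in>ksum 6 {(a - b, \<phi> a - \<phi> b) |a b. a \<in> S' \<and> b \<in> S'}. fst z = 0 \<longrightarrow> snd z = 0"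
  proof -
    have "\<exists>S'\<subseteq>S. card S' \<ge> (\<sigma>^5)^721 / (12 * 2^1623) * card S \<and>
      (\<forall>z\<in>ksum 6 {(a - b, \<phi> a - \<phi> b) |a b. a \<in> S' \<and> b \<in> S'}. fst z = 0 \<longrightarrow> snd z = 0)"
      by (rule freiman_model[OF S(1) Sne _ \<sigma>5 energy[unfolded E_def \<Gamma>_def]]) (rule \<phi>V)
    thus ?thesis using that by (elim exE conjE)
  qed
  define \<alpha> where "\<alpha> = \<beta> * \<sigma>"
  have \<alpha>0: "\<alpha> > 0" using \<beta> \<sigma> by (simp add: \<alpha>_def)
  have cS': "\<alpha> * N \<le> card S'"
  proof -
    have "\<alpha> * N = \<beta> * (\<sigma> * N)" by (simp add: \<alpha>_def)
    also have "\<dots> \<le> \<beta> * card S" using cS \<beta> by (intro mult_left_mono) auto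
    also have "\<dots> \<le> (\<sigma>^5)^721 / (12 * 2^1623) * card S" using \<beta>(2) by (rule mult_right_mono) simp
    finally show ?thesis using S'(2) by linarith
  qed
  have "0 < \<alpha> * N" using \<alpha>0 N_pos by simp
  hence S'0: "real (card S') > 0" using cS' by linarith
  hence S'ne: "S' \<noteq> {}" by auto
  have S'V: "S' \<subseteq> V" using S'(1) S(1) by auto
  obtain X where X: "finite X" "card X \<le> 4 * (N / card S')^2"
    and bog: "\<forall>v\<in>V. (\<forall>\<xi>\<in>X. e v \<xi> = 1) \<longrightarrow> (\<exists>a\<in>S'. \<exists>b\<in>S'. \<exists>c\<in>S'. \<exists>d\<in>S'. v = (a - b) + (c - d))"
    using bogolyubov[OF S'V S'ne] by (elim exE conjE)
  have "N / card S' \<le> 1 / \<alpha>" using cS' S'0 \<alpha>0 by (simp add: field_simps)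
  hence "(N / card S')^2 \<le> (1 / \<alpha>)^2" by (intro power_mono) auto
  hence "real (card X) \<le> real d" using X(2) d by (simp add: \<alpha>_def power_divide)
  hence Xd: "card X \<le> d" by simp
  define H where "H = {v\<in>V. \<forall>\<xi>\<in>X. e v \<xi> = 1}"
  have H: "fin_subgroup H" "card V \<le> 5 ^ card X * card H"
    using card_annihilator_ge[OF X(1) subgroup_V] by (auto simp: H_def)
  have HV: "H \<subseteq> V" by (auto simp: H_def)
  have H4: "\<And>v. v \<in> H \<Longrightarrow> \<exists>a\<in>S'. \<exists>b\<in>S'. \<exists>c\<in>S'. \<exists>d\<in>S'. v = (a - b) + (c - d)"
    using bog by (simp add: H_def)
  have cH: "125^(j+2) \<le> card H"
  proof -
    have "125^(j+2) * 5^d \<le> 5 ^ card X * card H" using j H(2) by linarith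
    also have "\<dots> \<le> 5 ^ d * card H" using Xd by (intro mult_right_mono power_increasing) auto
    finally show ?thesis by simp
  qed
  obtain \<psi> where \<psi>: "additive_on H \<psi>"
    and \<psi>\<phi>: "\<forall>a\<in>S'. \<forall>b\<in>S'. a - b \<in> H \<longrightarrow> \<phi> a = \<phi> b + \<psi> (a - b)"
  proof -
    have "\<exists>\<psi>. additive_on H \<psi> \<and>
      (\<forall>a\<in>S'. \<forall>b\<in>S'. a - b \<in> H \<longrightarrow> \<phi> a = \<phi> b + \<psi> (a - b))"
    proof (rule freiman_linear[OF S'ne _ H(1)])
      show "snd z = 0" if "z \<in> ksum 6 {(a - b, \<phi> a - \<phi> b) |a b. a \<in> S' \<and> b \<in> S'}" "fst z = 0" for z
        using fr that by (rule_tac bspec[elim_format]) auto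
      show "\<exists>a\<in>S'. \<exists>b\<in>S'. \<exists>c\<in>S'. \<exists>d\<in>S'. v = (a - b) + (c - d)" if "v \<in> H" for v
        using H4[OF that] .
    qed
    thus ?thesis using that by (elim exE conjE)
  qed
  from isotropic_subgroup[OF H(1) HV \<psi> cH]
  obtain W where W: "W \<subseteq> H" "fin_subgroup W" "2^j \<le> card W" and iso: "\<forall>u\<in>W. \<forall>w\<in>W. e u (\<psi> w) = 1"
    by (elim exE conjE)
  have WV: "W \<subseteq> V" using W(1) HV by auto
  have finW: "finite W" using fin_subgroup_finite[OF W(2)] .
  have W0: "real (card W) > 0" using fin_subgroup_card[OF W(2)] by simp
  \<comment> \<open>On average over s, the coset of \<open>W\<close> through s meets
    \<open>S'\<close> with the density of \<open>S'\<close> in \<open>V\<close>.\<close>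
  have "\<exists>s\<in>V. \<alpha> * card W \<le> card {w\<in>W. s + w \<in> S'}"
  proof (rule ccontr)
    assume "\<not> ?thesis"
    hence "(\<Sum>s\<in>V. real (card {w\<in>W. s + w \<in> S'})) < (\<Sum>s\<in>V. \<alpha> * card W)"
      by (intro sum_strict_mono) (auto simp: not_le)
    also have "\<dots> \<le> card S' * card W" using mult_right_mono[OF cS', of "card W"] by (simp add: mult_ac)
    also have "(\<Sum>s\<in>V. real (card {w\<in>W. s + w \<in> S'})) = (\<Sum>s\<in>V. \<Sum>w\<in>W. of_bool (s + w \<in> S'))"
      unfolding card_sum_of_bool[OF finW] ..
    also have "\<dots> = (\<Sum>w\<in>W. \<Sum>s\<in>V. of_bool (s + w \<in> S'))" by (rule sum.swap)
    also have "\<dots> = (\<Sum>w\<in>W. \<Sum>s\<in>V. of_bool (s \<in> S'))"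
    proof (rule sum.cong[OF refl])
      fix w assume "w \<in> W"
      hence "w \<in> V" using WV by auto
      thus "(\<Sum>s\<in>V. of_bool (s + w \<in> S')) = (\<Sum>s\<in>V. of_bool (s \<in> S') :: real)"
        by (rule sum_shift[OF subgroup_V])
    qed
    also have "V \<inter> S' = S'" using S'V by auto
    hence "(\<Sum>w\<in>W. \<Sum>s\<in>V. of_bool (s \<in> S')) = real (card S' * card W)" by simp
    finally show False by simp
  qed
  then obtain s where s: "s \<in> V" "\<alpha> * card W \<le> card {w\<in>W. s + w \<in> S'}" by (elim bexE)
  have "0 < \<alpha> * card W" using \<alpha>0 W0 by simp
  hence "real (card {w\<in>W. s + w \<in> S'}) > 0" using s(2) by linarith
  hence "{w\<in>W. s + w \<in> S'} \<noteq> {}" by (intro notI) simp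
  then obtain w0 where w0: "w0 \<in> W" "s + w0 \<in> S'" by blast
  \<comment> \<open>The base point is moved into \<open>S'\<close>, since \<phi> is known to be
    affine only relative to a point of \<open>S'\<close>.\<close>
  define h0 where "h0 = s + w0"
  define W' where "W' = {w\<in>W. h0 + w \<in> S'}"
  have h0V: "h0 \<in> V" using w0 S'V by (auto simp: h0_def)
  have cW': "\<alpha> * card W \<le> card W'"
  proof -
    have "real (card W') = (\<Sum>w\<in>W. of_bool (s + (w0 + w) \<in> S'))"
      unfolding W'_def card_sum_of_bool[OF finW] by (simp only: h0_def add.assoc)
    also have "\<dots> = (\<Sum>w\<in>W. of_bool (s + w \<in> S'))"
      by (rule sum_shift'[OF W(2) w0(1), where f="\<lambda>w. of_bool (s + w \<in> S')"])
    also have "\<dots> = real (card {w\<in>W. s + w \<in> S'})" unfolding card_sum_of_bool[OF finW] ..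
    finally show ?thesis using s(2) by simp
  qed
  have large: "norm (fourier (\<lambda>x. complex_of_real (\<Delta> f (h0 + w) x)) (\<phi> h0 + \<psi> w)) \<ge> \<sigma> * N" if w: "w \<in> W'" for w
  proof -
    have hw: "h0 + w \<in> S'" "w \<in> H" using w W(1) by (auto simp: W'_def)
    have h0S: "h0 \<in> S'" using w0 by (simp add: h0_def)
    have "(h0 + w) - h0 = w" by simp
    hence eq: "\<phi> (h0 + w) = \<phi> h0 + \<psi> w" using bspec[OF bspec[OF \<psi>\<phi> hw(1)] h0S] hw(2) by simp
    have "h0 + w \<in> S" using hw S'(1) by auto
    hence "\<sigma> * N^2 \<le> norm (fourier (\<lambda>x. complex_of_real (\<Delta> f (h0 + w) x)) (\<phi> h0 + \<psi> w))^2"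
      using \<phi> unfolding eq[symmetric] by blast
    \<comment> \<open>As \<sigma> \<le> 1, this avoids a square root of \<sigma>.\<close>
    moreover have "(\<sigma> * N)^2 \<le> \<sigma> * N^2"
      unfolding power_mult_distrib using \<sigma> by (intro mult_right_mono) (auto simp: power2_eq_square mult_le_one)
    ultimately have "(\<sigma> * N)^2 \<le> norm (fourier (\<lambda>x. complex_of_real (\<Delta> f (h0 + w) x)) (\<phi> h0 + \<psi> w))^2" by linarith
    thus ?thesis by (rule power2_le_imp_le) simp
  qed
  have "\<exists>c :: 'a \<Rightarrow> real. (\<Sum>s\<in>V. c s) * card W \<ge> \<sigma> * card W' * N \<and> 
    (\<forall>s\<in>V. \<exists>\<xi>. norm (\<Sum>u\<in>W. complex_of_real (f (s + u)) * e u \<xi>) \<ge> c s * card W)"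
    by (rule coset_correlation[where f=f, OF bd W(2) WV h0V _ _ _ large]) (use \<sigma> iso in \<open>auto simp: W'_def\<close>)
  then obtain c :: "'a \<Rightarrow> real" where c: "(\<Sum>s\<in>V. c s) * card W \<ge> \<sigma> * card W' * N"
    "\<forall>s\<in>V. \<exists>\<xi>. norm (\<Sum>u\<in>W. complex_of_real (f (s + u)) * e u \<xi>) \<ge> c s * card W"
    by (elim exE conjE)
  have "3 * \<kappa> * N * card W \<le> (\<Sum>s\<in>V. c s) * card W"
  proof -
    have "3 * \<kappa> * N * card W \<le> \<sigma> * \<alpha> * N * card W" using \<kappa>(2) by (intro mult_right_mono) (auto simp: \<alpha>_def)
    also have "\<dots> = \<sigma> * (\<alpha> * card W) * N" by simp
    also have "\<dots> \<le> \<sigma> * card W' * N" using cW' \<sigma> by (intro mult_right_mono mult_left_mono) auto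
    finally show ?thesis using c(1) by linarith
  qed
  hence csum: "3 * \<kappa> * N \<le> (\<Sum>s\<in>V. c s)" using W0 by simp
  have "\<exists>s\<in>V. \<exists>\<xi>. (\<Sum>u\<in>{u\<in>W. e u \<xi> = 1}. f (s + u)) \<ge> \<kappa> * card {u\<in>W. e u \<xi> = 1}"
    by (rule increment_of_correlation[OF W(2) WV f0 \<kappa>(1) _ csum]) (use c(2) in blast)
  then obtain t \<xi> where t: "t \<in> V" "(\<Sum>u\<in>{u\<in>W. e u \<xi> = 1}. f (t + u)) \<ge> \<kappa> * card {u\<in>W. e u \<xi> = 1}"
    by (elim bexE exE)
  define K where "K = {u\<in>W. e u \<xi> = 1}"
  have K: "fin_subgroup K" "card W \<le> 5 * card K" unfolding K_def by (rule card_ker_ge[OF W(2)])+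
  have "K \<subseteq> V" using WV by (auto simp: K_def)
  moreover have "2^j \<le> 5 * card K" using W(3) K(2) by linarith
  moreover have "card {u\<in>K. t + u \<in> A} \<ge> (\<delta> + \<kappa>) * card K"
  proof -
    have "(\<Sum>u\<in>K. f (t + u)) = (\<Sum>u\<in>K. of_bool (t + u \<in> A)) - \<delta> * card K"
      by (simp add: f_def sum_subtractf)
    also have "\<dots> = card {u\<in>K. t + u \<in> A} - \<delta> * card K"
      unfolding card_sum_of_bool[OF fin_subgroup_finite[OF K(1)]] ..
    finally show ?thesis using t(2) by (simp add: K_def algebra_simps)
  qed
  ultimately show ?thesis using t(1) K(1) by (intro bexI[of _ t] exI[of _ K] conjI)
qed

end

section \<open>The vector space over the field with five elements\<close>

type_synonym F5 = "5"

text \<open>A nontrivial additive character of the field, read off from the representative between 0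
  and 4.\<close>

definition root5 :: "F5 \<Rightarrow> complex" where
  "root5 x = cis (2 * pi / 5) ^ nat (Rep_bit1 x)"

lemma cis_pow5: "cis (2 * pi / 5) ^ 5 = 1"
  unfolding Complex.DeMoivre by simp

lemma F5_cases: obtains k where "x = (of_nat k :: F5)" "k < 5"
proof (cases x)
  case (of_int z)
  hence "x = of_nat (nat z)" "nat z < 5" by auto
  thus ?thesis using that by blast
qed

lemma root5_of_nat: "root5 (of_nat k) = cis (2 * pi / 5) ^ k"
proof -
  have "Rep_bit1 (of_nat k :: F5) = int k mod 5"
    using bit1.of_nat_eq[of k, where 'a="1 bit0"] bit1.Rep_Abs_mod[of "int k", where 'a="1 bit0"] by simp
  hence "root5 (of_nat k) = cis (2 * pi / 5) ^ (k mod 5)"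
    by (simp add: root5_def nat_mod_distrib)
  also have "\<dots> = cis (2 * pi / 5) ^ (k mod 5) * (cis (2 * pi / 5) ^ 5) ^ (k div 5)"
    by (simp add: cis_pow5)
  also have "\<dots> = cis (2 * pi / 5) ^ (k mod 5 + 5 * (k div 5))"
    by (simp only: power_add power_mult)
  finally show ?thesis by simp
qed

lemma root5_add: "root5 (x + y) = root5 x * root5 y"
proof -
  obtain j k where "x = of_nat j" "y = of_nat k" using F5_cases by metis
  thus ?thesis by (simp only: root5_of_nat of_nat_add[symmetric] power_add)
qed

lemma norm_root5: "norm (root5 x) = 1"
  by (simp add: root5_def norm_power)

lemma root5_neq_1: assumes "x \<noteq> 0" shows "root5 x \<noteq> 1"
proof
  assume r: "root5 x = 1"
  obtain k where k: "x = of_nat k" "k < 5" using F5_cases .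
  have "inj_on (\<lambda>k. cis (2 * pi * real k / real 5)) {..<5}"
    using bij_betw_imp_inj_on[OF Complex.bij_betw_roots_unity[of 5]] by simp
  moreover have "cis (2 * pi * real k / real 5) = cis (2 * pi * real 0 / real 5)"
    using r k by (simp add: root5_of_nat Complex.DeMoivre mult_ac)
  ultimately have "k = 0" using k(2) by (meson inj_onD lessThan_iff zero_less_numeral)
  thus False using k assms by simp
qed

lemma F5_inverse: "(x::F5) \<noteq> 0 \<Longrightarrow> \<exists>y. y * x = 1"
proof -
  assume x: "x \<noteq> 0"
  obtain k where k: "x = of_nat k" "k < 5" using F5_cases .
  hence "k = 1 \<or> k = 2 \<or> k = 3 \<or> k = 4" using x by (cases k) auto
  moreover have "(1::F5) * 1 = 1" "(3::F5) * 2 = 1" "(2::F5) * 3 = 1" "(4::F5) * 4 = 1" by simp_all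
  ultimately show ?thesis using k(1) by (metis of_nat_1 of_nat_numeral)
qed

text \<open>Vectors are padded with zeros, so that all dimensions share one type and the iteration
  can change n.\<close>

definition fvec :: "nat \<Rightarrow> (nat \<Rightarrow> F5) set" where "fvec n = {x. \<forall>i\<ge>n. x i = 0}"

definition pairing :: "nat \<Rightarrow> (nat \<Rightarrow> F5) \<Rightarrow> (nat \<Rightarrow> F5) \<Rightarrow> complex" where
  "pairing n x y = root5 (\<Sum>i<n. x i * y i)"

lemma fvec_0: "fvec 0 = {0}" by (auto simp: fvec_def)

lemma fvec_Suc: "fvec (Suc n) = (\<lambda>(x, c). x(n := c)) ` (fvec n \<times> UNIV)"
proof (intro equalityI subsetI)
  fix x assume "x \<in> fvec (Suc n)"
  hence "x(n := 0) \<in> fvec n" by (auto simp: fvec_def)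
  moreover have "x = (x(n := 0))(n := x n)" by simp
  ultimately show "x \<in> (\<lambda>(x, c). x(n := c)) ` (fvec n \<times> UNIV)"
    by (intro image_eqI[of _ _ "(x(n := 0), x n)"]) auto
qed (auto simp: fvec_def)

lemma fvec_finite_card: "finite (fvec n) \<and> card (fvec n) = 5 ^ n"
proof (induction n)
  case 0 thus ?case by (simp add: fvec_0)
next
  case (Suc n)
  have "inj_on (\<lambda>(x, c :: F5). x(n := c)) (fvec n \<times> UNIV)"
  proof (rule inj_onI, clarsimp)
    fix x c y d assume xy: "x \<in> fvec n" "y \<in> fvec n" "x(n := c) = y(n := d)"
    hence "c = d" by (metis fun_upd_same)
    moreover have "x = y"
    proof
      fix i show "x i = y i" using xy by (cases "i = n") (auto simp: fvec_def dest: fun_cong[of _ _ i])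
    qed
    ultimately show "x = y \<and> c = d" by simp
  qed
  thus ?case using Suc by (simp add: fvec_Suc card_image card_cartesian_product)
qed

lemma five_fun: "(5 :: nat \<Rightarrow> F5) = 0"
proof -
  have "(5 :: nat \<Rightarrow> F5) = 1 + 1 + 1 + 1 + 1" by simp
  also have "\<dots> = 0"
  proof
    fix i :: nat
    have "(1 + 1 + 1 + 1 + 1 :: nat \<Rightarrow> F5) i = 1 + 1 + 1 + 1 + 1" by (simp only: plus_fun_def one_fun_def)
    also have "\<dots> = 0" by simp
    finally show "(1 + 1 + 1 + 1 + 1 :: nat \<Rightarrow> F5) i = 0 i" by (simp add: zero_fun_def)
  qed
  finally show ?thesis .
qed

lemma fin_subgroup_fvec: "fin_subgroup (fvec n)"
  using fvec_finite_card[of n] by (auto simp: fin_subgroup_def fvec_def)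

interpretation fvec: dual_group "fvec n" "pairing n" for n
proof
  show "fin_subgroup (fvec n)" by (rule fin_subgroup_fvec)
  show "(5 :: nat \<Rightarrow> F5) = 0" by (rule five_fun)
  show add: "pairing n (x + y) z = pairing n x z * pairing n y z" for x y z
    unfolding pairing_def root5_add[symmetric] by (simp add: distrib_right sum.distrib)
  show "pairing n x y = pairing n y x" for x y by (simp add: pairing_def mult.commute)
  show "norm (pairing n x y) = 1" for x y by (simp add: pairing_def norm_root5)
  fix y assume y: "y \<in> fvec n" "y \<noteq> 0"
  then obtain j where j: "y j \<noteq> 0" by (auto simp: fun_eq_iff)
  hence jn: "j < n" using y(1) by (auto simp: fvec_def not_less[symmetric])
  \<comment> \<open>The unit vector at a nonzero coordinate of y: translation by it multiplies the
    character sum by a number other than 1.\<close>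
  define u :: "nat \<Rightarrow> F5" where "u = 0(j := 1)"
  have u: "u \<in> fvec n" using jn by (auto simp: u_def fvec_def)
  have "(\<Sum>i<n. u i * y i) = (\<Sum>i<n. if i = j then y j else 0)"
    by (intro sum.cong) (auto simp: u_def)
  hence "pairing n u y = root5 (y j)" using jn by (simp add: pairing_def)
  hence "pairing n u y \<noteq> 1" using root5_neq_1[OF j] by simp
  moreover have "(\<Sum>x\<in>fvec n. pairing n x y) = (\<Sum>x\<in>fvec n. pairing n x y) * pairing n u y"
    using sum_shift[OF fin_subgroup_fvec u, of "\<lambda>x. pairing n x y"] by (simp add: add sum_distrib_right)
  ultimately show "(\<Sum>x\<in>fvec n. pairing n x y) = 0" by (metis mult_cancel_left1)
qed

section \<open>Subgroups as coordinate spaces\<close>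

text \<open>Over a prime field scalars are repeated sums, so additive subgroups are
  subspaces.\<close>

lemma fin_subgroup_smult:
  assumes "fin_subgroup G" "x \<in> G" shows "(\<lambda>_. c) * x \<in> (G :: (nat \<Rightarrow> F5) set)"
proof -
  obtain k where k: "c = of_nat k" using F5_cases by metis
  have "(\<lambda>_. of_nat k) * x \<in> G"
  proof (induction k)
    case 0 thus ?case using fin_subgroup_0[OF assms(1)] by (simp add: times_fun_def zero_fun_def)
  next
    case (Suc k)
    have eq: "(\<lambda>_. of_nat (Suc k)) * x = x + (\<lambda>_. of_nat k) * x" by (simp add: fun_eq_iff distrib_right)
    show ?case unfolding eq by (rule fin_subgroup_add[OF assms Suc])
  qed
  thus ?thesis using k by simp
qed

text \<open>An injective additive map into \<open>H\<close> from a coordinate space of greatest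
  possible dimension is onto: a vector missed by it could serve as the image of one further
  coordinate.\<close>

lemma fvec_coordinates:
  assumes H: "fin_subgroup (H :: (nat \<Rightarrow> F5) set)"
  shows "\<exists>m L. (\<forall>x y. L (x + y) = L x + L y) \<and> inj_on L (fvec m) \<and> L ` fvec m = H"
proof -
  define P where "P m \<longleftrightarrow> (\<exists>L :: (nat \<Rightarrow> F5) \<Rightarrow> (nat \<Rightarrow> F5). (\<forall>x y. L (x + y) = L x + L y) \<and> inj_on L (fvec m) \<and> L ` fvec m \<subseteq> H)" for m
  have P0: "P 0" unfolding P_def using fin_subgroup_0[OF H] by (intro exI[of _ "\<lambda>_. 0"]) (auto simp: fvec_0)
  have bound: "m \<le> card H" if Pm: "P m" for m
  proof -
    obtain L :: "(nat \<Rightarrow> F5) \<Rightarrow> (nat \<Rightarrow> F5)" where "inj_on L (fvec m)" "L ` fvec m \<subseteq> H" using Pm unfolding P_def by (elim exE conjE)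
    hence "card (fvec m) \<le> card H" using fin_subgroup_finite[OF H] by (rule card_inj_on_le)
    hence "5 ^ m \<le> card H" by (simp add: fvec_finite_card)
    moreover have "m < 2 ^ m" by (rule less_exp)
    moreover have "(2::nat) ^ m \<le> 5 ^ m" by (rule power_mono) auto
    ultimately show ?thesis by linarith
  qed
  define m where "m = Greatest P"
  have m: "P m" "\<And>k. P k \<Longrightarrow> k \<le> m"
    unfolding m_def using GreatestI_nat[of P, OF P0 bound] Greatest_le_nat[of P _ "card H"] bound by blast+
  obtain L :: "(nat \<Rightarrow> F5) \<Rightarrow> (nat \<Rightarrow> F5)" where add: "\<forall>x y. L (x + y) = L x + L y" and inj: "inj_on L (fvec m)" and sub: "L ` fvec m \<subseteq> H"
    using m(1) unfolding P_def by (elim exE conjE)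
  have L0: "L 0 = 0" using add[rule_format, of 0 0] by simp
  have Lneg: "L (- x) = - L x" for x using add[rule_format, of x "- x"] L0 by (simp add: eq_neg_iff_add_eq_0 add.commute)
  have sgL: "fin_subgroup (L ` fvec m)"
    unfolding fin_subgroup_def
  proof (intro conjI ballI)
    show "finite (L ` fvec m)" using fvec_finite_card by simp
    show "0 \<in> L ` fvec m" using imageI[OF fin_subgroup_0[OF fin_subgroup_fvec], of L m] unfolding L0 .
  next
    fix a b assume "a \<in> L ` fvec m" "b \<in> L ` fvec m"
    then obtain x y where "a = L x" "b = L y" "x \<in> fvec m" "y \<in> fvec m" by blast
    hence "a + b = L (x + y)" "x + y \<in> fvec m" using add fin_subgroup_add[OF fin_subgroup_fvec] by simp_all
    thus "a + b \<in> L ` fvec m" by blast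
  next
    fix a assume "a \<in> L ` fvec m"
    then obtain x where "a = L x" "x \<in> fvec m" by blast
    hence "- a = L (- x)" "- x \<in> fvec m" using Lneg fin_subgroup_minus[OF fin_subgroup_fvec] by simp_all
    thus "- a \<in> L ` fvec m" by blast
  qed
  have "H \<subseteq> L ` fvec m"
  proof
    fix v assume v: "v \<in> H"
    show "v \<in> L ` fvec m"
    proof (rule ccontr)
      assume nv: "v \<notin> L ` fvec m"
      define L' where "L' t = L (t(m := 0)) + (\<lambda>_. t m) * v" for t
      have trunc: "t(m := 0) \<in> fvec m" if "t \<in> fvec (Suc m)" for t using that by (auto simp: fvec_def)
      have "L' (x + y) = L' x + L' y" for x y
      proof -
        have "(x + y)(m := 0) = x(m := 0) + y(m := 0)" by (auto simp: fun_eq_iff)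
        moreover have "(\<lambda>_. (x + y) m) * v = (\<lambda>_. x m) * v + (\<lambda>_. y m) * v" by (simp add: fun_eq_iff distrib_right)
        ultimately show ?thesis using add by (simp add: L'_def)
      qed
      moreover have "L' ` fvec (Suc m) \<subseteq> H"
      proof (rule image_subsetI)
        fix t assume "t \<in> fvec (Suc m)"
        hence "L (t(m := 0)) \<in> H" using sub trunc by blast
        thus "L' t \<in> H" unfolding L'_def using fin_subgroup_smult[OF H v] by (rule fin_subgroup_add[OF H])
      qed
      moreover have "inj_on L' (fvec (Suc m))"
      proof (rule inj_onI)
        fix x y assume xy: "x \<in> fvec (Suc m)" "y \<in> fvec (Suc m)" "L' x = L' y"
        have Lx: "L (x(m := 0)) \<in> L ` fvec m" "L (y(m := 0)) \<in> L ` fvec m" using trunc xy by auto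
        have diff: "(\<lambda>_. x m - y m) * v = L (y(m := 0)) - L (x(m := 0))"
          using xy(3) by (auto simp: L'_def fun_eq_iff algebra_simps)
        have "x m = y m"
        proof (rule ccontr)
          \<comment> \<open>Dividing the relation by the difference of the last coordinates would
            put v into the image of L.\<close>
          assume "x m \<noteq> y m"
          then obtain d where d: "d * (x m - y m) = 1" using F5_inverse[of "x m - y m"] by auto
          have "(\<lambda>_. d) * ((\<lambda>_. x m - y m) * v) = v"
          proof
            fix i
            have "d * ((x m - y m) * v i) = v i" using d by (metis mult.assoc mult_1)
            thus "((\<lambda>_. d) * ((\<lambda>_. x m - y m) * v)) i = v i" by simp
          qed
          moreover have "(\<lambda>_. x m - y m) * v \<in> L ` fvec m" unfolding diff using fin_subgroup_diff[OF sgL] Lx by blast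
          ultimately show False using fin_subgroup_smult[OF sgL, of _ d] nv by metis
        qed
        hence "L (x(m := 0)) = L (y(m := 0))" using xy(3) by (simp add: L'_def)
        hence "x(m := 0) = y(m := 0)" using inj trunc xy by (meson inj_onD)
        thus "x = y" using \<open>x m = y m\<close> by (metis fun_upd_triv fun_upd_upd)
      qed
      ultimately have "P (Suc m)" unfolding P_def by (intro exI[of _ L'] conjI allI)
      thus False using m(2) by fastforce
    qed
  qed
  thus ?thesis using add inj sub by (intro exI[of _ m] exI[of _ L]) auto
qed

text \<open>Progressions in the coordinates of \<open>W\<close> become progressions in the coset of
  s, so the increment on a coset is again an instance of the original problem.\<close>

lemma ap4_free_transfer:
  assumes W: "fin_subgroup W" "W \<subseteq> fvec n" and s: "s \<in> fvec n" and A: "fvec.ap4_free n A"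
  shows "\<exists>m A'. A' \<subseteq> fvec m \<and> fvec.ap4_free m A' \<and> card W = 5 ^ m \<and> card A' = card {u\<in>W. s + u \<in> A}"
proof -
  obtain m L where L: "\<forall>x y. L (x + y) = L x + L y" "inj_on L (fvec m)" "L ` fvec m = W"
    using fvec_coordinates[OF W(1)] by (elim exE conjE)
  define A' where "A' = {t\<in>fvec m. s + L t \<in> A}"
  have L0: "L 0 = 0" using L(1)[rule_format, of 0 0] by simp
  have "card A' = card (L ` A')"
    using L(2) by (intro card_image[symmetric]) (auto simp: A'_def inj_on_def)
  also have "L ` A' = {u\<in>W. s + u \<in> A}" using L(3) by (auto simp: A'_def)
  finally have c: "card A' = card {u\<in>W. s + u \<in> A}" .
  have "card W = 5 ^ m" using L(2,3) fvec_finite_card by (metis card_image)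
  moreover have "fvec.ap4_free m A'"
    unfolding fvec.ap4_free_def
  proof (intro ballI impI, elim conjE)
    fix x r assume xr: "x \<in> fvec m" "r \<in> fvec m" "x \<in> A'" "x + r \<in> A'" "x + 2 * r \<in> A'" "x + 3 * r \<in> A'"
    have L2: "L (x + 2 * r) = L x + 2 * L r" "L (x + 3 * r) = L x + 3 * L r"
    proof -
      have "x + 2 * r = x + (r + r)" "x + 3 * r = x + (r + (r + r))" by (simp_all add: algebra_simps)
      hence "L (x + 2 * r) = L x + (L r + L r)" "L (x + 3 * r) = L x + (L r + (L r + L r))" using L(1) by metis+
      thus "L (x + 2 * r) = L x + 2 * L r" "L (x + 3 * r) = L x + 3 * L r" by (simp_all add: algebra_simps)
    qed
    have "L r \<in> W" "L x \<in> W" using L(3) xr by auto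
    hence mem: "L r \<in> fvec n" "s + L x \<in> fvec n" using W(2) s fin_subgroup_add[OF fin_subgroup_fvec] by auto
    moreover have "s + L x \<in> A" "(s + L x) + L r \<in> A" "(s + L x) + 2 * L r \<in> A" "(s + L x) + 3 * L r \<in> A"
      using xr L(1) L2 by (auto simp: A'_def add.assoc)
    ultimately have "L r = 0" using A unfolding fvec.ap4_free_def by blast
    thus "r = 0" using L(2) L0 xr(2) fin_subgroup_0[OF fin_subgroup_fvec] by (metis inj_onD)
  qed
  ultimately show ?thesis using c by (intro exI[of _ m] exI[of _ A']) (auto simp: A'_def)
qed

section \<open>Iteration\<close>

text \<open>All parameters are powers of x = \<delta>/2, the constants being absorbed by x \<le>
  1/2. The exponents are 32 for \<sigma>, 32 * 5 * 721 + 1623 + 4 = 116987 for \<beta>, their sum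
  117019 for the density of the survivors, and 117019 + 32 + 2 = 117053 for the increment.\<close>

lemma ap4_free_density_step:
  fixes \<delta> :: real
  assumes A: "A \<subseteq> fvec n" "fvec.ap4_free n A" "A \<noteq> {}" and \<delta>: "card A = \<delta> * 5^n"
    and n: "(2 / \<delta>) ^ 234050 \<le> real n"
  shows "\<exists>m<n. n \<le> 36 * m \<and> (\<exists>B\<subseteq>fvec m. fvec.ap4_free m B \<and> card B \<ge> (\<delta> + (\<delta> / 2) ^ 117053) * 5^m)"
proof -
  define x where "x = \<delta> / 2"
  define y where "y = 1 / x"
  have cV: "card (fvec n) = 5 ^ n" "finite (fvec n)" using fvec_finite_card by auto
  have "card A > 0" using A cV by (simp add: card_gt_0_iff finite_subset)
  hence "\<delta> * 5^n > 0" using \<delta> by simp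
  hence \<delta>0: "\<delta> > 0" by (simp add: zero_less_mult_iff)
  have "card A \<le> 5^n" using A(1) cV by (metis card_mono)
  hence "real (card A) \<le> 5^n" by (simp only: of_nat_le_iff[symmetric, where 'a=real] of_nat_power of_nat_numeral)
  hence "\<delta> * 5^n \<le> 1 * 5^n" using \<delta> by simp
  hence \<delta>1: "\<delta> \<le> 1" by (rule mult_right_le_imp_le) simp
  have x: "0 < x" "x \<le> 1/2" "x \<le> 1" using \<delta>0 \<delta>1 by (auto simp: x_def)
  have y: "y \<ge> 2" using x by (simp add: y_def field_simps)
  have xy: "x^k * y^k = 1" for k using x by (simp add: y_def power_mult_distrib[symmetric])
  \<comment> \<open>The number of annihilating characters is governed by 4 / x^234038, and y^2
    absorbs the 4. The ten further powers of y in the hypothesis on n make n at least 1024 times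
    larger.\<close>
  define Y where "Y = y ^ 234040"
  have Y1: "Y \<ge> 1" unfolding Y_def using y by (intro one_le_power) simp
  have nY: "1024 * Y \<le> real n"
  proof -
    have "(2::real)^10 \<le> y^10" using y by (intro power_mono) auto
    hence "1024 \<le> y^10" by simp
    hence "1024 * Y \<le> y^10 * Y" using Y1 by (intro mult_right_mono) auto
    also have "\<dots> = y ^ 234050" unfolding Y_def by (simp flip: power_add)
    also have "y = 2 / \<delta>" by (simp add: y_def x_def)
    finally show ?thesis using n by simp
  qed
  define d where "d = nat \<lceil>Y\<rceil>"
  have d: "Y \<le> real d" "real d \<le> 2 * Y" using Y1 by (auto simp: d_def) linarith+
  have n1024: "real n \<ge> 1024" using nY Y1 by linarith
  have dn: "512 * d \<le> n" using nY d by linarith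
  \<comment> \<open>The largest j with 3 (j + 2) + d \<le> n, as 125 = 5^3; the subtractions do not
    truncate because n is at least 1024 and d at most n/512.\<close>
  define j where "j = (n - d) div 3 - 2"
  have big: "2 \<le> \<delta>^3 * real (card (fvec n))"
  proof -
    have "real n \<le> real (5 ^ n)" using less_exp[of n] power_mono[of "2::nat" 5 n] by (intro of_nat_mono) linarith
    have "y^3 \<le> y^234050" using y by (intro power_increasing) auto
    also have "\<dots> \<le> n" using n by (simp add: y_def x_def)
    also have "\<dots> \<le> real (5 ^ n)" by fact
    finally have "x^3 * y^3 \<le> x^3 * real (5^n)" using x by (intro mult_left_mono) auto
    hence "1 \<le> x^3 * real (5^n)" by (simp only: xy)
    moreover have "\<delta>^3 = 8 * x^3" by (simp add: x_def power_divide)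
    ultimately show ?thesis by (simp only: cV)
  qed
  have \<sigma>: "x^32 \<le> (\<delta>^4/8)^8 / 2"
  proof -
    have "\<delta> = 2 * x" by (simp add: x_def)
    hence "(\<delta>^4/8)^8 / 2 = 128 * x^32" by (simp add: power_mult_distrib power_divide flip: power_mult)
    moreover have "0 \<le> x^32" using x by simp
    ultimately show ?thesis by linarith
  qed
  have \<beta>: "x^116987 \<le> ((x^32)^5)^721 / (12 * 2^1623)"
  proof -
    define q :: real where "q = 2^1623"
    have q: "q > 0" by (simp only: q_def zero_less_power zero_less_numeral)
    have "x^1623 \<le> (1/2)^1623" using x by (intro power_mono) auto
    hence x1: "x^1623 \<le> 1 / q" by (simp only: q_def power_one_over)
    have "x^4 \<le> (1/2)^4" using x by (intro power_mono) auto
    hence x2: "x^4 \<le> 1/12" by (simp add: power_one_over)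
    have "x^1623 * x^4 \<le> 1 / q * (1/12)" using x1 x2 x q by (intro mult_mono) auto
    hence "x^115360 * (x^1623 * x^4) \<le> x^115360 * (1 / q * (1/12))" using x by (intro mult_left_mono) auto
    moreover have "x^116987 = x^115360 * (x^1623 * x^4)" by (simp flip: power_add)
    moreover have "((x^32)^5)^721 = x^115360" by (simp flip: power_mult)
    moreover have "b * (1 / q * (1/12)) = b / (12 * q)" for b by simp
    ultimately have "x^116987 \<le> ((x^32)^5)^721 / (12 * q)" by (simp only:)
    thus ?thesis unfolding q_def .
  qed
  have \<kappa>: "3 * x^117053 \<le> x^32 * (x^116987 * x^32)"
  proof -
    have "x^2 \<le> (1/2)^2" using x by (intro power_mono) auto
    hence "3 * x^2 \<le> 1" by (simp add: power_one_over)
    hence "x^117051 * (3 * x^2) \<le> x^117051 * 1" using x by (intro mult_left_mono) auto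
    moreover have "x^117053 = x^117051 * x^2" by (simp flip: power_add)
    moreover have "x^32 * (x^116987 * x^32) = x^117051" by (simp flip: power_add)
    ultimately show ?thesis by linarith
  qed
  have dd: "4 / (x^116987 * x^32)^2 \<le> real d"
  proof -
    have "(x^116987 * x^32)^2 = x^234038" by (simp flip: power_add power_mult)
    hence "4 / (x^116987 * x^32)^2 = 4 * y^234038" by (simp add: y_def power_one_over)
    also have "\<dots> \<le> y^2 * y^234038" using y power_mono[of 2 y 2] by (intro mult_right_mono) auto
    also have "\<dots> = Y" unfolding Y_def by (simp flip: power_add)
    finally show ?thesis using d by linarith
  qed
  have jj: "125^(j+2) * 5^d \<le> card (fvec n)"
  proof -
    have "(125::nat)^(j+2) * 5^d = 5^(3 * (j+2) + d)" by (simp only: power_add power_mult) simp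
    also have "\<dots> \<le> 5^n"
    proof (rule power_increasing)
      have "(n - d) div 3 \<ge> 2" using dn n1024 by linarith
      hence "j + 2 = (n - d) div 3" by (simp add: j_def)
      hence "3 * (j + 2) \<le> n - d" using times_div_less_eq_dividend[of 3 "n - d"] by (simp only:)
      moreover have "d \<le> n" using dn by linarith
      ultimately show "3 * (j + 2) + d \<le> n" by linarith
    qed simp
    finally show ?thesis using cV by simp
  qed
  have \<delta>': "card A = \<delta> * real (card (fvec n))" using \<delta> cV by simp
  have pos: "0 < x^32" "x^32 \<le> 1" "0 < x^116987" "0 < x^117053" 
    using x by (auto intro: power_le_one)
  from fvec.density_increment[OF A(1,2) \<delta>' big pos(1) \<sigma> pos(2) pos(3) \<beta> pos(4) \<kappa> dd jj]
  obtain s W where s: "s \<in> fvec n" and W: "W \<subseteq> fvec n" "fin_subgroup W" "2^j \<le> 5 * card W"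
    and inc: "card {u\<in>W. s + u \<in> A} \<ge> (\<delta> + x^117053) * card W" by (elim bexE exE conjE)
  obtain m B where B: "B \<subseteq> fvec m" "fvec.ap4_free m B" and cW: "card W = 5 ^ m" and cB: "card B = card {u\<in>W. s + u \<in> A}"
    using ap4_free_transfer[OF W(2,1) s A(2)] by (elim exE conjE)
  \<comment> \<open>If \<open>W\<close> were everything, the density on its coset would be \<delta>,
    without increment. The strict decrease drives the induction that follows.\<close>
  have "m < n"
  proof (rule ccontr)
    assume "\<not> m < n"
    hence "(5::nat)^n \<le> 5^m" by (intro power_increasing) auto
    hence "card (fvec n) \<le> card W" using cV cW by simp
    hence WV: "W = fvec n" using W(1) cV(2) by (meson card_seteq)
    have "real (card {u\<in>W. s + u \<in> A}) = (\<Sum>u\<in>fvec n. of_bool (s + u \<in> A))"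
      unfolding WV using cV(2) by (rule card_sum_of_bool)
    also have "\<dots> = (\<Sum>u\<in>fvec n. of_bool (u \<in> A))"
      by (rule sum_shift'[OF fin_subgroup_fvec s, where f="\<lambda>u. of_bool (u \<in> A)"])
    also have "\<dots> = real (card {u\<in>fvec n. u \<in> A})" unfolding card_sum_of_bool[OF cV(2)] ..
    also have "{u\<in>fvec n. u \<in> A} = A" using A(1) by auto
    finally have "real (card {u\<in>W. s + u \<in> A}) = \<delta> * card W" unfolding \<delta>' WV .
    hence "(\<delta> + x^117053) * card W \<le> \<delta> * card W" using inc by linarith
    moreover have "real (card W) > 0" using fin_subgroup_card[OF W(2)] by simp
    ultimately show False using pos(4) by simp
  qed
  moreover have "n \<le> 36 * m"
  proof -
    have "(2::nat)^j \<le> 5 * 5^m" using W(3) cW by simp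
    also have "\<dots> = 5^(m+1)" by simp
    also have "\<dots> \<le> (2^3)^(m+1)" by (intro power_mono) auto
    also have "\<dots> = 2^(3 * (m+1))" by (simp only: power_mult)
    finally have "j \<le> 3 * (m+1)" by (rule power_le_imp_le_exp[rotated]) simp
    hence "(n - d) div 3 \<le> 3 * m + 5" unfolding j_def le_diff_conv by simp
    hence "n - d < 9 * m + 18" by presburger
    thus ?thesis using dn n1024 by linarith
  qed
  moreover have "card B \<ge> (\<delta> + (\<delta> / 2) ^ 117053) * 5^m" using inc cB cW by (simp add: x_def)
  ultimately show ?thesis using B by (intro exI[of _ m] exI[of _ B] conjI)
qed

text \<open>Let D be the inverse density. A step lowers ln n by at most ln 36, and the potential C
  D^P by at least 36, so the inequality is inherited from the smaller space. When n is too small for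
  a step, it is bounded by a power of D outright.\<close>

lemma ln_dim_bound:
  "\<exists>C>0. \<forall>n A. A \<subseteq> fvec n \<longrightarrow> fvec.ap4_free n A \<longrightarrow> A \<noteq> {} \<longrightarrow> 1 \<le> n \<longrightarrow>
     ln (real n) \<le> C * (5^n / real (card A)) ^ 2^21"
proof -
  define K :: nat where "K = 117053"
  define Q :: nat where "Q = 234050"
  define P :: nat where "P = 2^21"
  have KP: "K \<le> P + 1" "Q \<le> P" "1 \<le> P" "1 \<le> K" by (simp_all add: K_def Q_def P_def)
  \<comment> \<open>The first summand serves the case n < (2D)^Q. The second makes the potential
    drop at least 36: the density grows by the factor 1 + u with u = \<kappa> D and \<kappa> =
    (2D)^(-K), and D^P u/2 \<ge> 1/(2 * 2^K) because K \<le> P + 1.\<close>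
  define C :: real where "C = 2^Q + 72 * 2^K"
  have C0: "C > 0" by (simp add: C_def add_pos_pos)
  have "ln (real n) \<le> C * (5^n / real (card A)) ^ P"
    if "A \<subseteq> fvec n" "fvec.ap4_free n A" "A \<noteq> {}" "1 \<le> n" for n A
    using that
  proof (induction n arbitrary: A rule: less_induct)
    case (less n)
    define D where "D = 5^n / real (card A)"
    have cV: "card (fvec n) = 5 ^ n" "finite (fvec n)" using fvec_finite_card by auto
    have cA: "card A > 0" using less.prems cV by (simp add: card_gt_0_iff finite_subset)
    have "card A \<le> 5^n" using less.prems(1) cV by (metis card_mono)
    hence "real (card A) \<le> 5^n" by (simp only: of_nat_le_iff[symmetric, where 'a=real] of_nat_power of_nat_numeral)
    hence D1: "D \<ge> 1" using cA by (simp add: D_def)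
    define \<delta> where "\<delta> = 1 / D"
    have \<delta>: "card A = \<delta> * 5^n" using cA by (simp add: \<delta>_def D_def)
    have \<delta>0: "0 < \<delta>" "\<delta> \<le> 1" using D1 by (auto simp: \<delta>_def)
    have n0: "real n > 0" using less.prems by simp
    show ?case
    proof (cases "(2 / \<delta>) ^ Q \<le> real n")
      case False
      have "ln (real n) \<le> real n" using n0 ln_less_self by (simp add: less_imp_le)
      also have "\<dots> \<le> (2 * D) ^ Q" using False by (simp add: \<delta>_def)
      also have "\<dots> = 2^Q * D^Q" by (rule power_mult_distrib)
      also have "\<dots> \<le> C * D^P" using D1 KP by (intro mult_mono power_increasing) (auto simp: C_def)
      finally show ?thesis by (simp add: D_def)
    next
      case True
      define \<kappa> where "\<kappa> = (\<delta> / 2) ^ K"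
      from ap4_free_density_step[OF less.prems(1-3) \<delta> True[unfolded Q_def]]
      obtain m B where m: "m < n" "n \<le> 36 * m" and B: "B \<subseteq> fvec m" "fvec.ap4_free m B"
        and cB: "card B \<ge> (\<delta> + \<kappa>) * 5^m" unfolding K_def[symmetric] \<kappa>_def[symmetric] by (elim exE conjE)
      have \<kappa>0: "\<kappa> > 0" using \<delta>0 by (simp add: \<kappa>_def)
      have "0 < (\<delta> + \<kappa>) * 5^m" using \<delta>0 \<kappa>0 by simp
      hence cB0: "real (card B) > 0" using cB by linarith
      hence Bne: "B \<noteq> {}" by auto
      have m1: "1 \<le> m" using m less.prems by linarith
      define u where "u = \<kappa> * D"
      have u0: "u > 0" using \<kappa>0 D1 by (simp add: u_def)
      have "\<kappa> \<le> (\<delta> / 2) ^ 1" unfolding \<kappa>_def using \<delta>0 KP by (intro power_decreasing) auto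
      hence "\<kappa> \<le> \<delta>" using \<delta>0 by simp
      hence u1: "u \<le> 1" using D1 by (simp add: u_def \<delta>_def field_simps)
      have "5^m / real (card B) \<le> 1 / (\<delta> + \<kappa>)"
        using cB cB0 \<delta>0 \<kappa>0 by (simp add: field_simps)
      also have "\<dots> = D / (1 + u)" using D1 by (simp add: \<delta>_def u_def field_simps)
      finally have "(5^m / real (card B)) ^ P \<le> (D / (1 + u)) ^ P" by (intro power_mono) auto
      also have "\<dots> = D^P / (1 + u)^P" by (rule power_divide)
      \<comment> \<open>A single factor 1 + u suffices for the required drop.\<close>
      also have "\<dots> \<le> D^P / (1 + u)^1" using D1 u0 KP by (intro divide_left_mono power_increasing) auto
      finally have le: "(5^m / real (card B)) ^ P \<le> D^P / (1 + u)" by simp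
      have "C * (5^m / real (card B)) ^ P \<le> C * (D^P / (1 + u))" using le C0 by (intro mult_left_mono) auto
      also have "D^P / (1 + u) = D^P - D^P * (u / (1 + u))" using u0 by (simp add: field_simps)
      finally have "C * (5^m / real (card B)) ^ P \<le> C * D^P - C * (D^P * (u / (1 + u)))" by (simp add: right_diff_distrib)
      moreover have "36 \<le> C * (D^P * (u / (1 + u)))"
      proof -
        have "(2 * D)^K * \<kappa> = 1"
          unfolding \<kappa>_def power_mult_distrib[symmetric] using D1 by (simp add: \<delta>_def)
        moreover have "0 < 2^K * D^K" using D1 by simp
        ultimately have \<kappa>eq: "\<kappa> = 1 / (2^K * D^K)"
          using D1 by (simp add: power_mult_distrib field_simps)
        have "D^K \<le> D^(P+1)" using D1 KP by (intro power_increasing) auto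
        moreover have "0 < D^K" using D1 by simp
        ultimately have "1 \<le> D^(P+1) / D^K" by simp
        hence "(72 * 2^K) * (1 / (2 * 2^K)) \<le> (72 * 2^K) * ((D^(P+1) / D^K) / (2 * 2^K))"
          by (intro mult_left_mono divide_right_mono) auto
        moreover have "(72 * 2^K) * (1 / (2 * 2^K :: real)) = 36" by simp
        moreover have "(D^(P+1) / D^K) / (2 * 2^K) = D^P * (u / 2)" by (simp add: u_def \<kappa>eq mult_ac)
        ultimately have "36 \<le> (72 * 2^K) * (D^P * (u / 2))" by (simp only:)
        also have "\<dots> \<le> C * (D^P * (u / (1 + u)))"
          using D1 u0 u1 C0 by (intro mult_mono divide_left_mono) (auto simp: C_def)
        finally show ?thesis .
      qed
      moreover have "ln (real m) \<le> C * (5^m / real (card B)) ^ P"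
        using less.IH[OF m(1) B Bne m1] .
      moreover have "ln (real n) \<le> 36 + ln (real m)"
      proof -
        have "ln (real n) \<le> ln (36 * real m)" using m(2) n0 m1 by (subst ln_le_cancel_iff) auto
        also have "\<dots> = ln 36 + ln (real m)" using m1 by (simp add: ln_mult)
        finally have "ln (real n) \<le> ln 36 + ln (real m)" .
        moreover have "ln 36 < (36::real)" by (rule ln_less_self) simp
        ultimately show ?thesis by linarith
      qed
      ultimately show ?thesis unfolding D_def[symmetric] by linarith
    qed
  qed
  thus ?thesis using C0 unfolding P_def by blast
qed

section \<open>Transfer to the group of the statement\<close>

text \<open>Elements of the product group are undefined at indices from n on, whereas vectors of
  \<open>fvec n\<close> vanish there.\<close>

definition to_fvec :: "nat \<Rightarrow> (nat \<Rightarrow> int) \<Rightarrow> nat \<Rightarrow> F5" where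
  "to_fvec n f i = (if i < n then of_int (f i) else 0)"

lemma of_int_F5_mod: "(of_int (z mod 5) :: F5) = of_int z"
  using bit1.of_int_eq[where 'a="1 bit0", of z] bit1.of_int_eq[where 'a="1 bit0", of "z mod 5"] by simp

lemma to_fvec_bij: "bij_betw (to_fvec n) (carrier (F5_space n)) (fvec n)"
proof -
  have sub: "to_fvec n ` carrier (F5_space n) \<subseteq> fvec n" by (auto simp: to_fvec_def fvec_def)
  have inj: "inj_on (to_fvec n) (carrier (F5_space n))"
  proof (rule inj_onI)
    fix f g assume fg: "f \<in> carrier (F5_space n)" "g \<in> carrier (F5_space n)" "to_fvec n f = to_fvec n g"
    have F: "f \<in> (\<Pi>\<^sub>E i\<in>{..<n}. {0..<5})" "g \<in> (\<Pi>\<^sub>E i\<in>{..<n}. {0..<5})"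
      using fg(1,2) by (simp_all add: F5_space_def carrier_integer_mod_group)
    have "f i = g i" if i: "i \<in> {..<n}" for i
    proof -
      have "of_int (f i) = (of_int (g i) :: F5)" using fun_cong[OF fg(3), of i] i by (simp add: to_fvec_def)
      hence "Rep_bit1 (of_int (f i) :: F5) = Rep_bit1 (of_int (g i) :: F5)" by simp
      hence "f i mod 5 = g i mod 5"
        using bit1.of_int_eq[where 'a="1 bit0"] bit1.Rep_Abs_mod[where 'a="1 bit0"] by simp
      moreover have "f i \<in> {0..<5}" "g i \<in> {0..<5}" using PiE_mem[OF F(1) i] PiE_mem[OF F(2) i] .
      ultimately show ?thesis by simp
    qed
    thus "f = g" by (rule PiE_ext[OF F])
  qed
  have "card (to_fvec n ` carrier (F5_space n)) = card (fvec n)"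
    using card_image[OF inj] order_F5_space[of n] fvec_finite_card[of n] by (simp add: Coset.order_def)
  hence "to_fvec n ` carrier (F5_space n) = fvec n" using sub fvec_finite_card by (intro card_subset_eq) auto
  thus ?thesis using inj by (simp add: bij_betw_def)
qed

lemma to_fvec_mult: "to_fvec n (f \<otimes>\<^bsub>F5_space n\<^esub> g) = to_fvec n f + to_fvec n g"
  by (rule ext) (simp add: to_fvec_def F5_space_def of_int_F5_mod)

lemma to_fvec_pow: "to_fvec n (f [^]\<^bsub>F5_space n\<^esub> (k::nat)) = of_nat k * to_fvec n f"
proof (induction k)
  case 0
  show ?case by (rule ext) (simp add: to_fvec_def F5_space_def zero_fun_def nat_pow_def)
next
  case (Suc k)
  have "f [^]\<^bsub>F5_space n\<^esub> Suc k = f [^]\<^bsub>F5_space n\<^esub> k \<otimes>\<^bsub>F5_space n\<^esub> f"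
    by (simp add: nat_pow_def)
  thus ?case using Suc by (simp add: to_fvec_mult algebra_simps)
qed

text \<open>A progression with nonzero step among the images pulls back to one in the group. Its
  terms are distinct because those of the image are.\<close>

lemma ap4_free_to_fvec:
  assumes A: "A \<subseteq> carrier (F5_space n)" "\<not> contains_4AP (F5_space n) A"
  shows "fvec.ap4_free n (to_fvec n ` A)"
  unfolding fvec.ap4_free_def
proof (intro ballI impI, elim conjE, rule ccontr)
  interpret G: comm_group "F5_space n" by (rule comm_group_F5_space)
  let ?T = "to_fvec n"
  fix a b assume ab: "a \<in> fvec n" "b \<in> fvec n" and mem: "a \<in> ?T ` A" "a + b \<in> ?T ` A" "a + 2 * b \<in> ?T ` A" "a + 3 * b \<in> ?T ` A"
    and b0: "b \<noteq> 0"
  have inj: "inj_on ?T (carrier (F5_space n))" using to_fvec_bij by (simp add: bij_betw_def)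
  have surj: "?T ` carrier (F5_space n) = fvec n" using to_fvec_bij by (simp add: bij_betw_def)
  obtain x where x: "x \<in> carrier (F5_space n)" "?T x = a" using ab(1) surj by (metis imageE)
  obtain r where r: "r \<in> carrier (F5_space n)" "?T r = b" using ab(2) surj by (metis imageE)
  have inA: "z \<in> A" if "z \<in> carrier (F5_space n)" "?T z \<in> ?T ` A" for z
    using that A(1) inj by (metis inj_on_image_mem_iff)
  let ?x1 = "x \<otimes>\<^bsub>F5_space n\<^esub> r"
  let ?x2 = "x \<otimes>\<^bsub>F5_space n\<^esub> (r [^]\<^bsub>F5_space n\<^esub> (2::nat))"
  let ?x3 = "x \<otimes>\<^bsub>F5_space n\<^esub> (r [^]\<^bsub>F5_space n\<^esub> (3::nat))"
  have T: "?T ?x1 = a + b" "?T ?x2 = a + 2 * b" "?T ?x3 = a + 3 * b"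
    using x r by (simp_all add: to_fvec_mult to_fvec_pow)
  have "x \<in> A" "?x1 \<in> A" "?x2 \<in> A" "?x3 \<in> A"
    using mem x r T by (auto intro!: inA)
  moreover have "distinct [a, a + b, a + 2 * b, a + 3 * b]"
  proof -
    \<comment> \<open>Since 6 = 1, neither 2b nor 3b can vanish for nonzero b.\<close>
    have six: "b = 3 * (2 * b)" "b = 2 * (3 * b)" using fvec.six by (simp_all add: mult.assoc[symmetric])
    have b2: "2 * b \<noteq> 0" using six(1) b0 by (metis mult_zero_right)
    have b3: "3 * b \<noteq> 0" using six(2) b0 by (metis mult_zero_right)
    have e3: "3 * b = b + 2 * b" and e2: "2 * b = b + b" by (simp_all add: algebra_simps)
    have "b \<noteq> 2 * b" unfolding e2 using b0 by (metis add_cancel_left_right)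
    moreover have "b \<noteq> 3 * b" "2 * b \<noteq> 3 * b" unfolding e3 using b0 b2 by (metis add_cancel_left_right add_cancel_left_left)+
    ultimately show ?thesis using b0 b2 b3 by (simp del: mult_eq_0_iff)
  qed
  hence "distinct [x, ?x1, ?x2, ?x3]" using x(2) T by auto
  ultimately have "distinct [x, ?x1, ?x2, ?x3] \<and> set [x, ?x1, ?x2, ?x3] \<subseteq> A" by simp
  hence "\<exists>r\<in>carrier (F5_space n). let P = [x, x \<otimes>\<^bsub>F5_space n\<^esub> r,
      x \<otimes>\<^bsub>F5_space n\<^esub> (r [^]\<^bsub>F5_space n\<^esub> (2::nat)), x \<otimes>\<^bsub>F5_space n\<^esub> (r [^]\<^bsub>F5_space n\<^esub> (3::nat))]
      in distinct P \<and> set P \<subseteq> A"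
    unfolding Let_def using r(1) by (rule bexI)
  hence "contains_4AP (F5_space n) A" unfolding contains_4AP_def using x(1) by (rule bexI)
  thus False using A(2) by simp
qed

lemma r4_attained:
  obtains A where "A \<subseteq> carrier (F5_space n)" "\<not> contains_4AP (F5_space n) A" "card A = r4 (F5_space n)"
proof -
  let ?S = "{card A | A. A \<subseteq> carrier (F5_space n) \<and> \<not> contains_4AP (F5_space n) A}"
  have "?S \<subseteq> {..card (carrier (F5_space n))}" using card_mono[OF finite_carrier_F5_space] by auto
  hence "finite ?S" by (rule finite_subset) simp
  moreover have "\<not> contains_4AP (F5_space n) {}" by (simp add: contains_4AP_def Let_def)
  hence "?S \<noteq> {}" by blast
  ultimately have "Max ?S \<in> ?S" by (rule Max_in)
  thus ?thesis using that unfolding r4_def by auto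
qed

theorem theorem7p1:
  shows "\<exists>C::real. C > 0 \<and>
    (\<forall>n::nat. n \<ge> 1 \<longrightarrow>
      real (r4 (F5_space n)) \<le> C * 5 ^ n * (ln (ln (5 ^ n))) powr (- (1 / 2 ^ 21)))"
proof -
  obtain C where C: "C > 0" "\<And>n A. A \<subseteq> fvec n \<Longrightarrow> fvec.ap4_free n A \<Longrightarrow> A \<noteq> {} \<Longrightarrow> 1 \<le> n \<Longrightarrow>
     ln (real n) \<le> C * (5^n / real (card A)) ^ 2^21"
    using ln_dim_bound by blast
  define P :: nat where "P = 2^21"
  have P0: "P > 0" by (simp add: P_def)
  have "real (r4 (F5_space n)) \<le> (C + 4) powr (1 / P) * 5 ^ n * (ln (ln (5 ^ n))) powr (- (1 / P))"
    if n: "n \<ge> 1" for n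
  proof -
    obtain A where A: "A \<subseteq> carrier (F5_space n)" "\<not> contains_4AP (F5_space n) A" "card A = r4 (F5_space n)"
      using r4_attained .
    show ?thesis
    proof (cases "A = {}")
      case True
      thus ?thesis using A(3) by simp
    next
      case False
      let ?B = "to_fvec n ` A"
      have "inj_on (to_fvec n) A" using to_fvec_bij A(1) by (meson bij_betw_def inj_on_subset)
      hence cB: "card ?B = card A" by (rule card_image)
      have B: "?B \<subseteq> fvec n" using to_fvec_bij A(1) by (metis bij_betw_imp_surj_on image_mono)
      have finA: "finite A" using A(1) finite_carrier_F5_space finite_subset by blast
      define D where "D = 5^n / real (card A)"
      have cA: "real (card A) > 0" using False finA by (simp add: card_gt_0_iff)
      have "card A \<le> card (carrier (F5_space n))" using A(1) finite_carrier_F5_space by (rule card_mono[rotated])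
      hence "card A \<le> 5^n" using order_F5_space[of n] by (simp add: Coset.order_def)
      hence "real (card A) \<le> 5^n" by (simp only: of_nat_le_iff[symmetric, where 'a=real] of_nat_power of_nat_numeral)
      hence D1: "D \<ge> 1" using cA by (simp add: D_def)
      have 1: "ln (real n) \<le> C * D ^ P"
        using C(2)[OF B ap4_free_to_fvec[OF A(1,2)] _ n] False cB by (simp add: D_def P_def)
      \<comment> \<open>This makes the iterated logarithm positive for every n, including n = 1,
        where ln n vanishes.\<close>
      have ln5: "ln 5 > (1::real)"
      proof -
        have "exp 1 < (5::real)" using exp_le by linarith
        thus ?thesis by (subst ln_exp[of 1, symmetric], subst ln_less_cancel_iff) auto
      qed
      define l where "l = ln (ln (5 ^ n :: real))"
      have l: "l = ln (real n) + ln (ln 5)" using n ln5 by (simp add: l_def ln_realpow ln_mult)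
      have "ln (ln 5 :: real) > 0" using ln5 by simp
      hence l0: "l > 0" using l n by (simp add: add_nonneg_pos)
      have "ln (ln 5 :: real) \<le> ln 5" using ln5 ln_less_self[of "ln 5 :: real"] by linarith
      also have "ln 5 \<le> (4::real)" using ln_le_minus_one[of "5::real"] by simp
      \<comment> \<open>The constant ln ln 5 is bounded by 4 and then absorbed into the power of D,
        as D is at least 1; this is the source of C + 4.\<close>
      finally have "l \<le> C * D^P + 4 * 1" using l 1 by linarith
      also have "\<dots> \<le> C * D^P + 4 * D^P" using D1 by (intro add_left_mono mult_left_mono one_le_power) auto
      finally have lD: "l \<le> (C + 4) * D^P" by (simp add: distrib_right)
      have "l powr (1 / P) \<le> ((C + 4) * D^P) powr (1 / P)" using lD l0 by (intro powr_mono2) auto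
      also have "\<dots> = (C + 4) powr (1 / P) * (D^P) powr (1 / P)" using C(1) D1 by (intro powr_mult)
      also have "(D^P) powr (1 / P) = D" using D1 P0 by (simp add: powr_powr flip: powr_realpow)
      finally have "l powr (1 / P) \<le> (C + 4) powr (1 / P) * D" .
      hence "l powr (1 / P) * card A \<le> (C + 4) powr (1 / P) * 5^n"
        using cA by (simp add: D_def field_simps)
      hence "card A \<le> (C + 4) powr (1 / P) * 5^n * l powr (- (1 / P))"
        using l0 by (simp add: powr_minus field_simps)
      thus ?thesis using A(3) by (simp add: l_def)
    qed
  qed
  moreover have "(C + 4) powr (1 / P) > 0" using C(1) by simp
  ultimately show ?thesis
    by (intro exI[of _ "(C + 4) powr (1 / P)"]) (simp add: P_def)
qed

end
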